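(* Let $i\in\{0,1\}$. The lattice $\mathcal L_i=\bigoplus_{\lambda,m}\mathbb Z[q,q^{-1}]\,s_\lambda e^{m\alpha}e^{i\alpha/2}$ ($\lambda$ running over all partitions, $m$ over $\mathbb Z$) is invariant under the action of the divided powers $X_n^{\pm(r)}=(X_n^{\pm})^r/[r]!$ ($n\in\mathbb Z$, $r\in\mathbb N$). More precisely, for every partition $\mu$ and $m\in\mathbb Z$, $$X_n^{+(r)}s_\mu e^{m\alpha}e^{i\alpha/2}=q^{-3\binom r2-r(n+1+2m+i)}\sum_{l(\lambda)\le r}q^{-2|\lambda|}\,s_\lambda\cdot s_{(-\lambda-2\delta-(n+1+2m+i)\mathbf 1,\ \mu)}\,e^{(m+r)\alpha}e^{i\alpha/2},$$ $$X_n^{-(r)}s_{\mu'} e^{m\alpha}e^{i\alpha/2}=(-1)^{r(n+1+i)}q^{\binom r2}\sum_{l(\lambda)\le r}q^{2|\lambda|}\,s_{\lambda'}\cdot s_{(-\lambda-2\delta-(n+1-2m-i)\mathbf 1,\ \mu)'}\,e^{(m-r)\alpha}e^{i\alpha/2},$$ where the sums run over all partitions $\lambda$ of length $\le r$ (viewed in $\mathbb Z^r$ by adding zeros), $\delta=(r-1,r-2,\dots,0)$ and $\mathbf 1=(1,\dots,1)\in\mathbb Z^r$.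
   Context: $q$ is an indeterminate; $[n]=\frac{q^n-q^{-n}}{q-q^{-1}}$, $[r]!=[r][r-1]\cdots[1]$. Fock space: let $\{a_n\mid n\ne0\}$ generate the Heisenberg algebra with $[a_m,a_n]=\delta_{m,-n}\frac{m}{1+q^{2|m|}}$, acting on $\mathrm{Sym}(a_{-n}\text{'s}, n\ge1)$ in the standard way ($a_{-n}$ by multiplication, $a_n\cdot1=0$ for $n\ge1$). The Fock space is $\mathrm{Sym}(a_{-n}\text{'s})\otimes\mathbb C[\mathbb Z\alpha]e^{i\alpha/2}$, where $\mathbb C[\mathbb Z\alpha]e^{i\alpha/2}$ has basis $e^{m\alpha}e^{i\alpha/2}$, $m\in\mathbb Z$ (scalars contain $\mathbb Q(q^{1/2})$). $\mathrm{Sym}(a_{-n}\text{'s})$ is identified with the ring of symmetric functions by $a_{-n}\mapsto p_n$ (power sums); $s_\lambda$ is the Schur function, and $\cdot$ is the product of symmetric functions. Operators: $e^{n\alpha}\cdot e^{m\alpha}e^{i\alpha/2}=e^{(m+n)\alpha}e^{i\alpha/2}$, $\partial\cdot e^{m\alpha}e^{i\alpha/2}=(2m+i)e^{m\alpha}e^{i\alpha/2}$. The operators $X_n^\pm$ are defined by $$X^+(z)=\exp\Bigl(\sum_{n\ge1}\tfrac{(1+q^{2n})q^{-n}}{n}a_{-n}z^n\Bigr)\exp\Bigl(-\sum_{n\ge1}\tfrac{(1+q^{2n})q^{-n}}{n}a_nz^{-n}\Bigr)e^{\alpha}z^{\partial}=\sum_{n\in\mathbb Z}X_n^+z^{-n-1},$$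 $$X^-(z)=\exp\Bigl(-\sum_{n\ge1}\tfrac{1+q^{2n}}{n}a_{-n}z^n\Bigr)\exp\Bigl(\sum_{n\ge1}\tfrac{1+q^{2n}}{n}a_nz^{-n}\Bigr)e^{-\alpha}z^{-\partial}=\sum_{n\in\mathbb Z}X_n^-z^{-n-1}.$$ Schur functions of tuples: $l(\lambda)$, $|\lambda|$, $\lambda'$ denote length, weight and conjugate of a partition; $(\nu,\mu)$ denotes juxtaposition of tuples. For an integer tuple $\nu=(\nu_1,\dots,\nu_l)$ put $\delta_l=(l-1,\dots,1,0)$. If there is a permutation $\sigma\in\mathfrak S_l$ such that $\sigma(\nu+\delta_l)-\delta_l$ is a partition $\pi(\nu)$ (with nonnegative entries) and $\nu+\delta_l$ has distinct entries, then $s_\nu=(-1)^{l(\sigma)}s_{\pi(\nu)}$ and $s_{\nu'}=(-1)^{l(\sigma)}s_{\pi(\nu)'}$, where $l(\sigma)$ is the length of $\sigma$; in all other cases $s_\nu=s_{\nu'}=0$. (Thus in $s_{(\cdots)'}$ the permutation action is applied first and then the conjugation.) *)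

theory Defs
  imports
    "HOL-Library.Poly_Mapping"
    "HOL-Combinatorics.Permutations"
    "HOL-Computational_Algebra.Formal_Power_Series"
    "Jordan_Normal_Form.Determinant"
begin

section \<open>Sym of the negative Heisenberg generators\<close>

text \<open>
  Polynomials over \<open>'k\<close> in countably many variables.  The variables are indexed from \<open>0\<close>:
  variable number \<open>k\<close> is \<open>a\<^bsub>-(k+1)\<^esub>\<close>, i.e. the power sum \<open>p\<^bsub>k+1\<^esub>\<close>.
\<close>

type_synonym 'k sym = "(nat \<Rightarrow>\<^sub>0 nat) \<Rightarrow>\<^sub>0 'k"

definition psum :: "nat \<Rightarrow> 'k::field_char_0 sym" where
  "psum n = Poly_Mapping.single (Poly_Mapping.single (n - 1) 1) 1"

definition sym_const :: "'k::field_char_0 \<Rightarrow> 'k sym" where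
  "sym_const c = Poly_Mapping.single 0 c"

definition pd :: "nat \<Rightarrow> 'k::field_char_0 sym \<Rightarrow> 'k sym" where
  \<comment> \<open>partial derivative with respect to variable number \<open>k\<close>\<close>
  "pd k f = (\<Sum>m\<in>Poly_Mapping.keys f.
     Poly_Mapping.single (m - Poly_Mapping.single k 1)
       (of_nat (Poly_Mapping.lookup m k) * Poly_Mapping.lookup f m))"

definition subst_eval :: "(nat \<Rightarrow> 'k) \<Rightarrow> 'k::field_char_0 sym \<Rightarrow> 'k" where
  "subst_eval y f = (\<Sum>m\<in>Poly_Mapping.keys f. Poly_Mapping.lookup f m *
     (\<Prod>k\<in>Poly_Mapping.keys m. y k ^ Poly_Mapping.lookup m k))"

text \<open>
  The operator \<open>a\<^sub>n\<close> on Sym, for \<open>n \<noteq> 0\<close> (the value at \<open>n = 0\<close> is not used).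
  See \<open>heis_commutator\<close> and \<open>heis_vacuum\<close> below.
\<close>

definition heis :: "'k::field_char_0 \<Rightarrow> int \<Rightarrow> 'k sym \<Rightarrow> 'k sym" where
  "heis q n f =
     (if n < 0 then psum (nat (- n)) * f
      else if n > 0 then sym_const (of_int n / (1 + q powi (2 * n))) * pd (nat n - 1) f
      else 0)"

section \<open>Schur functions\<close>

text \<open>
  The symmetric function \<open>f\<close> (a polynomial in the power sums) evaluated at
  \<open>x\<^sub>0, \<dots>, x\<^bsub>N-1\<^esub>, 0, 0, \<dots>\<close>.  The field has characteristic \<open>0\<close>, hence is infinite, so a
  symmetric function is determined by all these values; see \<open>schur_ex1\<close>.
\<close>

definition sym_eval :: "nat \<Rightarrow> (nat \<Rightarrow> 'k::field_char_0) \<Rightarrow> 'k sym \<Rightarrow> 'k" where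
  "sym_eval N x f = subst_eval (\<lambda>k. \<Sum>i<N. x i ^ (k + 1)) f"

text \<open>
  A partition is a weakly decreasing list of nonnegative integers; trailing zeros are allowed
  and do not affect any of the notions below.
\<close>

definition is_partition :: "int list \<Rightarrow> bool" where
  "is_partition xs \<longleftrightarrow> sorted_wrt (\<ge>) xs \<and> (\<forall>x\<in>set xs. 0 \<le> x)"

definition part :: "int list \<Rightarrow> nat \<Rightarrow> int" where
  "part xs j = (if j < length xs then xs ! j else 0)"

definition conj_part :: "int list \<Rightarrow> int list" where
  "conj_part xs = map (\<lambda>j. int (length (filter (\<lambda>x. j \<le> x) xs))) [1..part xs 0]"

definition alternant :: "nat \<Rightarrow> (nat \<Rightarrow> 'k::field_char_0) \<Rightarrow> (nat \<Rightarrow> nat) \<Rightarrow> 'k" where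
  "alternant N x \<alpha> = det (mat N N (\<lambda>(i, j). x i ^ \<alpha> j))"

text \<open>
  \<open>s\<^sub>\<lambda>\<close> is the symmetric function that restricts, in every number \<open>N \<ge> l(\<lambda>)\<close> of variables,
  to the quotient of alternants \<open>a\<^bsub>\<lambda>+\<delta>\<^esub> / a\<^bsub>\<delta>\<^esub>\<close>.  For a partition there is exactly one such \<open>f\<close>
  (\<open>schur_ex1\<close>), namely the Jacobi-Trudi determinant (\<open>schur_eq_jacobi_trudi\<close>).
\<close>

definition is_schur :: "int list \<Rightarrow> 'k::field_char_0 sym \<Rightarrow> bool" where
  "is_schur xs f \<longleftrightarrow> (\<forall>N\<ge>length xs. \<forall>x.
     sym_eval N x f * alternant N x (\<lambda>j. N - 1 - j) =
     alternant N x (\<lambda>j. nat (part xs j) + (N - 1 - j)))"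

definition schur :: "int list \<Rightarrow> 'k::field_char_0 sym" where
  "schur xs = (THE f. is_schur xs f)"

text \<open>
  \<open>straight_act \<nu> \<sigma>\<close> is \<open>\<sigma>(\<nu> + \<delta>) - \<delta>\<close>.
\<close>

definition add_delta :: "int list \<Rightarrow> int list" where
  "add_delta \<nu> = map (\<lambda>j. \<nu> ! j + (int (length \<nu>) - 1 - int j)) [0..<length \<nu>]"

definition straight_act :: "int list \<Rightarrow> (nat \<Rightarrow> nat) \<Rightarrow> int list" where
  "straight_act \<nu> \<sigma> =
     map (\<lambda>j. add_delta \<nu> ! \<sigma> j - (int (length \<nu>) - 1 - int j)) [0..<length \<nu>]"

definition straightens :: "int list \<Rightarrow> (nat \<Rightarrow> nat) \<Rightarrow> bool" where
  "straightens \<nu> \<sigma> \<longleftrightarrow> \<sigma> permutes {..<length \<nu>} \<and> distinct (add_delta \<nu>) \<and>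
     is_partition (straight_act \<nu> \<sigma>)"

text \<open>
  \<open>s\<^sub>\<nu>\<close> and \<open>s\<^bsub>\<nu>'\<^esub>\<close> for an arbitrary integer tuple; \<open>sign \<sigma> = (-1)\<^bsup>l(\<sigma>)\<^esup>\<close>.
  The permutation is unique if it exists (\<open>straightens_unique\<close>).
\<close>

definition schur_tuple :: "int list \<Rightarrow> 'k::field_char_0 sym" where
  "schur_tuple \<nu> =
     (if \<exists>\<sigma>. straightens \<nu> \<sigma>
      then let \<sigma> = THE \<sigma>. straightens \<nu> \<sigma>
           in of_int (sign \<sigma>) * schur (straight_act \<nu> \<sigma>)
      else 0)"

definition schur_tuple_conj :: "int list \<Rightarrow> 'k::field_char_0 sym" where
  "schur_tuple_conj \<nu> =
     (if \<exists>\<sigma>. straightens \<nu> \<sigma>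
      then let \<sigma> = THE \<sigma>. straightens \<nu> \<sigma>
           in of_int (sign \<sigma>) * schur (conj_part (straight_act \<nu> \<sigma>))
      else 0)"

section \<open>The Fock space\<close>

text \<open>
  \<open>Poly_Mapping.single m f\<close> is \<open>f \<otimes> e\<^bsup>m\<alpha>\<^esup> e\<^bsup>i\<alpha>/2\<^esup>\<close>.  The factor \<open>e\<^bsup>i\<alpha>/2\<^esup>\<close> is a mere label
  and is not recorded in the vector: \<open>i\<close> is a parameter of the operators below, which depend on
  it through \<open>\<partial>\<close>.  The type is also the group ring Sym\<open>[\<int>\<alpha>]\<close>, whose product serves to write
  scalar multiplication and \<open>e\<^bsup>n\<alpha>\<^esup>\<close>.
\<close>

type_synonym 'k fock = "int \<Rightarrow>\<^sub>0 'k sym"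

definition fscale :: "'k::field_char_0 \<Rightarrow> 'k fock \<Rightarrow> 'k fock" where
  "fscale c v = Poly_Mapping.single 0 (sym_const c) * v"

definition heis_fock :: "'k::field_char_0 \<Rightarrow> int \<Rightarrow> 'k fock \<Rightarrow> 'k fock" where
  "heis_fock q n v = Poly_Mapping.map (heis q n) v"

subsection \<open>Operator-valued formal distributions\<close>

text \<open>
  \<open>A :: 'k distr\<close> stands for \<open>\<Sum>\<^sub>k A\<^sub>k z\<^sup>k\<close>, \<open>k\<close> over all integers, with operators \<open>A\<^sub>k\<close> on the
  Fock space.  All sums arising from the distributions below are finite on each vector,
  since \<open>a\<^sub>n\<close> for \<open>n \<ge> 1\<close> lowers the degree by \<open>n\<close>.
\<close>

type_synonym 'k distr = "int \<Rightarrow> 'k fock \<Rightarrow> 'k fock"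

definition dmul :: "'k::field_char_0 distr \<Rightarrow> 'k distr \<Rightarrow> 'k distr" (infixr \<open>\<star>\<close> 70) where
  "(A \<star> B) k v = Sum_any (\<lambda>j. A (k - j) (B j v))"

definition dconst :: "('k::field_char_0 fock \<Rightarrow> 'k fock) \<Rightarrow> 'k distr" where
  "dconst T k v = (T v when k = 0)"

primrec dpow :: "'k::field_char_0 distr \<Rightarrow> nat \<Rightarrow> 'k distr" where
  "dpow A 0 = dconst id"
| "dpow A (Suc j) = A \<star> dpow A j"

definition dexp :: "'k::field_char_0 distr \<Rightarrow> 'k distr" where
  "dexp A k v = Sum_any (\<lambda>j. fscale (1 / fact j) (dpow A j k v))"

definition exp_alpha :: "int \<Rightarrow> 'k::field_char_0 fock \<Rightarrow> 'k fock" where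
  "exp_alpha n v = Poly_Mapping.single n 1 * v"

text \<open>
  \<open>z\<^bsup>\<epsilon>\<partial>\<^esup>\<close>: its coefficient of \<open>z\<^sup>k\<close> is the projection onto the span of the
  \<open>f \<otimes> e\<^bsup>m\<alpha>\<^esup> e\<^bsup>i\<alpha>/2\<^esup>\<close> with \<open>\<epsilon>(2m + i) = k\<close>.
\<close>

definition z_del :: "int \<Rightarrow> int \<Rightarrow> 'k::field_char_0 distr" where
  "z_del i \<epsilon> k v = (\<Sum>m\<in>Poly_Mapping.keys v.
     Poly_Mapping.single m (Poly_Mapping.lookup v m) when \<epsilon> * (2 * m + i) = k)"

text \<open>
  \<open>creation_series q c = \<Sum>\<^bsub>n\<ge>1\<^esub> c\<^sub>n a\<^bsub>-n\<^esub> z\<^sup>n\<close> and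
  \<open>annihilation_series q c = \<Sum>\<^bsub>n\<ge>1\<^esub> c\<^sub>n a\<^sub>n z\<^bsup>-n\<^esup>\<close>.
\<close>

definition creation_series :: "'k::field_char_0 \<Rightarrow> (int \<Rightarrow> 'k) \<Rightarrow> 'k distr" where
  "creation_series q c k v = (fscale (c k) (heis_fock q (- k) v) when k \<ge> 1)"

definition annihilation_series :: "'k::field_char_0 \<Rightarrow> (int \<Rightarrow> 'k) \<Rightarrow> 'k distr" where
  "annihilation_series q c k v = (fscale (c (- k)) (heis_fock q (- k) v) when - k \<ge> 1)"

definition X_plus_series :: "'k::field_char_0 \<Rightarrow> int \<Rightarrow> 'k distr" where
  "X_plus_series q i =
     dexp (creation_series q (\<lambda>n. (1 + q powi (2 * n)) * q powi (- n) / of_int n)) \<star>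
     dexp (annihilation_series q (\<lambda>n. - ((1 + q powi (2 * n)) * q powi (- n) / of_int n))) \<star>
     dconst (exp_alpha 1) \<star> z_del i 1"

definition X_minus_series :: "'k::field_char_0 \<Rightarrow> int \<Rightarrow> 'k distr" where
  "X_minus_series q i =
     dexp (creation_series q (\<lambda>n. - ((1 + q powi (2 * n)) / of_int n))) \<star>
     dexp (annihilation_series q (\<lambda>n. (1 + q powi (2 * n)) / of_int n)) \<star>
     dconst (exp_alpha (- 1)) \<star> z_del i (- 1)"

text \<open>\<open>X(z) = \<Sum>\<^sub>n X\<^sub>n z\<^bsup>-n-1\<^esup>\<close>.\<close>

definition X_plus :: "'k::field_char_0 \<Rightarrow> int \<Rightarrow> int \<Rightarrow> 'k fock \<Rightarrow> 'k fock" where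
  "X_plus q i n = X_plus_series q i (- n - 1)"

definition X_minus :: "'k::field_char_0 \<Rightarrow> int \<Rightarrow> int \<Rightarrow> 'k fock \<Rightarrow> 'k fock" where
  "X_minus q i n = X_minus_series q i (- n - 1)"

definition qint :: "'k::field_char_0 \<Rightarrow> nat \<Rightarrow> 'k" where
  "qint q n = (q powi (int n) - q powi (- int n)) / (q - q powi (- 1))"

definition qfact :: "'k::field_char_0 \<Rightarrow> nat \<Rightarrow> 'k" where
  "qfact q r = (\<Prod>k=1..r. qint q k)"

definition divided_power ::
    "'k::field_char_0 \<Rightarrow> ('k fock \<Rightarrow> 'k fock) \<Rightarrow> nat \<Rightarrow> 'k fock \<Rightarrow> 'k fock" where
  "divided_power q T r v = fscale (1 / qfact q r) ((T ^^ r) v)"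

section \<open>The integral lattice\<close>

text \<open>
  The \<open>\<int>[q, q\<^bsup>-1\<^esup>]\<close>-span of all \<open>s\<^sub>\<lambda> e\<^bsup>m\<alpha>\<^esup> e\<^bsup>i\<alpha>/2\<^esup>\<close>; in the present coordinates it does not
  depend on \<open>i\<close>.
\<close>

definition laurent_int :: "'k::field_char_0 \<Rightarrow> 'k set" where
  \<comment> \<open>\<open>\<int>[q, q\<^bsup>-1\<^esup>]\<close>\<close>
  "laurent_int q = {(\<Sum>k\<in>K. of_int (c k) * q powi k) | (c :: int \<Rightarrow> int) K. finite K}"

definition fock_lattice :: "'k::field_char_0 \<Rightarrow> 'k fock set" where
  "fock_lattice q = {(\<Sum>(xs, m)\<in>B. fscale (c (xs, m)) (Poly_Mapping.single m (schur xs)))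
     | B c. finite B \<and> B \<subseteq> {xs. is_partition xs} \<times> UNIV \<and> (\<forall>b\<in>B. c b \<in> laurent_int q)}"

section \<open>Index tuples of the right-hand sides\<close>

text \<open>
  Only finitely many \<open>\<lambda>\<close> contribute to the sums over \<open>partitions_upto r\<close> of terms containing
  \<open>schur_tuple (shifted_neg \<lambda> c @ \<mu>)\<close> or its conjugate version (\<open>finite_nonzero_terms\<close>),
  so \<open>Sum_any\<close> is the sum of the series.
\<close>

definition partitions_upto :: "nat \<Rightarrow> int list set" where
  \<comment> \<open>partitions of length at most \<open>r\<close>, padded with zeros to \<open>r\<close> entries\<close>
  "partitions_upto r = {xs. is_partition xs \<and> length xs = r}"

definition shifted_neg :: "int list \<Rightarrow> int \<Rightarrow> int list" where
  \<comment> \<open>\<open>-\<lambda> - 2\<delta> - c\<one>\<close>\<close>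
  "shifted_neg xs c =
     map (\<lambda>j. - (xs ! j) - 2 * (int (length xs) - 1 - int j) - c) [0..<length xs]"

section \<open>Well-definedness\<close>

subsection \<open>The Heisenberg relations\<close>

lemma sum_monomials:
  "(\<Sum>m\<in>Poly_Mapping.keys f. Poly_Mapping.single m (Poly_Mapping.lookup f m)) = f"
  by (rule poly_mapping_eqI)
     (auto simp: lookup_sum lookup_single when_def in_keys_iff if_distrib sum.delta cong: if_cong)

definition mon_eval :: "(nat \<Rightarrow> 'k::field_char_0) \<Rightarrow> (nat \<Rightarrow>\<^sub>0 nat) \<Rightarrow> 'k" where
  "mon_eval y m = (\<Prod>k\<in>Poly_Mapping.keys m. y k ^ Poly_Mapping.lookup m k)"

lemma mon_eval_superset:
  assumes "finite S" "Poly_Mapping.keys m \<subseteq> S"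
  shows "mon_eval y m = (\<Prod>k\<in>S. y k ^ Poly_Mapping.lookup m k)"
  unfolding mon_eval_def
  by (rule prod.mono_neutral_left) (use assms in \<open>auto simp: in_keys_iff\<close>)

lemma mon_eval_add: "mon_eval y (m + n) = mon_eval y m * mon_eval y n"
proof -
  let ?S = "Poly_Mapping.keys m \<union> Poly_Mapping.keys n"
  have f: "finite ?S" by simp
  show ?thesis
    using mon_eval_superset[OF f, of "m + n" y] mon_eval_superset[OF f, of m y]
      mon_eval_superset[OF f, of n y] Poly_Mapping.keys_add[of m n]
    by (auto simp: lookup_add power_add prod.distrib)
qed

lemma mon_eval_0 [simp]: "mon_eval y 0 = 1"
  by (simp add: mon_eval_def)

lemma mon_eval_single [simp]: "mon_eval y (Poly_Mapping.single k n) = y k ^ n"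
  by (cases "n = 0") (auto simp: mon_eval_def)

lemma subst_eval_superset:
  assumes "finite S" "Poly_Mapping.keys f \<subseteq> S"
  shows "subst_eval y f = (\<Sum>m\<in>S. Poly_Mapping.lookup f m * mon_eval y m)"
  unfolding subst_eval_def mon_eval_def[symmetric]
  by (rule sum.mono_neutral_left) (use assms in \<open>auto simp: in_keys_iff\<close>)

lemma subst_eval_add: "subst_eval y (f + g) = subst_eval y f + subst_eval y g"
proof -
  let ?S = "Poly_Mapping.keys f \<union> Poly_Mapping.keys g"
  have F: "finite ?S" by simp
  show ?thesis
    using subst_eval_superset[OF F, of "f + g" y] subst_eval_superset[OF F, of f y]
      subst_eval_superset[OF F, of g y] Poly_Mapping.keys_add[of f g]
    by (auto simp: lookup_add sum.distrib distrib_right)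
qed

lemma subst_eval_0 [simp]: "subst_eval y 0 = 0"
  by (simp add: subst_eval_def)

lemma subst_eval_single [simp]: "subst_eval y (Poly_Mapping.single m c) = c * mon_eval y m"
  by (cases "c = 0") (auto simp: subst_eval_def mon_eval_def)

lemma subst_eval_sum: "subst_eval y (sum g A) = (\<Sum>a\<in>A. subst_eval y (g a))"
  by (induction A rule: infinite_finite_induct) (auto simp: subst_eval_add)

lemma subst_eval_mult: "subst_eval y (f * g) = subst_eval y f * subst_eval y g"
proof -
  have "f * g = (\<Sum>m\<in>Poly_Mapping.keys f. Poly_Mapping.single m (Poly_Mapping.lookup f m)) *
      (\<Sum>n\<in>Poly_Mapping.keys g. Poly_Mapping.single n (Poly_Mapping.lookup g n))"
    by (simp add: sum_monomials)
  also have "subst_eval y \<dots> = 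
      (\<Sum>m\<in>Poly_Mapping.keys f. \<Sum>n\<in>Poly_Mapping.keys g. 
         (Poly_Mapping.lookup f m * mon_eval y m) * (Poly_Mapping.lookup g n * mon_eval y n))"
    by (simp add: sum_product subst_eval_sum mult_single mon_eval_add mult_ac)
  also have "\<dots> = subst_eval y f * subst_eval y g"
    by (simp add: subst_eval_def mon_eval_def sum_product)
  finally show ?thesis .
qed

lemma subst_eval_1 [simp]: "subst_eval y 1 = 1"
  using subst_eval_single[of y 0 1] by simp

lemma subst_eval_uminus: "subst_eval y (- f) = - subst_eval y f"
  using subst_eval_add[of y f "- f"] by (simp add: eq_neg_iff_add_eq_0 add.commute)

lemma subst_eval_diff: "subst_eval y (f - g) = subst_eval y f - subst_eval y g"
  using subst_eval_add[of y f "- g"] by (simp add: subst_eval_uminus)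

interpretation subst_eval: comm_ring_hom "subst_eval y" for y :: "nat \<Rightarrow> 'k::field_char_0"
  by unfold_locales (auto simp: subst_eval_add subst_eval_mult)

lemma pd_superset:
  assumes "finite S" "Poly_Mapping.keys f \<subseteq> S"
  shows "pd k f = (\<Sum>m\<in>S. Poly_Mapping.single (m - Poly_Mapping.single k 1)
     (of_nat (Poly_Mapping.lookup m k) * Poly_Mapping.lookup f m))"
  unfolding pd_def
  by (rule sum.mono_neutral_left) (use assms in \<open>auto simp: in_keys_iff\<close>)

lemma pd_add: "pd k (f + g) = pd k f + pd k g"
proof -
  let ?S = "Poly_Mapping.keys f \<union> Poly_Mapping.keys g"
  have F: "finite ?S" by simp
  show ?thesis
    using pd_superset[OF F, of "f + g" k] pd_superset[OF F, of f k]
      pd_superset[OF F, of g k] Poly_Mapping.keys_add[of f g]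
    by (auto simp: lookup_add sum.distrib distrib_left single_add)
qed

lemma pd_0 [simp]: "pd k 0 = 0"
  by (simp add: pd_def)

lemma pd_single: "pd k (Poly_Mapping.single m c) =
    Poly_Mapping.single (m - Poly_Mapping.single k 1) (of_nat (Poly_Mapping.lookup m k) * c)"
  by (cases "c = 0") (auto simp: pd_def)

lemma pd_sum: "pd k (sum g A) = (\<Sum>a\<in>A. pd k (g a))"
  by (induction A rule: infinite_finite_induct) (auto simp: pd_add)

lemma sym_induct:
  assumes "\<And>m c. P (Poly_Mapping.single m c)" and "\<And>f g. P f \<Longrightarrow> P g \<Longrightarrow> P (f + g)"
  shows "P (f :: 'k::field_char_0 sym)"
proof -
  have "P (\<Sum>m\<in>A. Poly_Mapping.single m (Poly_Mapping.lookup f m))" if "finite A" for A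
    using that by (induction A) (use assms assms(1)[of 0 0] in auto)
  from this[OF finite_keys[of f]] show ?thesis by (simp add: sum_monomials)
qed

lemma pd_sym_const: "pd k (sym_const c * f) = sym_const c * pd k f"
  by (induction f rule: sym_induct) (auto simp: sym_const_def mult_single pd_single pd_add algebra_simps)

lemma sub_add_single:
  "Poly_Mapping.lookup m k > 0 \<Longrightarrow>
   Poly_Mapping.single k 1 + (m - Poly_Mapping.single k 1) = (m :: nat \<Rightarrow>\<^sub>0 nat)"
  by (rule poly_mapping_eqI) (auto simp: lookup_add lookup_minus lookup_single when_def)

lemma sub_add_single':
  "k \<noteq> l \<Longrightarrow> Poly_Mapping.single l 1 + m - Poly_Mapping.single k 1 =
     Poly_Mapping.single l 1 + (m - Poly_Mapping.single k (1::nat))"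
  by (rule poly_mapping_eqI) (auto simp: lookup_add lookup_minus lookup_single when_def)

lemma pd_psum_mult:
  assumes "j \<ge> 1"
  shows "pd k (psum j * f) = (f when k = j - 1) + psum j * pd k f"
proof (induction f rule: sym_induct)
  case (1 m c)
  show ?case
  proof (cases "k = j - 1")
    case True
    show ?thesis
    proof (cases "Poly_Mapping.lookup m k = 0")
      case False
      then show ?thesis using True sub_add_single[of m k]
        by (simp add: psum_def mult_single pd_single lookup_add single_add[symmetric] distrib_right)
    qed (use True in \<open>simp add: psum_def mult_single pd_single lookup_add\<close>)
  next
    case False
    then show ?thesis using sub_add_single'[of k "j - 1" m]
      by (simp add: psum_def mult_single pd_single lookup_add lookup_single)
  qed
next
  case (2 f g)
  then show ?case by (simp add: pd_add distrib_left when_def)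
qed

lemma pd_commute: "pd k (pd l f) = pd l (pd k f)"
proof (induction f rule: sym_induct)
  case (1 m c)
  have *: "m - a - b = m - b - (a :: nat \<Rightarrow>\<^sub>0 nat)" for a b
    by (rule poly_mapping_eqI) (auto simp: lookup_minus)
  show ?case
    by (cases "k = l") (auto simp: pd_single lookup_minus lookup_single * mult.left_commute)
qed (simp add: pd_add)

lemma sym_const_mult: "sym_const a * sym_const b = sym_const (a * b)"
  by (simp add: sym_const_def mult_single)

text \<open>\<open>[a\<^sub>m, a\<^sub>n] = \<delta>\<^bsub>m,-n\<^esub> m / (1 + q\<^bsup>2|m|\<^esup>)\<close>.\<close>

lemma heis_commutator:
  assumes "m \<noteq> 0" "n \<noteq> 0"
  shows "heis q m (heis q n f) - heis q n (heis q m f) =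
    (sym_const (of_int m / (1 + q powi (2 * \<bar>m\<bar>))) * f when m = - n)"
proof -
  have sc: "sym_const (- x) = - sym_const x" for x :: 'a
    by (simp add: sym_const_def single_uminus)
  have A: "heis q a (heis q b f) - heis q b (heis q a f) =
      (sym_const (of_int a / (1 + q powi (2 * a))) * f when a = - b)"
    if "a > 0" "b < 0" for a b
    using that pd_psum_mult[of "nat (- b)" "nat a - 1" f]
    by (auto simp: heis_def when_def algebra_simps)
  consider "m > 0" "n < 0" | "m < 0" "n > 0" | "m < 0" "n < 0" | "m > 0" "n > 0"
    using assms by linarith
  then show ?thesis
  proof cases
    case 1 then show ?thesis using A[of m n] by simp
  next
    case 2 then show ?thesis using A[of n m] sc
      by (cases "n = - m") (auto simp: minus_equation_iff algebra_simps)
  next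
    case 3 then show ?thesis by (simp add: heis_def algebra_simps)
  next
    case 4 then show ?thesis
      using pd_commute[of "nat m - 1" "nat n - 1" f]
      by (simp add: heis_def pd_sym_const mult.left_commute)
  qed
qed

lemma heis_vacuum: "n > 0 \<Longrightarrow> heis (q :: 'k::field_char_0) n 1 = 0"
  using pd_single[of "nat n - 1" 0 "1 :: 'k"] by (simp add: heis_def del: One_nat_def)

subsection \<open>Uniqueness of Schur functions\<close>

lemma poly_eq_0_if_roots:
  fixes P :: "'k::field_char_0 poly"
  assumes "inj_on x {..<N}" "\<And>i. i < N \<Longrightarrow> poly P (x i) = 0" "\<And>k. k \<ge> N \<Longrightarrow> coeff P k = 0"
  shows "P = 0"
proof (rule ccontr)
  assume P: "P \<noteq> 0"
  have "card (x ` {..<N}) \<le> card {t. poly P t = 0}"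
    by (rule card_mono) (use P assms poly_roots_finite in auto)
  also have "card (x ` {..<N}) = N"
    using assms(1) by (simp add: card_image)
  also have "card {t. poly P t = 0} \<le> degree P"
    using P by (rule card_poly_roots_bound)
  finally have "coeff P (degree P) = 0" using assms(3) by blast
  then show False using P by simp
qed

lemma alternant_delta_nonzero:
  fixes x :: "nat \<Rightarrow> 'k::field_char_0"
  assumes "inj_on x {..<N}"
  shows "alternant N x (\<lambda>j. N - 1 - j) \<noteq> 0"
proof
  define A where "A = mat N N (\<lambda>(i, j). x i ^ (N - 1 - j))"
  assume "alternant N x (\<lambda>j. N - 1 - j) = 0"
  then have "det A = 0" by (simp add: alternant_def A_def)
  moreover have "A \<in> carrier_mat N N" by (simp add: A_def)
  ultimately obtain v where v: "v \<in> carrier_vec N" "v \<noteq> 0\<^sub>v N" "A *\<^sub>v v = 0\<^sub>v N"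
    using det_0_iff_vec_prod_zero_field by blast
  define P where "P = (\<Sum>j<N. monom (v $ j) (N - 1 - j))"
  have "P = 0"
  proof (rule poly_eq_0_if_roots[OF assms])
    fix i assume i: "i < N"
    have "(A *\<^sub>v v) $ i = (\<Sum>j<N. x i ^ (N - 1 - j) * v $ j)"
      using i v(1) by (simp add: A_def scalar_prod_def atLeast0LessThan)
    then show "poly P (x i) = 0"
      using v(3) i by (simp add: P_def poly_sum poly_monom mult.commute)
  qed (auto simp: P_def coeff_sum intro!: sum.neutral)
  have "v $ j = 0" if "j < N" for j
  proof -
    have "coeff P (N - 1 - j) = (\<Sum>l<N. if l = j then v $ l else 0)"
      unfolding P_def coeff_sum by (rule sum.cong) (use that in auto)
    then show ?thesis using that \<open>P = 0\<close> by simp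
  qed
  then have "v = 0\<^sub>v N" using v(1) by auto
  then show False using v(2) by simp
qed

lemma pderiv_sum: "pderiv (sum f A) = (\<Sum>a\<in>A. pderiv (f a))"
  by (induction A rule: infinite_finite_induct) (auto simp: pderiv_add)

text \<open>Chain rule for substituting polynomials in one variable.\<close>

lemma poly_subst_deriv:
  fixes Y :: "nat \<Rightarrow> 'k::field_char_0 poly" and g :: "'k sym"
  assumes S: "finite S" "\<And>m. m \<in> Poly_Mapping.keys g \<Longrightarrow> Poly_Mapping.keys m \<subseteq> S"
  obtains Q where "\<And>t. poly Q t = subst_eval (\<lambda>k. poly (Y k) t) g"
    "\<And>t. poly (pderiv Q) t = (\<Sum>k\<in>S. subst_eval (\<lambda>k. poly (Y k) t) (pd k g) * poly (pderiv (Y k)) t)"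
proof
  define Q where "Q = (\<Sum>m\<in>Poly_Mapping.keys g. smult (Poly_Mapping.lookup g m)
     (\<Prod>k\<in>S. Y k ^ Poly_Mapping.lookup m k))"
  show "poly Q t = subst_eval (\<lambda>k. poly (Y k) t) g" for t
    unfolding Q_def subst_eval_superset[OF finite_keys order_refl]
    by (auto simp: poly_sum poly_prod mon_eval_superset[OF S(1) S(2)] intro!: sum.cong)
  fix t
  let ?y = "\<lambda>k. poly (Y k) t"
  have mon: "mon_eval ?y (m - Poly_Mapping.single k 1) * of_nat (Poly_Mapping.lookup m k) =
      (\<Prod>l\<in>S - {k}. ?y l ^ Poly_Mapping.lookup m l) *
        (of_nat (Poly_Mapping.lookup m k) * ?y k ^ (Poly_Mapping.lookup m k - 1))"
    if "Poly_Mapping.keys m \<subseteq> S" "k \<in> S" for m k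
  proof -
    have sub: "Poly_Mapping.keys (m - Poly_Mapping.single k 1) \<subseteq> S"
      using that(1) by (auto simp: in_keys_iff lookup_minus)
    have "mon_eval ?y (m - Poly_Mapping.single k 1) = 
        ?y k ^ (Poly_Mapping.lookup m k - 1) * (\<Prod>l\<in>S - {k}. ?y l ^ Poly_Mapping.lookup m l)"
      unfolding mon_eval_superset[OF S(1) sub] prod.remove[OF S(1) that(2)]
      by (intro arg_cong2[of _ _ _ _ "(*)"] prod.cong)
         (auto simp: lookup_minus lookup_single)
    then show ?thesis by simp
  qed
  have "poly (pderiv Q) t = (\<Sum>m\<in>Poly_Mapping.keys g. Poly_Mapping.lookup g m *
      (\<Sum>k\<in>S. (\<Prod>l\<in>S - {k}. ?y l ^ Poly_Mapping.lookup m l) *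
        (of_nat (Poly_Mapping.lookup m k) * ?y k ^ (Poly_Mapping.lookup m k - 1)) *
        poly (pderiv (Y k)) t))"
    unfolding Q_def pderiv_sum pderiv_smult pderiv_prod poly_sum poly_smult
    by (intro sum.cong refl arg_cong2[of _ _ _ _ "(*)"])
       (auto simp: poly_sum poly_prod pderiv_power mult_ac)
  also have "\<dots> = (\<Sum>m\<in>Poly_Mapping.keys g. Poly_Mapping.lookup g m *
      (\<Sum>k\<in>S. mon_eval ?y (m - Poly_Mapping.single k 1) * of_nat (Poly_Mapping.lookup m k) *
        poly (pderiv (Y k)) t))"
    by (intro sum.cong refl arg_cong2[of _ _ _ _ "(*)"] mon[symmetric]) (use S in auto)
  also have "\<dots> = (\<Sum>k\<in>S. \<Sum>m\<in>Poly_Mapping.keys g. Poly_Mapping.lookup g m *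
      (mon_eval ?y (m - Poly_Mapping.single k 1) * of_nat (Poly_Mapping.lookup m k) *
        poly (pderiv (Y k)) t))"
    by (simp add: sum_distrib_left sum.swap[of _ S])
  also have "\<dots> = (\<Sum>k\<in>S. subst_eval ?y (pd k g) * poly (pderiv (Y k)) t)"
    by (simp add: pd_def subst_eval_sum sum_distrib_left sum_distrib_right mult_ac)
  finally show "poly (pderiv Q) t = (\<Sum>k\<in>S. subst_eval ?y (pd k g) * poly (pderiv (Y k)) t)" .
qed

text \<open>Power sums in sufficiently many variables are algebraically independent.\<close>

lemma psum_independent:
  fixes g :: "'k::field_char_0 sym"
  assumes "\<And>m. m \<in> Poly_Mapping.keys g \<Longrightarrow> (\<Sum>k\<in>Poly_Mapping.keys m. Poly_Mapping.lookup m k) \<le> D"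
    and "\<And>N x. N \<ge> L \<Longrightarrow> inj_on x {..<N} \<Longrightarrow> sym_eval N x g = 0"
  shows "g = 0"
  using assms
proof (induction D arbitrary: g L)
  case (0 g L)
  have "Poly_Mapping.keys g \<subseteq> {0}"
  proof
    fix m assume "m \<in> Poly_Mapping.keys g"
    then have "(\<Sum>k\<in>Poly_Mapping.keys m. Poly_Mapping.lookup m k) = 0" using 0(1) by simp
    then have "Poly_Mapping.lookup m k = 0" for k
      by (cases "k \<in> Poly_Mapping.keys m") (auto simp: in_keys_iff)
    then show "m \<in> {0}" by (simp add: poly_mapping_eqI)
  qed
  then have "sym_eval L x g = Poly_Mapping.lookup g 0" for x
    by (simp add: sym_eval_def subst_eval_superset[of "{0}"])
  moreover have "inj_on (of_nat :: nat \<Rightarrow> 'k) {..<L}" by (simp add: inj_on_def)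
  ultimately have "Poly_Mapping.lookup g 0 = 0" using 0(2)[of L of_nat] by simp
  with \<open>Poly_Mapping.keys g \<subseteq> {0}\<close> show ?case
    by (metis in_keys_iff keys_eq_empty subset_singletonD singletonI)
next
  case (Suc D g L)
  obtain n where n: "\<And>m. m \<in> Poly_Mapping.keys g \<Longrightarrow> Poly_Mapping.keys m \<subseteq> {..<n}"
  proof -
    have "finite (\<Union>m\<in>Poly_Mapping.keys g. Poly_Mapping.keys m)" by simp
    then obtain n where "(\<Union>m\<in>Poly_Mapping.keys g. Poly_Mapping.keys m) \<subseteq> {..<n}"
      using finite_nat_iff_bounded by meson
    then show ?thesis using that by blast
  qed
  have pd_zero: "pd k g = 0" if k: "k < n" for k
  proof (rule Suc.IH)
    fix m assume "m \<in> Poly_Mapping.keys (pd k g)"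
    then have "(\<Sum>m'\<in>Poly_Mapping.keys g. Poly_Mapping.lookup (Poly_Mapping.single
        (m' - Poly_Mapping.single k 1) (of_nat (Poly_Mapping.lookup m' k) * Poly_Mapping.lookup g m')) m) \<noteq> 0"
      by (simp add: pd_def in_keys_iff lookup_sum)
    then have "\<exists>m'\<in>Poly_Mapping.keys g. m \<in> Poly_Mapping.keys (Poly_Mapping.single
        (m' - Poly_Mapping.single k 1) (of_nat (Poly_Mapping.lookup m' k) * Poly_Mapping.lookup g m'))"
      by (meson in_keys_iff sum.neutral)
    then obtain m' where m': "m' \<in> Poly_Mapping.keys g" "m = m' - Poly_Mapping.single k 1"
      "Poly_Mapping.lookup m' k > 0"
      by (auto split: if_splits)
    have fin: "finite (Poly_Mapping.keys m')" by simp
    have kk: "k \<in> Poly_Mapping.keys m'" using m'(3) by (simp add: in_keys_iff)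
    have "(\<Sum>l\<in>Poly_Mapping.keys m. Poly_Mapping.lookup m l) = 
        (\<Sum>l\<in>Poly_Mapping.keys m'. Poly_Mapping.lookup m l)"
      by (rule sum.mono_neutral_left) (auto simp: m'(2) in_keys_iff lookup_minus)
    also have "\<dots> < (\<Sum>l\<in>Poly_Mapping.keys m'. Poly_Mapping.lookup m' l)"
      by (rule sum_strict_mono_ex1) (use kk m'(3) in \<open>auto simp: m'(2) lookup_minus lookup_single intro!: bexI[of _ k]\<close>)
    also have "\<dots> \<le> Suc D" using Suc.prems(1) m'(1) by simp
    finally show "(\<Sum>l\<in>Poly_Mapping.keys m. Poly_Mapping.lookup m l) \<le> D" by simp
  next
    fix N and x :: "nat \<Rightarrow> 'k" assume N: "N \<ge> max L n" and inj: "inj_on x {..<N}"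
    define C where "C = (\<lambda>k. sym_eval N x (pd k g))"
    define R where "R = (\<Sum>k<n. monom (C k * of_nat (k + 1)) k)"
    have "R = 0"
    proof (rule poly_eq_0_if_roots[OF inj])
      fix i assume i: "i < N"
      define Y where "Y = (\<lambda>k. [:\<Sum>j\<in>{..<N} - {i}. x j ^ (k + 1):] + monom (1::'k) (k + 1))"
      obtain Q where Q: "\<And>t. poly Q t = subst_eval (\<lambda>k. poly (Y k) t) g"
        "\<And>t. poly (pderiv Q) t =
           (\<Sum>k<n. subst_eval (\<lambda>k. poly (Y k) t) (pd k g) * poly (pderiv (Y k)) t)"
        using poly_subst_deriv[of "{..<n}" g Y] n by blast
      have Yt: "poly (Y k) t = (\<Sum>j<N. (x(i := t)) j ^ (k + 1))" for k t
        using i by (simp add: Y_def poly_monom sum.remove[of "{..<N}" i] add.commute)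
      have Q0: "poly Q t = 0" if "t \<notin> x ` {..<N}" for t
      proof -
        have "inj_on (x(i := t)) {..<N}" using inj that by (auto simp: inj_on_def)
        then have "sym_eval N (x(i := t)) g = 0"
          by (rule Suc.prems(2)[rotated]) (use N in simp)
        then show ?thesis by (simp add: Q(1) sym_eval_def Yt)
      qed
      have "infinite (UNIV - x ` {..<N} :: 'k set)"
        using infinite_UNIV_char_0 by (rule Diff_infinite_finite[rotated]) simp
      then have "infinite {t. poly Q t = 0}"
        by (rule infinite_super[rotated]) (use Q0 in auto)
      then have "Q = 0" using poly_roots_finite by blast
      then have "(\<Sum>k<n. subst_eval (\<lambda>k. poly (Y k) (x i)) (pd k g) * poly (pderiv (Y k)) (x i)) = 0"
        using Q(2)[of "x i"] by simp
      moreover have "subst_eval (\<lambda>k. poly (Y k) (x i)) (pd k g) = C k" for k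
        by (simp add: C_def sym_eval_def Yt)
      moreover have "poly (pderiv (Y k)) (x i) = of_nat (k + 1) * x i ^ k" for k
        by (simp add: Y_def pderiv_add pderiv_monom poly_monom pderiv_pCons)
      ultimately show "poly R (x i) = 0"
        by (simp add: R_def poly_sum poly_monom mult.assoc)
    qed (use N in \<open>auto simp: R_def coeff_sum intro!: sum.neutral\<close>)
    moreover have "coeff R k = C k * of_nat (k + 1)"
      using k by (simp add: R_def coeff_sum sum.delta)
    ultimately have "C k = 0" by (simp del: of_nat_Suc of_nat_add)
    then show "sym_eval N x (pd k g) = 0" by (simp add: C_def)
  qed
  have "Poly_Mapping.keys g \<subseteq> {0}"
  proof
    fix m assume m: "m \<in> Poly_Mapping.keys g"
    have "Poly_Mapping.lookup m k = 0" for k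
    proof (rule ccontr)
      assume mk: "Poly_Mapping.lookup m k \<noteq> 0"
      then have "k \<in> Poly_Mapping.keys m" by (simp add: in_keys_iff)
      then have "k < n" using n[OF m] by auto
      then have "0 = Poly_Mapping.lookup (pd k g) (m - Poly_Mapping.single k 1)"
        by (simp add: pd_zero)
      also have "\<dots> = (\<Sum>m'\<in>Poly_Mapping.keys g. if m' = m then
          of_nat (Poly_Mapping.lookup m k) * Poly_Mapping.lookup g m else 0)"
        unfolding pd_def lookup_sum
      proof (rule sum.cong)
        fix m' assume "m' \<in> Poly_Mapping.keys g"
        show "Poly_Mapping.lookup (Poly_Mapping.single (m' - Poly_Mapping.single k 1)
           (of_nat (Poly_Mapping.lookup m' k) * Poly_Mapping.lookup g m'))
           (m - Poly_Mapping.single k 1) =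
          (if m' = m then of_nat (Poly_Mapping.lookup m k) * Poly_Mapping.lookup g m else 0)"
        proof (cases "Poly_Mapping.lookup m' k = 0 \<or> m = m'")
          case False
          then have "m' - Poly_Mapping.single k 1 \<noteq> m - Poly_Mapping.single k 1"
            using sub_add_single[of m k] sub_add_single[of m' k] mk by (metis neq0_conv)
          then show ?thesis using False by (auto simp: lookup_single when_def)
        qed (use mk in auto)
      qed simp
      also have "\<dots> = of_nat (Poly_Mapping.lookup m k) * Poly_Mapping.lookup g m"
        using m by (simp add: sum.delta)
      finally show False using m mk by (simp add: in_keys_iff)
    qed
    then show "m \<in> {0}" by (simp add: poly_mapping_eqI)
  qed
  then have "sym_eval L x g = Poly_Mapping.lookup g 0" for x
    by (simp add: sym_eval_def subst_eval_superset[of "{0}"])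
  moreover have "inj_on (of_nat :: nat \<Rightarrow> 'k) {..<L}" by (simp add: inj_on_def)
  ultimately have "Poly_Mapping.lookup g 0 = 0" using Suc.prems(2)[of L of_nat] by simp
  with \<open>Poly_Mapping.keys g \<subseteq> {0}\<close> show ?case
    by (metis in_keys_iff keys_eq_empty subset_singletonD singletonI)
qed

lemma is_schur_unique:
  fixes f g :: "'k::field_char_0 sym"
  assumes "is_schur xs f" "is_schur xs g"
  shows "f = g"
proof -
  have "sym_eval N x (f - g) = 0" if "N \<ge> length xs" "inj_on x {..<N}" for N and x :: "nat \<Rightarrow> 'k"
  proof -
    have "sym_eval N x f * alternant N x (\<lambda>j. N - 1 - j) =
          sym_eval N x g * alternant N x (\<lambda>j. N - 1 - j)"
      using assms that(1) unfolding is_schur_def by metis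
    then show ?thesis
      using alternant_delta_nonzero[OF that(2)] by (simp add: sym_eval_def subst_eval_diff)
  qed
  moreover obtain D where "\<forall>m\<in>Poly_Mapping.keys (f - g). (\<Sum>k\<in>Poly_Mapping.keys m. Poly_Mapping.lookup m k) \<le> D"
    using finite_nat_set_iff_bounded_le[of "(\<lambda>m. \<Sum>k\<in>Poly_Mapping.keys m. Poly_Mapping.lookup m k) ` Poly_Mapping.keys (f - g)"]
    by auto
  ultimately have "f - g = 0" using psum_independent[of "f - g" D "length xs"] by blast
  then show ?thesis by simp
qed

subsection \<open>Existence of Schur functions, and finiteness of the sums\<close>

text \<open>Complete symmetric functions, by Newton's recursion \<open>n h\<^sub>n = \<Sum>\<^sub>k p\<^sub>k h\<^bsub>n-k\<^esub>\<close>.\<close>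

fun hsym :: "nat \<Rightarrow> 'k::field_char_0 sym" where
  "hsym n = (if n = 0 then 1
     else sym_const (1 / of_nat n) * (\<Sum>k\<in>{1..n}. psum k * hsym (n - k)))"

declare hsym.simps [simp del]

definition hsym_int :: "int \<Rightarrow> 'k::field_char_0 sym" where
  "hsym_int k = (if k < 0 then 0 else hsym (nat k))"

lemma sym_eval_psum: "n \<ge> 1 \<Longrightarrow> sym_eval N x (psum n) = (\<Sum>i<N. x i ^ n)"
  by (cases n) (auto simp: sym_eval_def psum_def)

lemma sym_eval_sum: "sym_eval N x (sum g A) = (\<Sum>a\<in>A. sym_eval N x (g a))"
  by (simp add: sym_eval_def subst_eval_sum)

lemma sym_eval_mult: "sym_eval N x (f * g) = sym_eval N x f * sym_eval N x g"
  by (simp add: sym_eval_def subst_eval_mult)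

lemma sym_eval_const: "sym_eval N x (sym_const c) = c"
  by (simp add: sym_eval_def sym_const_def)

lemma fps_geometric_nth:
  fixes A :: "'k::field fps"
  assumes "A * (1 - fps_const c * fps_X) = 1"
  shows "fps_nth A n = c ^ n"
proof (induction n)
  case 0
  show ?case using arg_cong[OF assms, of "\<lambda>f. fps_nth f 0"] by simp
next
  case (Suc n)
  have "A - fps_const c * (A * fps_X) = 1" using assms by (simp add: algebra_simps)
  from arg_cong[OF this, of "\<lambda>f. fps_nth f (Suc n)"] Suc show ?case by simp
qed

lemma fps_deriv_prod_linear:
  fixes x :: "nat \<Rightarrow> 'k::field_char_0"
  assumes "finite A"
  shows "fps_deriv (\<Prod>i\<in>A. 1 - fps_const (x i) * fps_X) =
    (\<Sum>i\<in>A. - fps_const (x i) * (\<Prod>j\<in>A - {i}. 1 - fps_const (x j) * fps_X))"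
  using assms
proof (induction A)
  case (insert a A)
  have "(\<Prod>j\<in>insert a A - {i}. 1 - fps_const (x j) * fps_X) =
      (1 - fps_const (x a) * fps_X) * (\<Prod>j\<in>A - {i}. 1 - fps_const (x j) * fps_X)" if "i \<in> A" for i
  proof -
    have "insert a A - {i} = insert a (A - {i})" using that insert by auto
    then show ?thesis using insert by simp
  qed
  note P = this
  let ?u = "\<lambda>j. 1 - fps_const (x j) * fps_X"
  have ins: "insert a A - {a} = A" using insert by auto
  have "(\<Sum>i\<in>insert a A. - fps_const (x i) * (\<Prod>j\<in>insert a A - {i}. ?u j)) =
      - fps_const (x a) * (\<Prod>j\<in>A. ?u j) +
      (\<Sum>i\<in>A. - fps_const (x i) * (\<Prod>j\<in>insert a A - {i}. ?u j))"
    using insert ins by simp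
  also have "(\<Sum>i\<in>A. - fps_const (x i) * (\<Prod>j\<in>insert a A - {i}. ?u j)) =
      (\<Sum>i\<in>A. ?u a * (- fps_const (x i) * (\<Prod>j\<in>A - {i}. ?u j)))"
  proof (rule sum.cong)
    fix i assume "i \<in> A"
    show "- fps_const (x i) * (\<Prod>j\<in>insert a A - {i}. ?u j) =
        ?u a * (- fps_const (x i) * (\<Prod>j\<in>A - {i}. ?u j))"
      unfolding P[OF \<open>i \<in> A\<close>] by (rule mult.left_commute)
  qed simp
  also have "\<dots> = ?u a * fps_deriv (\<Prod>j\<in>A. ?u j)"
    using insert by (simp only: sum_distrib_left)
  also have "- fps_const (x a) * (\<Prod>j\<in>A. ?u j) + \<dots> = fps_deriv (\<Prod>j\<in>insert a A. ?u j)"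
    using insert(1,2) by (simp add: prod.insert algebra_simps del: fps_const_neg)
  finally show ?case by simp
qed simp

lemma complete_gf:
  fixes x :: "nat \<Rightarrow> 'k::field_char_0"
  shows "Abs_fps (\<lambda>n. sym_eval N x (hsym n)) * (\<Prod>i<N. 1 - fps_const (x i) * fps_X) = 1"
proof -
  define G where "G = Abs_fps (\<lambda>n. sym_eval N x (hsym n))"
  define P where "P = (\<Prod>i<N. 1 - fps_const (x i) * fps_X)"
  define T where "T = (\<lambda>i. Abs_fps (\<lambda>n. if n = 0 then 0 else x i ^ n))"
  have T: "T i * (1 - fps_const (x i) * fps_X) = fps_const (x i) * fps_X" for i
  proof (rule fps_ext)
    fix n show "fps_nth (T i * (1 - fps_const (x i) * fps_X)) n = fps_nth (fps_const (x i) * fps_X) n"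
      by (cases n) (auto simp: T_def ring_distribs fps_mult_fps_X_commute mult.left_commute)
  qed
  have G: "fps_X * fps_deriv G = G * (\<Sum>i<N. T i)"
  proof (rule fps_ext)
    fix n
    show "fps_nth (fps_X * fps_deriv G) n = fps_nth (G * (\<Sum>i<N. T i)) n"
    proof (cases "n = 0")
      case False
      have "sym_eval N x (hsym n) = 1 / of_nat n * (\<Sum>k\<in>{1..n}. (\<Sum>i<N. x i ^ k) * sym_eval N x (hsym (n - k)))"
        using False
        by (subst hsym.simps)
           (auto simp: sym_eval_mult sym_eval_const sym_eval_psum sym_eval_sum)
      then have "of_nat n * fps_nth G n = (\<Sum>k\<in>{1..n}. (\<Sum>i<N. x i ^ k) * fps_nth G (n - k))"
        using False by (simp add: G_def)
      also have "\<dots> = (\<Sum>k\<in>{0..n}. fps_nth (\<Sum>i<N. T i) k * fps_nth G (n - k))"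
        by (rule sum.mono_neutral_cong_left) (auto simp: T_def fps_sum_nth)
      also have "\<dots> = fps_nth ((\<Sum>i<N. T i) * G) n"
        by (simp add: fps_mult_nth)
      finally show ?thesis using False by (simp add: mult.commute)
    qed (simp add: fps_sum_nth T_def)
  qed
  have P: "fps_X * fps_deriv P = - (P * (\<Sum>i<N. T i))"
  proof -
    have "P * T i = fps_X * (fps_const (x i) * (\<Prod>j\<in>{..<N} - {i}. 1 - fps_const (x j) * fps_X))"
      if "i < N" for i
    proof -
      have "P = (1 - fps_const (x i) * fps_X) * (\<Prod>j\<in>{..<N} - {i}. 1 - fps_const (x j) * fps_X)"
        unfolding P_def using that by (subst prod.remove[of _ i]) auto
      then have "P * T i = (T i * (1 - fps_const (x i) * fps_X)) *
          (\<Prod>j\<in>{..<N} - {i}. 1 - fps_const (x j) * fps_X)"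
        by (simp only: mult_ac)
      then show ?thesis unfolding T by (simp only: mult_ac)
    qed
    then show ?thesis
      by (simp add: fps_deriv_prod_linear P_def sum_distrib_left sum_negf del: fps_const_neg)
  qed
  have "fps_X * fps_deriv (G * P) = 0"
  proof -
    have "fps_X * fps_deriv (G * P) = G * (fps_X * fps_deriv P) + P * (fps_X * fps_deriv G)"
      by (simp add: algebra_simps)
    then show ?thesis unfolding G P by (simp add: mult_ac)
  qed
  then have "fps_deriv (G * P) = 0" by simp
  then have "G * P = fps_const (fps_nth (G * P) 0)" by (simp only: fps_deriv_eq_0_iff)
  also have "fps_nth (G * P) 0 = 1"
    by (simp add: G_def P_def hsym.simps sym_eval_def fps_prod_nth' )
  finally show ?thesis by (simp add: G_def P_def)
qed

lemma alternant_factor: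
  fixes x :: "nat \<Rightarrow> 'k::field_char_0"
  obtains M where "M \<in> carrier_mat N N"
    "\<And>\<alpha>. alternant N x \<alpha> = det (mat N N (\<lambda>(i, j).
        sym_eval N x (hsym_int (int (\<alpha> i) - int (N - 1) + int j)))) * det M"
proof
  define E where "E = (\<lambda>k. \<Prod>i\<in>{..<N} - {k}. 1 - fps_const (x i) * fps_X)"
  define M where "M = mat N N (\<lambda>(j, k). fps_nth (E k) (N - 1 - j))"
  define G where "G = Abs_fps (\<lambda>n. sym_eval N x (hsym n))"
  show M: "M \<in> carrier_mat N N" by (simp add: M_def)
  have deg: "fps_nth (\<Prod>i\<in>A. 1 - fps_const (x i) * fps_X) n = 0" if "finite A" "n > card A" for A n
    using that
  proof (induction A arbitrary: n)
    case (insert a A)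
    then show ?case by (cases n) (auto simp: ring_distribs mult.assoc)
  qed auto
  have GE: "fps_nth (G * E k) n = x k ^ n" if "k < N" for k n
  proof (rule fps_geometric_nth)
    have "(\<Prod>i<N. 1 - fps_const (x i) * fps_X) = (1 - fps_const (x k) * fps_X) * E k"
      unfolding E_def using that by (subst prod.remove[of _ k]) auto
    then show "G * E k * (1 - fps_const (x k) * fps_X) = 1"
      using complete_gf[of N x] by (simp add: G_def mult_ac)
  qed
  have hG: "sym_eval N x (hsym_int k) = (if k < 0 then 0 else fps_nth G (nat k))" for k
    by (simp add: hsym_int_def G_def sym_eval_def)
  fix \<alpha> :: "nat \<Rightarrow> nat"
  let ?H = "mat N N (\<lambda>(i, j). sym_eval N x (hsym_int (int (\<alpha> i) - int (N - 1) + int j)))"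
  have entry: "(\<Sum>j<N. sym_eval N x (hsym_int (int a - int (N - 1) + int j)) * fps_nth (E k) (N - 1 - j))
      = x k ^ a" if "k < N" for a k
  proof -
    have "x k ^ a = (\<Sum>l\<in>{0..a}. fps_nth (E k) l * fps_nth G (a - l))"
      using GE[OF that, of a] by (simp add: mult.commute[of G] fps_mult_nth)
    also have "\<dots> = (\<Sum>l<N. fps_nth (E k) l * sym_eval N x (hsym_int (int a - int l)))"
      (is "?A = ?B")
    proof -
      have "?A = (\<Sum>l\<in>{0..a} \<inter> {..<N}. fps_nth (E k) l * sym_eval N x (hsym_int (int a - int l)))"
      proof (rule sum.mono_neutral_cong_right)
        show "\<forall>l\<in>{0..a} - {0..a} \<inter> {..<N}. fps_nth (E k) l * fps_nth G (a - l) = 0"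
        proof
          fix l assume "l \<in> {0..a} - {0..a} \<inter> {..<N}"
          then have "l \<ge> N" by auto
          then have "fps_nth (E k) l = 0" unfolding E_def using that by (intro deg) auto
          then show "fps_nth (E k) l * fps_nth G (a - l) = 0" by simp
        qed
      qed (auto simp: hG nat_diff_distrib)
      also have "\<dots> = ?B"
        by (rule sum.mono_neutral_left) (auto simp: hG)
      finally show ?thesis .
    qed
    also have "\<dots> = (\<Sum>j<N. fps_nth (E k) (N - 1 - j) * sym_eval N x (hsym_int (int a - int (N - 1 - j))))"
      using sum.nat_diff_reindex[of "\<lambda>l. fps_nth (E k) l * sym_eval N x (hsym_int (int a - int l))" N]
      by simp
    also have "\<dots> = (\<Sum>j<N. sym_eval N x (hsym_int (int a - int (N - 1) + int j)) * fps_nth (E k) (N - 1 - j))"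
      by (rule sum.cong) (auto simp: of_nat_diff algebra_simps)
    finally show ?thesis by simp
  qed
  have "?H * M = transpose_mat (mat N N (\<lambda>(i, j). x i ^ \<alpha> j))"
  proof (rule eq_matI)
    fix i k assume "i < dim_row (transpose_mat (mat N N (\<lambda>(i, j). x i ^ \<alpha> j)))"
      "k < dim_col (transpose_mat (mat N N (\<lambda>(i, j). x i ^ \<alpha> j)))"
    then have ik: "i < N" "k < N" by auto
    then show "(?H * M) $$ (i, k) = transpose_mat (mat N N (\<lambda>(i, j). x i ^ \<alpha> j)) $$ (i, k)"
      using entry[of k "\<alpha> i"] by (simp add: M_def scalar_prod_def atLeast0LessThan)
  qed (auto simp: M_def)
  then have "det (?H * M) = alternant N x \<alpha>"
    by (simp add: alternant_def det_transpose[of _ N])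
  then show "alternant N x \<alpha> = det ?H * det M"
    using det_mult[of ?H N M] M by simp
qed

lemma alternant_eq:
  fixes x :: "nat \<Rightarrow> 'k::field_char_0"
  shows "alternant N x \<alpha> = det (mat N N (\<lambda>(i, j).
        sym_eval N x (hsym_int (int (\<alpha> i) - int (N - 1) + int j)))) *
      alternant N x (\<lambda>j. N - 1 - j)"
proof -
  obtain M where M: "\<And>\<alpha>. alternant N x \<alpha> = det (mat N N (\<lambda>(i, j).
        sym_eval N x (hsym_int (int (\<alpha> i) - int (N - 1) + int j)))) * det M"
    using alternant_factor by metis
  let ?U = "mat N N (\<lambda>(i, j). sym_eval N x (hsym_int (int (N - 1 - i) - int (N - 1) + int j)))"
  have "det ?U = prod_list (diag_mat ?U)"
    by (rule det_upper_triangular[of _ N]) (auto simp: hsym_int_def sym_eval_def of_nat_diff)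
  also have "diag_mat ?U = map (\<lambda>_. 1) [0..<N]"
    by (auto simp: diag_mat_def hsym_int_def sym_eval_def hsym.simps of_nat_diff)
  also have "prod_list \<dots> = 1" by (induction N) auto
  finally have "alternant N x (\<lambda>j. N - 1 - j) = det M"
    using M[of "\<lambda>j. N - 1 - j"] by simp
  then show ?thesis using M[of \<alpha>] by simp
qed

definition jacobi_trudi :: "nat \<Rightarrow> int list \<Rightarrow> 'k::field_char_0 sym" where
  "jacobi_trudi N xs = det (mat N N (\<lambda>(i, j). hsym_int (part xs i - int i + int j)))"

lemma jacobi_trudi_Suc:
  assumes "N \<ge> length xs"
  shows "jacobi_trudi (Suc N) xs = (jacobi_trudi N xs :: 'k::field_char_0 sym)"
proof -
  let ?A = "mat (Suc N) (Suc N) (\<lambda>(i, j). hsym_int (part xs i - int i + int j)) :: 'k sym mat"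
  have "det ?A = (\<Sum>j<Suc N. ?A $$ (N, j) * cofactor ?A N j)"
    by (rule laplace_expansion_row) auto
  also have "\<dots> = (\<Sum>j<Suc N. if j = N then cofactor ?A N N else 0)"
    by (rule sum.cong) (use assms in \<open>auto simp: hsym_int_def hsym.simps part_def\<close>)
  also have "\<dots> = cofactor ?A N N" by simp
  also have "\<dots> = det (mat_delete ?A N N)" by (simp add: cofactor_def mult_2[symmetric])
  also have "mat_delete ?A N N = mat N N (\<lambda>(i, j). hsym_int (part xs i - int i + int j))"
    by (rule eq_matI) (auto simp: mat_delete_def)
  finally show ?thesis by (simp add: jacobi_trudi_def)
qed

lemma jacobi_trudi_stable:
  assumes "N \<ge> length xs"
  shows "jacobi_trudi N xs = jacobi_trudi (length xs) xs"
  using assms by (induction N rule: dec_induct) (auto simp: jacobi_trudi_Suc)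

lemma is_schur_jacobi_trudi:
  assumes "is_partition xs"
  shows "is_schur xs (jacobi_trudi (length xs) xs)"
  unfolding is_schur_def
proof (intro allI impI)
  fix N and x :: "nat \<Rightarrow> 'a" assume N: "N \<ge> length xs"
  have pos: "part xs i \<ge> 0" for i
    using assms by (auto simp: part_def is_partition_def)
  let ?H = "mat N N (\<lambda>(i, j). hsym_int (part xs i - int i + int j)) :: 'a sym mat"
  have "sym_eval N x (jacobi_trudi (length xs) xs) = sym_eval N x (det ?H)"
    using jacobi_trudi_stable[OF N, where 'a = 'a] by (simp add: jacobi_trudi_def)
  also have "\<dots> = det (map_mat (sym_eval N x) ?H)"
    by (simp add: sym_eval_def[abs_def] subst_eval.hom_det)
  also have "map_mat (sym_eval N x) ?H = mat N N (\<lambda>(i, j). sym_eval N x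
      (hsym_int (int (nat (part xs i) + (N - 1 - i)) - int (N - 1) + int j)))"
    by (rule eq_matI) (use pos in \<open>auto simp: of_nat_diff algebra_simps\<close>)
  finally show "sym_eval N x (jacobi_trudi (length xs) xs) * alternant N x (\<lambda>j. N - 1 - j) =
     alternant N x (\<lambda>j. nat (part xs j) + (N - 1 - j))"
    by (metis alternant_eq[of N x "\<lambda>j. nat (part xs j) + (N - 1 - j)"])
qed

lemma schur_ex1:
  assumes "is_partition xs"
  shows "\<exists>!f. is_schur xs (f :: 'k::field_char_0 sym)"
  using is_schur_jacobi_trudi[OF assms] is_schur_unique by blast

lemma schur_eq_jacobi_trudi:
  "is_partition xs \<Longrightarrow> schur xs = jacobi_trudi (length xs) xs"
  unfolding schur_def
  by (rule the_equality) (auto intro: is_schur_jacobi_trudi is_schur_unique)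

lemma straightens_unique:
  assumes "straightens \<nu> \<sigma>" "straightens \<nu> \<tau>"
  shows "\<sigma> = \<tau>"
proof -
  define l where "l = length \<nu>"
  define ys where "ys = add_delta \<nu>"
  have len: "length ys = l" by (simp add: ys_def l_def add_delta_def)
  have dec: "sorted_wrt (>) (map (\<lambda>j. ys ! \<rho> j) [0..<l])" if "straightens \<nu> \<rho>" for \<rho>
  proof -
    have "ys ! \<rho> i > ys ! \<rho> j" if "i < j" "j < l" for i j
    proof -
      have "straight_act \<nu> \<rho> ! i \<ge> straight_act \<nu> \<rho> ! j"
        using \<open>straightens \<nu> \<rho>\<close> that
        by (auto simp: straightens_def is_partition_def sorted_wrt_iff_nth_less straight_act_def l_def)
      then show ?thesis using that by (simp add: straight_act_def l_def ys_def)
    qed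
    then show ?thesis by (auto simp: sorted_wrt_iff_nth_less)
  qed
  have set: "set (map (\<lambda>j. ys ! \<rho> j) [0..<l]) = set ys" if "straightens \<nu> \<rho>" for \<rho>
  proof -
    have "\<rho> permutes {..<l}" using that by (simp add: straightens_def l_def)
    then have "\<rho> ` {..<l} = {..<l}" by (rule permutes_image)
    then have "set (map (\<lambda>j. ys ! \<rho> j) [0..<l]) = (!) ys ` {..<l}"
      by (metis atLeast0LessThan atLeast_upt image_image list.set_map set_upt)
    then show ?thesis using len by (auto simp: set_conv_nth)
  qed
  have eq: "map (\<lambda>j. ys ! \<sigma> j) [0..<l] = map (\<lambda>j. ys ! \<tau> j) [0..<l]"
  proof -
    have "rev (map (\<lambda>j. ys ! \<sigma> j) [0..<l]) = rev (map (\<lambda>j. ys ! \<tau> j) [0..<l])"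
      using dec[OF assms(1)] dec[OF assms(2)] set[OF assms(1)] set[OF assms(2)]
      by (intro strict_sorted_equal) (auto simp: sorted_wrt_rev)
    then show ?thesis by simp
  qed
  have perm: "\<sigma> permutes {..<l}" "\<tau> permutes {..<l}" and dist: "distinct ys"
    using assms by (auto simp: straightens_def l_def ys_def)
  show ?thesis
  proof
    fix j show "\<sigma> j = \<tau> j"
    proof (cases "j < l")
      case True
      then have "ys ! \<sigma> j = ys ! \<tau> j" using eq by simp
      moreover have "\<sigma> j < l" "\<tau> j < l" using perm True by (auto simp: permutes_in_image dest: permutes_in_image[of _ _ j])
      ultimately show ?thesis using dist len by (simp add: nth_eq_iff_index_eq)
    next
      case False
      then show ?thesis using perm by (simp add: permutes_def)
    qed
  qed
qed

lemma straightens_bound: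
  assumes "straightens \<nu> \<sigma>" "j < length \<nu>"
  shows "\<nu> ! j \<ge> - int (length \<nu>)"
proof -
  have perm: "\<sigma> permutes {..<length \<nu>}" using assms by (simp add: straightens_def)
  then obtain i where i: "i < length \<nu>" "\<sigma> i = j"
    using assms(2) permutes_image[OF perm] by (metis imageE lessThan_iff)
  have "straight_act \<nu> \<sigma> ! i \<ge> 0"
    using assms(1) i(1) by (auto simp: straightens_def is_partition_def straight_act_def)
  then show ?thesis using i assms(2) by (simp add: straight_act_def add_delta_def)
qed

text \<open>The sums over \<open>\<lambda>\<close> in the main formulas have finitely many nonzero terms.\<close>

lemma finite_nonzero_terms:
  "finite {l \<in> partitions_upto r. \<exists>\<sigma>. straightens (shifted_neg l c @ \<mu>) \<sigma>}"
proof (rule finite_subset)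
  define b where "b = int (r + length \<mu>) - c"
  show "finite {l. set l \<subseteq> {0..b} \<and> length l = r}"
    by (rule finite_lists_length_eq) simp
  show "{l \<in> partitions_upto r. \<exists>\<sigma>. straightens (shifted_neg l c @ \<mu>) \<sigma>} \<subseteq>
     {l. set l \<subseteq> {0..b} \<and> length l = r}"
  proof safe
    fix l \<sigma> x
    assume l: "l \<in> partitions_upto r" and s: "straightens (shifted_neg l c @ \<mu>) \<sigma>" and "x \<in> set l"
    then obtain j where j: "j < r" "x = l ! j" and len: "length l = r"
      by (auto simp: partitions_upto_def in_set_conv_nth)
    have "(shifted_neg l c @ \<mu>) ! j \<ge> - int (length (shifted_neg l c @ \<mu>))"
      using s by (rule straightens_bound) (use j len in \<open>simp add: shifted_neg_def\<close>)
    moreover have "x \<ge> 0" using l \<open>x \<in> set l\<close> by (auto simp: partitions_upto_def is_partition_def)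
    ultimately show "x \<in> {0..b}"
      using j len by (simp add: shifted_neg_def nth_append b_def)
  qed (auto simp: partitions_upto_def)
qed

end

theory Submission
  imports Defs
begin

text \<open>
  Let \<open>H(z) = \<Sum>\<^sub>n h\<^sub>n z\<^sup>n\<close> and let \<open>B(z) = \<Sum>\<^sub>n B\<^sub>n z\<^sup>n\<close> be Bernstein's operator, so that
  \<open>B\<^sub>n s\<^sub>\<mu> = s\<^bsub>(n, \<mu>)\<^esub>\<close>.  The annihilation part of \<open>X\<^sup>+\<close> is a translation of the power sums, and
  \<open>X\<^sup>+(z) = H(z/q) B(qz) e\<^sup>\<alpha> z\<^sup>\<partial>\<close>; conjugation by the involution \<open>\<omega>\<close> turns \<open>X\<^sup>-(z)\<close> into
  \<open>H(- q\<^sup>2 z) B(- z) e\<^sup>-\<^sup>\<alpha> z\<^sup>-\<^sup>\<partial>\<close>.  Hence both formulas are statements about the operators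
  \<open>Y\<^sub>c = \<Sum>\<^sub>k t\<^sup>k h\<^sub>k B\<^bsub>- c - k\<^esub>\<close> with \<open>t = q\<^sup>-\<^sup>2\<close> and \<open>t = q\<^sup>2\<close>.  Moving \<open>B\<close> past \<open>H\<close> in a product
  \<open>Y\<^bsub>c + 2(r - 1)\<^esub> \<cdots> Y\<^sub>c\<close> produces factors \<open>1 - t z\<^sub>j / z\<^sub>i\<close>.  Since \<open>s\<^sub>\<nu>\<close> is alternating in \<open>\<nu> + \<delta>\<close>, almost
  all terms of their expansion cancel: the \<open>k\<close>-th step contributes the scalar
  \<open>1 + t + \<cdots> + t\<^bsup>k - 1\<^esup>\<close>, and together they give \<open>[r]!\<close> up to a power of \<open>q\<close>.  The remaining sum over
  \<open>k \<in> \<nat>\<^sup>r\<close> is collected, again by alternation, into one over partitions, where the products of the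
  \<open>h\<^bsub>k\<^sub>i\<^esub>\<close> become Jacobi-Trudi determinants.
\<close>

text \<open>The creation part of a current carries the factor \<open>1 + q^(2n)\<close>, while in
  the annihilation part it cancels against the Heisenberg constant. Hence two series
  \<open>H\<close> stand on the left and one translation on the right, and one \<open>H\<close> is
  left over when Bernstein's operator is split off. Only this extra factor has to be reordered,
  since a composite of Bernstein operators is already \<open>s\<close> of a tuple. Each application
  of a current raises \<partial> (for \<open>X^-\<close>, its negative) by 2, so successive indices
  differ by 2. A term \<open>t z_j / z_i\<close> of the reordering factors narrows such a gap to 1,
  and an alternating function vanishes on neighbouring entries \<open>w, w - 1\<close>; this is why
  so few terms survive. After division by \<open>[r]!\<close> all coefficients lie in
  \<open>Z[q, 1/q]\<close>, so invariance of the lattice reduces to closure of the integral span of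
  Schur functions under products. This again comes from the commutation of \<open>B\<close> with
  \<open>H\<close>. That \<omega> conjugates partitions is derived from a Clifford relation between
  operators that add rows and operators that add columns.\<close>

section \<open>Constants, and induction over power sums\<close>

lemma sym_const_0 [simp]: "sym_const 0 = 0"
  by (simp add: sym_const_def)

lemma sym_const_1 [simp]: "sym_const 1 = 1"
  by (simp add: sym_const_def)

lemma sym_const_add: "sym_const (a + b) = sym_const a + sym_const b"
  by (simp add: sym_const_def single_add)

lemma sym_const_uminus: "sym_const (- a) = - sym_const a"
  by (simp add: sym_const_def single_uminus)

lemma sym_const_of_nat: "sym_const (of_nat n) = of_nat n"
  by (induction n) (simp_all add: sym_const_add)

lemma sym_const_power: "sym_const (a ^ n) = sym_const a ^ n"
  by (induction n) (simp_all add: sym_const_mult[symmetric])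

lemma single_mult_psum:
  "Poly_Mapping.single (Poly_Mapping.single k 1 + m) c =
     psum (Suc k) * (Poly_Mapping.single m c :: 'k::field_char_0 sym)"
  by (simp add: psum_def mult_single)

text \<open>Induction on the total degree of a monomial, splitting off one variable at a time. It
  suits operators whose commutation with a power sum is known.\<close>

lemma sym_psum_induct [case_names const psum add]:
  fixes f :: "'k::field_char_0 sym"
  assumes const: "\<And>c. P (sym_const c)"
    and psum: "\<And>n f. n \<ge> 1 \<Longrightarrow> P f \<Longrightarrow> P (psum n * f)"
    and add: "\<And>f g. P f \<Longrightarrow> P g \<Longrightarrow> P (f + g)"
  shows "P f"
proof (rule sym_induct)
  fix m :: "nat \<Rightarrow>\<^sub>0 nat" and c :: 'k
  have "P (Poly_Mapping.single m c)" if "(\<Sum>k\<in>Poly_Mapping.keys m. Poly_Mapping.lookup m k) = d" for d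
    using that
  proof (induction d arbitrary: m)
    case 0
    then have "Poly_Mapping.lookup m k = 0" for k
      by (cases "k \<in> Poly_Mapping.keys m") (auto simp: in_keys_iff)
    then have "m = 0" by (simp add: poly_mapping_eqI)
    then show ?case using const[of c] by (simp add: sym_const_def)
  next
    case (Suc d)
    then obtain k where k: "k \<in> Poly_Mapping.keys m"
      by (metis Zero_not_Suc all_not_in_conv sum.empty)
    define m' where "m' = m - Poly_Mapping.single k 1"
    have pos: "Poly_Mapping.lookup m k > 0" using k by (simp add: in_keys_iff)
    have m: "m = Poly_Mapping.single k 1 + m'"
      using sub_add_single[OF pos] by (simp add: m'_def)
    have "(\<Sum>l\<in>Poly_Mapping.keys m'. Poly_Mapping.lookup m' l) =
        (\<Sum>l\<in>Poly_Mapping.keys m. Poly_Mapping.lookup m' l)"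
      by (rule sum.mono_neutral_left) (auto simp: m'_def in_keys_iff lookup_minus)
    moreover have "(\<Sum>l\<in>Poly_Mapping.keys m. Poly_Mapping.lookup m l) =
        (\<Sum>l\<in>Poly_Mapping.keys m. Poly_Mapping.lookup (Poly_Mapping.single k 1) l) +
        (\<Sum>l\<in>Poly_Mapping.keys m. Poly_Mapping.lookup m' l)"
      unfolding sum.distrib[symmetric] by (rule sum.cong) (simp_all add: m lookup_add)
    moreover have "(\<Sum>l\<in>Poly_Mapping.keys m. Poly_Mapping.lookup (Poly_Mapping.single k (1::nat)) l) = 1"
      using k by (simp add: lookup_single when_def)
    ultimately have "P (Poly_Mapping.single m' c)" using Suc by simp
    then show ?case using psum[of "Suc k"] by (simp only: m single_mult_psum)
  qed
  then show "P (Poly_Mapping.single m c)" by simp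
qed (rule add)

text \<open>With scaling as a separate case, a linear operator needs to be inspected only at
  \<open>1\<close> and under multiplication by power sums.\<close>

lemma sym_const_mult_psum_induct [case_names one psum add scale]:
  fixes f :: "'k::field_char_0 sym"
  assumes one: "P 1"
    and psum: "\<And>n f. n \<ge> 1 \<Longrightarrow> P f \<Longrightarrow> P (psum n * f)"
    and add: "\<And>f g. P f \<Longrightarrow> P g \<Longrightarrow> P (f + g)"
    and scale: "\<And>c f. P f \<Longrightarrow> P (sym_const c * f)"
  shows "P f"
proof (induction f rule: sym_psum_induct)
  case (const c)
  then show ?case using scale[OF one, of c] by simp
qed (simp_all add: psum add)

subsection \<open>Ring homomorphisms out of Sym\<close>

text \<open>Sym is a free polynomial ring, so images of the constants and of the power sums
  determine a ring homomorphism. Two instances follow: translation, with polynomial values, and the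
  involution of Sym. The image of the power sum number \<open>k + 1\<close> is
  \<open>y k\<close>.\<close>

locale sym_substitution =
  fixes \<iota> :: "'k::field_char_0 \<Rightarrow> 'b::comm_ring_1" and y :: "nat \<Rightarrow> 'b"
  assumes \<iota>_0: "\<iota> 0 = 0" and \<iota>_1: "\<iota> 1 = 1"
    and \<iota>_add: "\<iota> (a + b) = \<iota> a + \<iota> b"
    and \<iota>_mult: "\<iota> (a * b) = \<iota> a * \<iota> b"
begin

definition mon :: "(nat \<Rightarrow>\<^sub>0 nat) \<Rightarrow> 'b" where
  "mon m = (\<Prod>k\<in>Poly_Mapping.keys m. y k ^ Poly_Mapping.lookup m k)"

definition lift :: "'k sym \<Rightarrow> 'b" where
  "lift f = (\<Sum>m\<in>Poly_Mapping.keys f. \<iota> (Poly_Mapping.lookup f m) * mon m)"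

lemma mon_superset:
  "finite S \<Longrightarrow> Poly_Mapping.keys m \<subseteq> S \<Longrightarrow> mon m = (\<Prod>k\<in>S. y k ^ Poly_Mapping.lookup m k)"
  unfolding mon_def by (rule prod.mono_neutral_left) (auto simp: in_keys_iff)

lemma mon_add: "mon (m + n) = mon m * mon n"
proof -
  let ?S = "Poly_Mapping.keys m \<union> Poly_Mapping.keys n"
  have "finite ?S" by simp
  then show ?thesis
    using Poly_Mapping.keys_add[of m n]
    by (simp add: mon_superset[of ?S] lookup_add power_add prod.distrib)
qed

lemma lift_superset:
  "finite S \<Longrightarrow> Poly_Mapping.keys f \<subseteq> S \<Longrightarrow>
    lift f = (\<Sum>m\<in>S. \<iota> (Poly_Mapping.lookup f m) * mon m)"
  unfolding lift_def by (rule sum.mono_neutral_left) (auto simp: in_keys_iff \<iota>_0)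

lemma lift_add: "lift (f + g) = lift f + lift g"
proof -
  let ?S = "Poly_Mapping.keys f \<union> Poly_Mapping.keys g"
  have "finite ?S" by simp
  then show ?thesis
    using Poly_Mapping.keys_add[of f g]
    by (simp add: lift_superset[of ?S] lookup_add \<iota>_add sum.distrib distrib_right)
qed

lemma lift_0: "lift 0 = 0"
  by (simp add: lift_def)

lemma lift_single: "lift (Poly_Mapping.single m c) = \<iota> c * mon m"
  by (cases "c = 0") (auto simp: lift_def \<iota>_0)

lemma lift_const: "lift (sym_const c) = \<iota> c"
  by (simp add: sym_const_def lift_single mon_def)

lemma lift_psum: "n \<ge> 1 \<Longrightarrow> lift (psum n) = y (n - 1)"
  by (simp add: psum_def lift_single mon_def \<iota>_1)

lemma lift_single_mult: "lift (Poly_Mapping.single m c * f) = \<iota> c * mon m * lift f"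
proof (induction f rule: sym_induct)
  case (1 n d)
  then show ?case by (simp add: mult_single lift_single \<iota>_mult mon_add mult_ac)
next
  case (2 f g)
  then show ?case by (simp add: distrib_left lift_add)
qed

lemma lift_mult: "lift (f * g) = lift f * lift g"
proof (induction f rule: sym_induct)
  case (1 m c)
  then show ?case by (simp add: lift_single_mult lift_single)
next
  case (2 f f')
  then show ?case by (simp add: distrib_right lift_add)
qed

sublocale lift: comm_ring_hom lift
  by unfold_locales
     (simp_all add: lift_add lift_mult lift_0 lift_const[of 1, unfolded sym_const_1 \<iota>_1])

end

subsection \<open>Translation of the power sums\<close>

text \<open>
  \<open>translate \<epsilon>\<close> is \<open>p\<^sub>n \<mapsto> p\<^sub>n - \<epsilon> u\<^sup>n\<close>: with \<open>u = z\<^sup>-\<^sup>1\<close> it is the action of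
  \<open>exp (- \<epsilon> \<Sum>\<^sub>n z\<^sup>-\<^sup>n \<partial>/\<partial>p\<^sub>n)\<close>.
\<close>

global_interpretation translate: sym_substitution "\<lambda>c. [:sym_const c:]"
  "\<lambda>k. [:psum (Suc k):] - monom (sym_const \<epsilon>) (Suc k)" for \<epsilon> :: "'k::field_char_0"
  defines translate = translate.lift
  by unfold_locales (simp_all add: sym_const_add sym_const_mult[symmetric] mult.commute)

lemma translate_psum:
  "n \<ge> 1 \<Longrightarrow> translate \<epsilon> (psum n) = [:psum n:] - monom (sym_const \<epsilon>) n"
  by (simp add: translate.lift_psum)

lemma translate_psum_mult:
  "n \<ge> 1 \<Longrightarrow> translate \<epsilon> (psum n * f) =
    smult (psum n) (translate \<epsilon> f) - smult (sym_const \<epsilon>) (monom 1 n * translate \<epsilon> f)"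
proof -
  have "monom (sym_const \<epsilon>) n = smult (sym_const \<epsilon>) (monom 1 n)"
    by (simp add: smult_monom)
  then show "n \<ge> 1 \<Longrightarrow> ?thesis"
    by (simp add: translate.lift_mult translate_psum left_diff_distrib)
qed

text \<open>The classical involution, with sign \<open>(-1)^(n-1)\<close> on the power sum number
  \<open>n = k + 1\<close>. That it conjugates partitions is shown later, in
  \<open>omega_schur\<close>.\<close>

global_interpretation omega: sym_substitution sym_const
  "\<lambda>k. (- 1) ^ k * psum (Suc k) :: 'k::field_char_0 sym"
  defines omega = omega.lift
  by unfold_locales (simp_all add: sym_const_add sym_const_mult[symmetric])

lemma omega_psum: "n \<ge> 1 \<Longrightarrow> omega (psum n) = (- 1) ^ (n - 1) * psum n"
  by (simp add: omega.lift_psum)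

lemma omega_omega [simp]: "omega (omega f) = f"
proof (induction f rule: sym_psum_induct)
  case (psum n f)
  then show ?case
    by (simp add: omega.lift_mult omega_psum omega.lift.hom_power omega.lift.hom_uminus
        flip: mult.assoc power_mult_distrib)
qed (simp_all add: omega.lift_const omega.lift_add)

subsection \<open>Pairing with a sequence, and Bernstein operators\<close>

text \<open>The linear functional that replaces the k-th power of the variable
  \<open>u = 1/z\<close> by \<open>g k\<close>. It extracts one coefficient from the product of a
  series in \<open>z\<close> with a polynomial in \<open>1/z\<close>.\<close>

definition pair :: "(nat \<Rightarrow> 'b::comm_ring_1) \<Rightarrow> 'b poly \<Rightarrow> 'b" where
  "pair g p = (\<Sum>k\<le>degree p. g k * coeff p k)"

lemma pair_superset:
  assumes "\<And>k. k \<ge> N \<Longrightarrow> coeff p k = 0"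
  shows "pair g p = (\<Sum>k<N. g k * coeff p k)"
proof -
  have "pair g p = (\<Sum>k\<in>{..degree p} \<inter> {..<N}. g k * coeff p k)"
    unfolding pair_def
    by (rule sum.mono_neutral_right) (use assms in \<open>auto simp: not_less intro: ccontr\<close>)
  also have "\<dots> = (\<Sum>k<N. g k * coeff p k)"
    by (rule sum.mono_neutral_left) (auto intro: le_degree)
  finally show ?thesis .
qed

lemma pair_0 [simp]: "pair g 0 = 0"
  by (simp add: pair_def)

lemma pair_add: "pair g (p + q) = pair g p + pair g q"
proof -
  define N where "N = Suc (max (degree p) (degree q))"
  have "k \<ge> N \<Longrightarrow> coeff p k = 0 \<and> coeff q k = 0" for k
    by (auto simp: N_def coeff_eq_0)
  then show ?thesis
    by (simp add: pair_superset[of N] ring_distribs sum.distrib)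
qed

lemma pair_smult: "pair g (smult c p) = c * pair g p"
  using pair_superset[of "Suc (degree p)" "smult c p" g]
  by (simp add: pair_def sum_distrib_left mult_ac coeff_eq_0 lessThan_Suc_atMost)

lemma pair_uminus: "pair g (- p) = - pair g p"
  using pair_add[of g p "- p"] by (simp add: eq_neg_iff_add_eq_0 add.commute)

lemma pair_diff: "pair g (p - q) = pair g p - pair g q"
  using pair_add[of g p "- q"] by (simp add: pair_uminus)

lemma pair_const [simp]: "pair g [:c:] = g 0 * c"
  by (simp add: pair_def)

lemma pair_monom_mult: "pair g (monom 1 n * p) = pair (\<lambda>k. g (k + n)) p"
proof -
  have "pair g (monom 1 n * p) = (\<Sum>k<Suc (degree p) + n. g k * coeff (monom 1 n * p) k)"
    by (rule pair_superset) (auto simp: coeff_monom_mult coeff_eq_0)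
  also have "\<dots> = (\<Sum>k\<in>{n..<Suc (degree p) + n}. g k * coeff (monom 1 n * p) k)"
    by (rule sum.mono_neutral_right) (auto simp: coeff_monom_mult)
  also have "\<dots> = (\<Sum>k<Suc (degree p). g (k + n) * coeff p k)"
    by (rule sum.reindex_bij_witness[of _ "\<lambda>k. k + n" "\<lambda>k. k - n"])
       (auto simp: coeff_monom_mult)
  finally show ?thesis by (simp add: pair_def lessThan_Suc_atMost)
qed

text \<open>
  For \<open>W(z) = \<Sum>\<^sub>n w\<^sub>n z\<^sup>n\<close>, this is the coefficient of \<open>z\<^sup>n\<close> in
  \<open>W(z) exp (- \<epsilon> \<Sum>\<^sub>j z\<^sup>-\<^sup>j \<partial>/\<partial>p\<^sub>j)\<close>.
\<close>

definition vertex :: "'k::field_char_0 \<Rightarrow> (int \<Rightarrow> 'k sym) \<Rightarrow> int \<Rightarrow> 'k sym \<Rightarrow> 'k sym" where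
  "vertex \<epsilon> w n f = pair (\<lambda>k. w (n + int k)) (translate \<epsilon> f)"

lemma vertex_add: "vertex \<epsilon> w n (f + g) = vertex \<epsilon> w n f + vertex \<epsilon> w n g"
  by (simp add: vertex_def translate.lift_add pair_add)

lemma vertex_0 [simp]: "vertex \<epsilon> w n 0 = 0"
  by (simp add: vertex_def translate.lift_0)

lemma vertex_sum: "vertex \<epsilon> w n (sum g A) = (\<Sum>a\<in>A. vertex \<epsilon> w n (g a))"
  by (induction A rule: infinite_finite_induct) (simp_all add: vertex_add)

lemma vertex_const: "vertex \<epsilon> w n (sym_const c * f) = sym_const c * vertex \<epsilon> w n f"
  by (simp add: vertex_def translate.lift_mult translate.lift_const pair_smult)

lemma vertex_uminus: "vertex \<epsilon> w n (- f) = - vertex \<epsilon> w n f"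
  using vertex_add[of \<epsilon> w n f "- f"] by (simp add: eq_neg_iff_add_eq_0 add.commute)

lemma vertex_diff: "vertex \<epsilon> w n (f - g) = vertex \<epsilon> w n f - vertex \<epsilon> w n g"
  using vertex_add[of \<epsilon> w n f "- g"] by (simp add: vertex_uminus)

lemma vertex_one [simp]: "vertex \<epsilon> w n 1 = w n"
  by (simp add: vertex_def pCons_one[symmetric])

text \<open>Together with linearity and the value at \<open>1\<close>, this commutation rule
  determines the operator. Identities between vertex operators are therefore proved by induction
  over power sums.\<close>

lemma vertex_psum:
  assumes "j \<ge> 1"
  shows "vertex \<epsilon> w n (psum j * f) =
    psum j * vertex \<epsilon> w n f - sym_const \<epsilon> * vertex \<epsilon> w (n + int j) f"
  using assms
  by (simp add: vertex_def translate_psum_mult pair_diff pair_smult pair_monom_mult add_ac)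

subsection \<open>Power series with prescribed logarithmic derivative\<close>

text \<open>A division-free form of \<open>z G'/G = P\<close>, meaningful over Sym and over
  polynomials with coefficients in Sym. Exponentials are compared through this equation instead of
  through their expansions.\<close>

definition log_deriv :: "'b::comm_ring_1 fps \<Rightarrow> 'b fps \<Rightarrow> bool" where
  "log_deriv P G \<longleftrightarrow> fps_X * fps_deriv G = P * G"

lemma log_deriv_mult: "log_deriv P F \<Longrightarrow> log_deriv Q G \<Longrightarrow> log_deriv (P + Q) (F * G)"
proof -
  assume F: "log_deriv P F" and G: "log_deriv Q G"
  have "fps_X * fps_deriv (F * G) = F * (fps_X * fps_deriv G) + (fps_X * fps_deriv F) * G"
    by (simp add: algebra_simps)
  with F G show ?thesis by (simp add: log_deriv_def algebra_simps)
qed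

lemma log_deriv_nth:
  "log_deriv P G \<longleftrightarrow> (\<forall>n. of_nat n * fps_nth G n = (\<Sum>i=0..n. fps_nth P i * fps_nth G (n - i)))"
proof -
  have "fps_nth (fps_X * fps_deriv G) n = of_nat n * fps_nth G n" for n
    by (cases n) auto
  then show ?thesis by (simp add: log_deriv_def fps_eq_iff fps_mult_nth)
qed

text \<open>As \<open>P\<close> has no constant term, \<open>n\<close> times the n-th coefficient is
  a combination of earlier coefficients, and the factor \<open>n\<close> can be cancelled.\<close>

lemma log_deriv_unique:
  assumes P: "fps_nth P 0 = (0 :: 'b::{idom,ring_char_0})" and F: "log_deriv P F" and G: "log_deriv P G"
    and start: "fps_nth F 0 = fps_nth G 0"
  shows "F = G"
proof (rule fps_ext)
  fix n show "fps_nth F n = fps_nth G n"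
  proof (induction n rule: less_induct)
    case (less n)
    show ?case
    proof (cases "n = 0")
      case False
      have "of_nat n * fps_nth F n = (\<Sum>i=0..n. fps_nth P i * fps_nth F (n - i))"
        using F by (simp add: log_deriv_nth)
      also have "\<dots> = (\<Sum>i=0..n. fps_nth P i * fps_nth G (n - i))"
      proof (rule sum.cong)
        fix i assume "i \<in> {0..n}"
        then show "fps_nth P i * fps_nth F (n - i) = fps_nth P i * fps_nth G (n - i)"
          using P less[of "n - i"] by (cases "i = 0") auto
      qed simp
      also have "\<dots> = of_nat n * fps_nth G n"
        using G by (simp add: log_deriv_nth)
      finally show ?thesis using False by simp
    qed (simp add: start)
  qed
qed

definition fps_map :: "('a::comm_ring_1 \<Rightarrow> 'b::comm_ring_1) \<Rightarrow> 'a fps \<Rightarrow> 'b fps" where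
  "fps_map h F = Abs_fps (\<lambda>n. h (fps_nth F n))"

lemma fps_map_nth [simp]: "fps_nth (fps_map h F) n = h (fps_nth F n)"
  by (simp add: fps_map_def)

lemma (in comm_ring_hom) log_deriv_map:
  assumes "log_deriv P G" shows "log_deriv (fps_map hom P) (fps_map hom G)"
  unfolding log_deriv_nth
proof
  fix n
  have "hom (of_nat n * fps_nth G n) = hom (\<Sum>i=0..n. fps_nth P i * fps_nth G (n - i))"
    using assms by (simp add: log_deriv_nth)
  then show "of_nat n * fps_nth (fps_map hom G) n =
      (\<Sum>i=0..n. fps_nth (fps_map hom P) i * fps_nth (fps_map hom G) (n - i))"
    by (simp add: hom_distribs)
qed

definition fps_dilate :: "'b::comm_ring_1 \<Rightarrow> 'b fps \<Rightarrow> 'b fps" where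
  "fps_dilate c F = Abs_fps (\<lambda>n. c ^ n * fps_nth F n)"

lemma fps_dilate_nth [simp]: "fps_nth (fps_dilate c F) n = c ^ n * fps_nth F n"
  by (simp add: fps_dilate_def)

lemma log_deriv_dilate:
  assumes "log_deriv P G" shows "log_deriv (fps_dilate c P) (fps_dilate c G)"
  unfolding log_deriv_nth
proof
  fix n
  have "of_nat n * fps_nth (fps_dilate c G) n = c ^ n * (of_nat n * fps_nth G n)"
    by (simp add: mult_ac)
  also have "of_nat n * fps_nth G n = (\<Sum>i=0..n. fps_nth P i * fps_nth G (n - i))"
    using assms by (simp add: log_deriv_nth)
  also have "c ^ n * \<dots> = (\<Sum>i=0..n. fps_nth (fps_dilate c P) i * fps_nth (fps_dilate c G) (n - i))"
    unfolding sum_distrib_left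
    by (rule sum.cong) (simp_all add: mult_ac flip: power_add)
  finally show "of_nat n * fps_nth (fps_dilate c G) n = \<dots>" .
qed

subsection \<open>Complete symmetric functions and their inverses\<close>

text \<open>
  The coefficients of \<open>exp (\<epsilon> \<Sum>\<^sub>n p\<^sub>n z\<^sup>n / n)\<close>: the complete symmetric functions for \<open>\<epsilon> = 1\<close>, the
  elementary ones with alternating signs for \<open>\<epsilon> = -1\<close>.
\<close>

fun hgen :: "'k::field_char_0 \<Rightarrow> nat \<Rightarrow> 'k sym" where
  "hgen \<epsilon> n = (if n = 0 then 1
     else sym_const (\<epsilon> / of_nat n) * (\<Sum>k\<in>{1..n}. psum k * hgen \<epsilon> (n - k)))"

declare hgen.simps [simp del]

lemma hgen_0 [simp]: "hgen \<epsilon> 0 = 1"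
  by (simp add: hgen.simps)

lemma hgen_1_eq_hsym: "hgen 1 n = hsym n"
proof (induction n rule: less_induct)
  case (less n)
  then show ?case by (subst hgen.simps, subst hsym.simps) simp
qed

abbreviation hser :: "'k::field_char_0 \<Rightarrow> 'k sym fps" where
  "hser \<epsilon> \<equiv> Abs_fps (hgen \<epsilon>)"

definition psum_ser :: "'k::field_char_0 sym fps" where
  "psum_ser = Abs_fps (\<lambda>n. if n = 0 then 0 else psum n)"

lemma log_deriv_hser: "log_deriv (fps_const (sym_const \<epsilon>) * psum_ser) (hser \<epsilon>)"
  unfolding log_deriv_nth
proof
  fix n
  show "of_nat n * fps_nth (hser \<epsilon>) n =
     (\<Sum>i=0..n. fps_nth (fps_const (sym_const \<epsilon>) * psum_ser) i * fps_nth (hser \<epsilon>) (n - i))"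
  proof (cases "n = 0")
    case False
    have "of_nat n * hgen \<epsilon> n =
        (sym_const (of_nat n) * sym_const (\<epsilon> / of_nat n)) * (\<Sum>k\<in>{1..n}. psum k * hgen \<epsilon> (n - k))"
      using False by (subst hgen.simps) (simp add: sym_const_of_nat mult.assoc)
    also have "\<dots> = (\<Sum>i\<in>{1..n}. sym_const \<epsilon> * psum i * hgen \<epsilon> (n - i))"
      using False by (simp add: sym_const_mult sum_distrib_left mult.assoc)
    also have "\<dots> = (\<Sum>i=0..n. fps_nth (fps_const (sym_const \<epsilon>) * psum_ser) i * fps_nth (hser \<epsilon>) (n - i))"
      by (rule sum.mono_neutral_cong_left) (auto simp: psum_ser_def)
    finally show ?thesis by simp
  qed (simp add: psum_ser_def)
qed

text \<open>The two logarithmic derivatives add up to zero, which is that of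
  \<open>1\<close>.\<close>

lemma hser_inverse: "hser \<epsilon> * hser (- \<epsilon>) = 1"
proof (rule log_deriv_unique)
  show "log_deriv (fps_const (sym_const \<epsilon>) * psum_ser + fps_const (sym_const (- \<epsilon>)) * psum_ser)
     (hser \<epsilon> * hser (- \<epsilon>))"
    by (intro log_deriv_mult log_deriv_hser)
qed (simp_all add: log_deriv_def sym_const_uminus psum_ser_def flip: fps_const_neg)

text \<open>Translation changes the logarithmic derivative of \<open>hser \<eta>\<close> by
  \<open>- \<eta> \<epsilon>\<close> times the series of all \<open>(u z)^n\<close>,
  \<open>n \<ge> 1\<close>. For \<open>\<eta> = \<epsilon>\<close> this is the logarithmic
  derivative of \<open>1 - u z\<close>. For \<open>\<eta> = - \<epsilon>\<close> it is that of the
  inverse, so the factor is moved to the other side.\<close>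

lemma translate_hser:
  assumes "\<epsilon> * \<epsilon> = 1"
  shows "fps_map (translate \<epsilon>) (hser \<epsilon>) =
      (1 - fps_const (monom 1 1) * fps_X) * fps_map (\<lambda>c. [:c:]) (hser \<epsilon>)"
    and "(1 - fps_const (monom 1 1) * fps_X) * fps_map (translate \<epsilon>) (hser (- \<epsilon>)) =
      fps_map (\<lambda>c. [:c:]) (hser (- \<epsilon>))"
proof -
  interpret C: comm_ring_hom "\<lambda>c :: 'a sym. [:c:]"
    by unfold_locales (simp_all add: mult.commute)
  define U :: "'a sym poly fps" where "U = Abs_fps (\<lambda>n. if n = 0 then 0 else monom 1 n)"
  define L :: "'a sym poly fps" where "L = 1 - fps_const (monom 1 1) * fps_X"
  have "U * L = fps_const (monom 1 1) * fps_X"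
  proof (rule fps_ext)
    fix n
    have "U * L = U - fps_const (monom 1 1) * (U * fps_X)"
      by (simp add: L_def algebra_simps)
    then show "fps_nth (U * L) n = fps_nth (fps_const (monom 1 1) * fps_X) n"
      by (cases n) (auto simp: U_def mult_monom)
  qed
  then have L: "log_deriv (- U) L" by (simp add: log_deriv_def L_def mult.commute del: fps_const_neg flip: fps_const_neg)
  have T: "fps_map (translate \<epsilon>) (fps_const (sym_const \<eta>) * psum_ser) =
      fps_map (\<lambda>c. [:c:]) (fps_const (sym_const \<eta>) * psum_ser) -
      fps_const [:sym_const (\<eta> * \<epsilon>):] * U" for \<eta>
    by (rule fps_ext) (simp add: psum_ser_def U_def translate.lift_mult translate.lift_const
      translate_psum smult_diff_right smult_monom sym_const_mult translate.lift_0)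
  show "fps_map (translate \<epsilon>) (hser \<epsilon>) = L * fps_map (\<lambda>c. [:c:]) (hser \<epsilon>)"
  proof (rule log_deriv_unique)
    show "log_deriv (fps_map (translate \<epsilon>) (fps_const (sym_const \<epsilon>) * psum_ser))
       (fps_map (translate \<epsilon>) (hser \<epsilon>))"
      by (intro translate.lift.log_deriv_map log_deriv_hser)
    have "log_deriv (- U + fps_map (\<lambda>c. [:c:]) (fps_const (sym_const \<epsilon>) * psum_ser))
        (L * fps_map (\<lambda>c. [:c:]) (hser \<epsilon>))"
      by (intro log_deriv_mult L C.log_deriv_map log_deriv_hser)
    then show "log_deriv (fps_map (translate \<epsilon>) (fps_const (sym_const \<epsilon>) * psum_ser))
        (L * fps_map (\<lambda>c. [:c:]) (hser \<epsilon>))"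
      by (simp add: T assms one_pCons[symmetric])
  qed (simp_all add: psum_ser_def translate.lift_0 L_def)
  show "L * fps_map (translate \<epsilon>) (hser (- \<epsilon>)) = fps_map (\<lambda>c. [:c:]) (hser (- \<epsilon>))"
  proof (rule log_deriv_unique)
    have "log_deriv (- U + fps_map (translate \<epsilon>) (fps_const (sym_const (- \<epsilon>)) * psum_ser))
       (L * fps_map (translate \<epsilon>) (hser (- \<epsilon>)))"
      by (intro log_deriv_mult L translate.lift.log_deriv_map log_deriv_hser)
    moreover have "fps_const [:sym_const (- \<epsilon> * \<epsilon>) :: 'a sym:] = - 1"
    proof -
      have "[:sym_const (- \<epsilon> * \<epsilon>) :: 'a sym:] = [:- 1:]"
        by (simp add: assms sym_const_uminus)
      also have "\<dots> = - [:1:]" by (simp only: minus_pCons minus_zero)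
      also have "\<dots> = - 1" by (simp only: one_pCons)
      finally show ?thesis by (metis fps_const_neg fps_const_1_eq_1)
    qed
    ultimately show "log_deriv (fps_map (\<lambda>c. [:c:]) (fps_const (sym_const (- \<epsilon>)) * psum_ser))
       (L * fps_map (translate \<epsilon>) (hser (- \<epsilon>)))"
      by (simp only: T) simp
    show "log_deriv (fps_map (\<lambda>c. [:c:]) (fps_const (sym_const (- \<epsilon>)) * psum_ser))
        (fps_map (\<lambda>c. [:c:]) (hser (- \<epsilon>)))"
      by (intro C.log_deriv_map log_deriv_hser)
  qed (simp_all add: psum_ser_def L_def)
qed

definition hint :: "'k::field_char_0 \<Rightarrow> int \<Rightarrow> 'k sym" where
  "hint \<epsilon> k = (if k < 0 then 0 else hgen \<epsilon> (nat k))"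

lemma hint_neg [simp]: "k < 0 \<Longrightarrow> hint \<epsilon> k = 0"
  by (simp add: hint_def)

lemma hint_0 [simp]: "hint \<epsilon> 0 = 1"
  by (simp add: hint_def)

lemma hint_of_nat [simp]: "hint \<epsilon> (int n) = hgen \<epsilon> n"
  by (simp add: hint_def)

lemma hint_Suc [simp]: "hint \<epsilon> (1 + int n) = hgen \<epsilon> (Suc n)"
  by (simp add: hint_def nat_add_distrib)

lemma hint_1_eq_hsym_int: "hint 1 k = hsym_int k"
  by (simp add: hint_def hsym_int_def hgen_1_eq_hsym)

lemma hint_cases:
  obtains "k < 0" | "k = 0" | n where "k = int (Suc n)"
  by (metis int_cases3 of_nat_0_less_iff gr0_conv_Suc neg_0_less_iff_less neg_equal_0_iff_equal
      neg_less_0_iff_less)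

lemma translate_hint:
  assumes "\<epsilon> * \<epsilon> = 1"
  shows "translate \<epsilon> (hint \<epsilon> k) = [:hint \<epsilon> k:] - monom 1 1 * [:hint \<epsilon> (k - 1):]"
proof (cases k rule: hint_cases)
  case (3 n)
  then show ?thesis
    using arg_cong[OF translate_hser(1)[OF assms], of "\<lambda>F. fps_nth F (Suc n)"]
    by (simp add: left_diff_distrib mult.assoc)
qed (simp_all add: translate.lift_0 one_pCons)

lemma translate_hint_neg:
  assumes "\<epsilon> * \<epsilon> = 1"
  shows "translate \<epsilon> (hint (- \<epsilon>) k) = [:hint (- \<epsilon>) k:] + monom 1 1 * translate \<epsilon> (hint (- \<epsilon>) (k - 1))"
proof (cases k rule: hint_cases)
  case (3 n)
  then show ?thesis
    using arg_cong[OF translate_hser(2)[OF assms], of "\<lambda>F. fps_nth F (Suc n)"]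
    by (simp add: left_diff_distrib mult.assoc diff_eq_eq)
qed (simp_all add: translate.lift_0 one_pCons)

text \<open>The coefficient form of \<open>V(z) H(x) = (1 - x/z) H(x) V(z)\<close>, where
  \<open>V(z)\<close> has an arbitrary creation part \<open>w\<close>: only the translation acts on
  \<open>H(x)\<close>.\<close>

lemma vertex_hint:
  "vertex 1 w n (hint 1 k * f) = hint 1 k * vertex 1 w n f - hint 1 (k - 1) * vertex 1 w (n + 1) f"
proof -
  have "translate 1 (hint 1 k * f) = smult (hint 1 k) (translate 1 f) -
      smult (hint 1 (k - 1)) (monom 1 1 * translate 1 f)"
    by (simp add: translate.lift_mult translate_hint left_diff_distrib mult.assoc)
  then show ?thesis
    by (simp add: vertex_def pair_diff pair_smult pair_monom_mult add_ac)
qed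

text \<open>The exchange of complete and elementary symmetric functions. The sign appears because
  \<open>hgen (- 1) n\<close> is the elementary function times \<open>(-1)^n\<close>.\<close>

lemma omega_hgen: "omega (hgen \<epsilon> n) = (- 1) ^ n * hgen (- \<epsilon>) n"
proof (induction n rule: less_induct)
  case (less n)
  show ?case
  proof (cases "n = 0")
    case False
    have "omega (psum k * hgen \<epsilon> (n - k)) = - ((- 1) ^ n * (psum k * hgen (- \<epsilon>) (n - k)))"
      if kn: "k \<in> {1..n}" for k
    proof -
      obtain j where j: "k = Suc j" using kn by (cases k) auto
      have n: "n = Suc (j + (n - k))" using kn j by simp
      have sign: "(- 1 :: 'a sym) ^ (k - 1) * (- 1) ^ (n - k) = - ((- 1) ^ n)"
        by (subst (2) n) (simp add: j power_add)
      have "(- 1) ^ (k - 1) * psum k * ((- 1) ^ (n - k) * hgen (- \<epsilon>) (n - k)) =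
          - ((- 1) ^ n * (psum k * hgen (- \<epsilon>) (n - k)))"
      proof -
        have "(- 1) ^ (k - 1) * psum k * ((- 1) ^ (n - k) * hgen (- \<epsilon>) (n - k)) =
            (- 1) ^ (k - 1) * (- 1) ^ (n - k) * (psum k * hgen (- \<epsilon>) (n - k))"
          by (simp only: mult_ac)
        also have "\<dots> = - ((- 1) ^ n * (psum k * hgen (- \<epsilon>) (n - k)))"
          unfolding sign by (rule mult_minus_left)
        finally show ?thesis .
      qed
      moreover have "omega (psum k) = (- 1) ^ (k - 1) * (psum k :: 'a sym)"
        "omega (hgen \<epsilon> (n - k)) = (- 1) ^ (n - k) * hgen (- \<epsilon>) (n - k)"
        using kn less[of "n - k"] by (simp_all add: omega_psum)
      ultimately show ?thesis by (simp only: omega.lift_mult)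
    qed
    then have "(\<Sum>k\<in>{1..n}. omega (psum k * hgen \<epsilon> (n - k))) =
        (\<Sum>k\<in>{1..n}. - ((- 1) ^ n * (psum k * hgen (- \<epsilon>) (n - k))))"
      by (rule sum.cong[OF refl])
    moreover have "omega (hgen \<epsilon> n) =
        sym_const (\<epsilon> / of_nat n) * (\<Sum>k\<in>{1..n}. omega (psum k * hgen \<epsilon> (n - k)))"
      using False by (subst hgen.simps)
        (simp only: if_False omega.lift_mult omega.lift_const omega.lift.hom_sum)
    moreover have "hgen (- \<epsilon>) n =
        - (sym_const (\<epsilon> / of_nat n) * (\<Sum>k\<in>{1..n}. psum k * hgen (- \<epsilon>) (n - k)))"
      using False by (subst hgen.simps) (simp add: sym_const_uminus)
    ultimately show ?thesis
      by (simp only: sum_negf sum_distrib_left[symmetric]) (simp add: mult.left_commute)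
  qed (simp add: omega.lift_const[of 1, simplified])
qed

subsection \<open>Jacobi-Trudi determinants of integer tuples\<close>

text \<open>Jacobi-Trudi determinants make sense for all integer tuples and are alternating by
  themselves, so they replace the case distinction in \<open>schur_tuple\<close>; the two agree by
  \<open>schur_tuple_eq_jt\<close>.\<close>

definition jt :: "int list \<Rightarrow> 'k::field_char_0 sym" where
  "jt \<nu> = jacobi_trudi (length \<nu>) \<nu>"

lemma schur_eq_jt: "is_partition \<nu> \<Longrightarrow> schur \<nu> = jt \<nu>"
  by (simp add: jt_def schur_eq_jacobi_trudi)

lemma jt_eq: "jt \<nu> = det (mat (length \<nu>) (length \<nu>) (\<lambda>(i, j). hint 1 (\<nu> ! i - int i + int j)))"
  unfolding jt_def jacobi_trudi_def
  by (rule arg_cong[of _ _ det], rule eq_matI) (auto simp: part_def hint_1_eq_hsym_int)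

lemma jt_Nil [simp]: "jt [] = 1"
  by (simp add: jt_eq)

text \<open>Row \<open>i\<close> of the determinant depends on the tuple only through
  \<open>\<nu> ! i - i\<close>, so the hypothesis describes a permutation of rows.\<close>

lemma jt_permute:
  assumes "\<sigma> permutes {..<length \<nu>}" "length \<nu>' = length \<nu>"
    and "\<And>i. i < length \<nu> \<Longrightarrow> \<nu>' ! i - int i = \<nu> ! \<sigma> i - int (\<sigma> i)"
  shows "jt \<nu>' = of_int (sign \<sigma>) * jt \<nu>"
proof -
  let ?l = "length \<nu>"
  let ?A = "mat ?l ?l (\<lambda>(i, j). hint 1 (\<nu> ! i - int i + int j)) :: 'a sym mat"
  have "jt \<nu>' = det (mat ?l ?l (\<lambda>(i, j). ?A $$ (\<sigma> i, j)))"
    unfolding jt_eq assms(2)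
  proof (rule arg_cong[of _ _ det], rule cong_mat)
    fix i j assume "i < ?l" "j < ?l"
    moreover from this have "\<sigma> i < ?l" using permutes_in_image[OF assms(1), of i] by simp
    ultimately show "(case (i, j) of (i, j) \<Rightarrow> hint 1 (\<nu>' ! i - int i + int j)) =
        (case (i, j) of (i, j) \<Rightarrow> ?A $$ (\<sigma> i, j))"
      using assms(3)[of i] by simp
  qed auto
  also have "\<dots> = of_int (sign \<sigma>) * det ?A"
    by (rule det_permute_rows) (use assms(1) in \<open>auto simp: atLeast0LessThan\<close>)
  finally show ?thesis by (simp add: jt_eq)
qed

text \<open>The largest index in row \<open>i\<close> stands in the last column and is
  \<open>\<nu> ! i - i + length \<nu> - 1\<close>. If it is negative, the whole row
  vanishes.\<close>

lemma jt_eq_0_neg: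
  assumes "i < length \<nu>" "\<nu> ! i - int i + int (length \<nu>) \<le> 0"
  shows "jt \<nu> = 0"
proof -
  let ?l = "length \<nu>"
  let ?A = "mat ?l ?l (\<lambda>(i, j). hint 1 (\<nu> ! i - int i + int j)) :: 'a sym mat"
  have "det ?A = (\<Sum>j<?l. ?A $$ (i, j) * cofactor ?A i j)"
    by (rule laplace_expansion_row) (use assms in auto)
  also have "\<dots> = 0"
    by (rule sum.neutral) (use assms in auto)
  finally show ?thesis by (simp add: jt_eq)
qed

lemma jt_eq_0_repeat:
  assumes "i < length \<nu>" "j < length \<nu>" "i \<noteq> j" "\<nu> ! i - int i = \<nu> ! j - int j"
  shows "jt \<nu> = 0"
  unfolding jt_eq
  by (rule det_identical_rows[of _ "length \<nu>" i j]) (use assms in \<open>auto intro!: eq_vecI\<close>)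

lemma jt_swap: "jt (u @ a # b # v) = - jt (u @ (b - 1) # (a + 1) # v)"
proof -
  let ?n = "length u"
  let ?\<sigma> = "transpose ?n (Suc ?n)"
  let ?\<nu> = "u @ (b - 1) # (a + 1) # v"
  have *: "(u @ a # b # v) ! i - int i = ?\<nu> ! ?\<sigma> i - int (?\<sigma> i)" for i
  proof -
    consider "i < ?n" | "i = ?n" | "i = Suc ?n" | k where "i = Suc (Suc (?n + k))"
      by (metis add_Suc_right less_imp_Suc_add linorder_less_linear not_less_eq)
    then show ?thesis
      by cases (auto simp: nth_append transpose_def)
  qed
  have "jt (u @ a # b # v) = of_int (sign ?\<sigma>) * jt ?\<nu>"
    by (rule jt_permute) (use * in \<open>auto intro!: permutes_swap_id\<close>)
  then show ?thesis by (simp add: sign_swap_id)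
qed

text \<open>Both identities are expansions along the first row with the same cofactors, the second
  one for a first row \<open>1, u, u^2, ...\<close>. Subtracting \<open>u\<close> times each column
  from the next (right multiplication by the unitriangular \<open>P\<close>) turns that row into
  \<open>1, 0, 0, ...\<close>. Every other entry \<open>h_k\<close> becomes
  \<open>h_k - u h_(k-1)\<close>, which is its translate.\<close>

lemma jt_Cons_expansion:
  obtains cof :: "nat \<Rightarrow> 'k::field_char_0 sym"
  where "\<forall>n. jt (n # \<nu>) = (\<Sum>j\<le>length \<nu>. hint 1 (n + int j) * cof j)"
    and "translate 1 (jt \<nu>) = (\<Sum>j\<le>length \<nu>. monom (cof j) j)"
proof -
  let ?l = "length \<nu>"
  define row :: "nat \<Rightarrow> nat \<Rightarrow> 'k sym" where
    "row = (\<lambda>i j. hint 1 (\<nu> ! (i - 1) - int i + int j))"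
  define M where "M = (\<lambda>g. mat (Suc ?l) (Suc ?l) (\<lambda>(i, j). if i = 0 then g j else row i j))"
  define cof where "cof = cofactor (M (\<lambda>_. 0)) 0"
  have M: "M g \<in> carrier_mat (Suc ?l) (Suc ?l)" for g by (simp add: M_def)
  \<comment> \<open>Deleting row 0 removes \<open>g\<close>, so one family of cofactors serves all
    first rows, and in particular all \<open>n\<close>.\<close>
  have del: "mat_delete (M g) 0 j = mat_delete (M (\<lambda>_. 0)) 0 j" for g j
    by (rule eq_matI) (auto simp: mat_delete_def M_def)
  have cof: "cofactor (M g) 0 j = cof j" for g j
    by (simp only: cof_def cofactor_def del[of g])
  have 1: "jt (n # \<nu>) = (\<Sum>j\<le>?l. hint 1 (n + int j) * cof j)" for n
  proof -
    have "jt (n # \<nu>) = det (M (\<lambda>j. hint 1 (n + int j)))"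
      unfolding jt_eq M_def row_def
      by (rule arg_cong[of _ _ det], rule eq_matI) (auto simp: nth_Cons')
    also have "\<dots> = (\<Sum>j<Suc ?l. M (\<lambda>j. hint 1 (n + int j)) $$ (0, j) *
        cofactor (M (\<lambda>j. hint 1 (n + int j))) 0 j)"
      by (rule laplace_expansion_row[OF M]) simp
    also have "\<dots> = (\<Sum>j<Suc ?l. hint 1 (n + int j) * cof j)"
      by (rule sum.cong) (simp_all add: cof, simp add: M_def)
    finally show ?thesis by (simp add: lessThan_Suc_atMost)
  qed
  interpret C: comm_ring_hom "\<lambda>c :: 'k sym. [:c:]"
    by unfold_locales (simp_all add: mult.commute)
  define Mu where "Mu = mat (Suc ?l) (Suc ?l) (\<lambda>(i, j). if i = 0 then monom 1 j else [:row i j:])"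
  define P where "P = mat (Suc ?l) (Suc ?l) (\<lambda>(i, j).
    if i = j then 1 else if Suc i = j then - monom 1 1 else (0 :: 'k sym poly))"
  have Mu: "Mu \<in> carrier_mat (Suc ?l) (Suc ?l)" by (simp add: Mu_def)
  have P: "P \<in> carrier_mat (Suc ?l) (Suc ?l)" by (simp add: P_def)
  have MuP: "Mu * P \<in> carrier_mat (Suc ?l) (Suc ?l)" using Mu P by simp
  have delu: "mat_delete Mu 0 j = map_mat (\<lambda>c. [:c:]) (mat_delete (M (\<lambda>_. 0)) 0 j)" for j
    by (rule eq_matI) (auto simp: mat_delete_def M_def Mu_def)
  have entry: "(Mu * P) $$ (i, j) = Mu $$ (i, j) - (if j = 0 then 0 else monom 1 1 * Mu $$ (i, j - 1))"
    if "i < Suc ?l" "j < Suc ?l" for i j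
  proof -
    have "(Mu * P) $$ (i, j) = (\<Sum>k<Suc ?l. Mu $$ (i, k) * P $$ (k, j))"
      using that Mu P by (simp add: scalar_prod_def atLeast0LessThan)
    also have "\<dots> = (\<Sum>k<Suc ?l. (if k = j then Mu $$ (i, j) else 0) -
        (if Suc k = j then monom 1 1 * Mu $$ (i, k) else 0))"
      by (rule sum.cong) (use that in \<open>auto simp: P_def\<close>)
    also have "(\<Sum>k<Suc ?l. (if Suc k = j then monom 1 1 * Mu $$ (i, k) else 0)) =
        (if j = 0 then 0 else monom 1 1 * Mu $$ (i, j - 1))"
      using that by (cases j) (auto simp: sum.delta)
    then have "(\<Sum>k<Suc ?l. (if k = j then Mu $$ (i, j) else 0) -
        (if Suc k = j then monom 1 1 * Mu $$ (i, k) else 0)) =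
        Mu $$ (i, j) - (if j = 0 then 0 else monom 1 1 * Mu $$ (i, j - 1))"
      using that by (simp add: sum_subtractf del: sum.lessThan_Suc)
    finally show ?thesis .
  qed
  have "det P = prod_list (diag_mat P)"
    by (rule det_upper_triangular[OF _ P]) (auto simp: P_def)
  also have "diag_mat P = map (\<lambda>_. 1) [0..<Suc ?l]"
    by (auto simp: diag_mat_def P_def simp del: upt_Suc)
  also have "prod_list \<dots> = 1" 
    by (simp add: map_replicate_const prod_list_replicate del: upt_Suc)
  finally have "det Mu = det (Mu * P)"
    using det_mult[OF Mu P] by simp
  also have "\<dots> = (\<Sum>j<Suc ?l. (Mu * P) $$ (0, j) * cofactor (Mu * P) 0 j)"
    by (rule laplace_expansion_row[OF MuP]) simp
  also have "\<dots> = (\<Sum>j<Suc ?l. if j = 0 then cofactor (Mu * P) 0 0 else 0)"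
  proof (rule sum.cong)
    fix j assume "j \<in> {..<Suc ?l}"
    moreover have "Mu $$ (0, k) = monom 1 k" if "k < Suc ?l" for k
      using that by (simp add: Mu_def)
    ultimately have "(Mu * P) $$ (0, j) = (if j = 0 then 1 else 0)"
      by (cases j) (simp_all add: entry mult_monom)
    then show "(Mu * P) $$ (0, j) * cofactor (Mu * P) 0 j = (if j = 0 then cofactor (Mu * P) 0 0 else 0)"
      by simp
  qed simp
  also have "\<dots> = det (mat_delete (Mu * P) 0 0)"
    by (simp add: cofactor_def del: sum.lessThan_Suc)
  also have "mat_delete (Mu * P) 0 0 = map_mat (translate 1) (mat ?l ?l (\<lambda>(i, j). hint 1 (\<nu> ! i - int i + int j)))"
  proof (rule eq_matI)
    fix i j
    assume "i < dim_row (map_mat (translate 1) (mat ?l ?l (\<lambda>(i, j). hint 1 (\<nu> ! i - int i + int j))))"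
      "j < dim_col (map_mat (translate 1) (mat ?l ?l (\<lambda>(i, j). hint 1 (\<nu> ! i - int i + int j))))"
    then have ij: "i < ?l" "j < ?l" by auto
    then have "mat_delete (Mu * P) 0 0 $$ (i, j) = (Mu * P) $$ (Suc i, Suc j)"
      using Mu P by (simp add: mat_delete_def)
    also have "\<dots> = [:row (Suc i) (Suc j):] - monom 1 1 * [:row (Suc i) j:]"
      using ij by (simp add: entry) (simp add: Mu_def)
    also have "\<dots> = translate 1 (hint 1 (\<nu> ! i - int i + int j))"
      by (simp add: translate_hint row_def algebra_simps)
    finally show "mat_delete (Mu * P) 0 0 $$ (i, j) =
       map_mat (translate 1) (mat ?l ?l (\<lambda>(i, j). hint 1 (\<nu> ! i - int i + int j))) $$ (i, j)"
      using ij by simp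
  qed (use Mu P in auto)
  finally have "translate 1 (jt \<nu>) = det Mu"
    by (simp add: jt_eq)
  also have "\<dots> = (\<Sum>j<Suc ?l. Mu $$ (0, j) * cofactor Mu 0 j)"
    by (rule laplace_expansion_row[OF Mu]) simp
  also have "\<dots> = (\<Sum>j<Suc ?l. monom (cof j) j)"
  proof (rule sum.cong)
    fix j assume "j \<in> {..<Suc ?l}"
    moreover have "cofactor Mu 0 j = [:cof j:]"
      unfolding cofactor_def cof_def delu C.hom_det by (cases "even j") simp_all
    ultimately show "Mu $$ (0, j) * cofactor Mu 0 j = monom (cof j) j"
      by (simp add: Mu_def smult_monom)
  qed simp
  finally have 2: "translate 1 (jt \<nu>) = (\<Sum>j\<le>?l. monom (cof j) j)"
    by (simp add: lessThan_Suc_atMost)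
  show ?thesis using that[of cof] 1 2 by blast
qed

lemma coeff_translate_jt:
  assumes "k > length \<nu>"
  shows "coeff (translate 1 (jt \<nu>)) k = 0"
proof -
  obtain cof where "translate 1 (jt \<nu>) = (\<Sum>j\<le>length \<nu>. monom (cof j :: 'a sym) j)"
    using jt_Cons_expansion[where \<nu> = \<nu>] by blast
  then show ?thesis using assms by (auto simp: coeff_sum intro!: sum.neutral)
qed

text \<open>Bernstein's formula: adding a row in front is a vertex operator.\<close>

lemma vertex_hint_jt: "vertex 1 (hint 1) n (jt \<nu>) = jt (n # \<nu>)"
proof -
  obtain cof where cof: "\<forall>n. jt (n # \<nu>) = (\<Sum>j\<le>length \<nu>. hint 1 (n + int j) * cof j :: 'a sym)"
    "translate 1 (jt \<nu>) = (\<Sum>j\<le>length \<nu>. monom (cof j) j)"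
    using jt_Cons_expansion[where \<nu> = \<nu>] by blast
  have "coeff (translate 1 (jt \<nu>)) k = cof k" if "k \<le> length \<nu>" for k
    using that by (simp add: cof(2) coeff_sum)
  then show ?thesis
    unfolding vertex_def
    by (subst pair_superset[of "Suc (length \<nu>)"])
       (auto simp: cof(1) coeff_translate_jt lessThan_Suc_atMost intro!: sum.cong)
qed

subsection \<open>Straightening\<close>

lemma sorting_permutation:
  fixes xs :: "'a::linorder list"
  obtains \<sigma> where "\<sigma> permutes {..<length xs}"
    "\<forall>i j. i \<le> j \<longrightarrow> j < length xs \<longrightarrow> xs ! \<sigma> j \<le> xs ! \<sigma> i"
proof -
  obtain \<sigma> where \<sigma>: "\<sigma> permutes {..<length xs}" "permute_list \<sigma> xs = rev (sort xs)"
    using mset_eq_permutation[of "rev (sort xs)" xs] by auto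
  have "xs ! \<sigma> j \<le> xs ! \<sigma> i" if "i \<le> j" "j < length xs" for i j
  proof -
    have "sorted_wrt (\<ge>) (rev (sort xs))" by (simp add: sorted_wrt_rev)
    then have "rev (sort xs) ! i \<ge> rev (sort xs) ! j"
      using that by (cases "i = j") (auto simp: sorted_wrt_iff_nth_less)
    then show ?thesis using that by (simp add: \<sigma> permute_list_nth flip: \<sigma>(2))
  qed
  with \<sigma>(1) that show ?thesis by blast
qed

lemma length_straight_act [simp]: "length (straight_act \<nu> \<sigma>) = length \<nu>"
  by (simp add: straight_act_def)

lemma length_add_delta [simp]: "length (add_delta \<nu>) = length \<nu>"
  by (simp add: add_delta_def)

lemma nth_add_delta: "i < length \<nu> \<Longrightarrow> add_delta \<nu> ! i = \<nu> ! i + (int (length \<nu>) - 1 - int i)"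
  by (simp add: add_delta_def)

lemma nth_straight_act:
  assumes "\<sigma> permutes {..<length \<nu>}" "i < length \<nu>"
  shows "straight_act \<nu> \<sigma> ! i = \<nu> ! \<sigma> i - int (\<sigma> i) + int i"
proof -
  have "\<sigma> i < length \<nu>" using permutes_in_image[OF assms(1), of i] assms(2) by simp
  with assms(2) show ?thesis by (simp add: straight_act_def nth_add_delta)
qed

text \<open>Distinct integers in decreasing order drop by at least one at each step, which is
  exactly what subtracting the staircase \<delta> costs.\<close>

lemma sorting_straight_act:
  assumes "distinct (add_delta \<nu>)"
  obtains \<sigma> where "\<sigma> permutes {..<length \<nu>}" "sorted_wrt (\<ge>) (straight_act \<nu> \<sigma>)"
proof -
  let ?l = "length \<nu>"
  obtain \<sigma> where \<sigma>: "\<sigma> permutes {..<?l}"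
    "\<forall>i j. i \<le> j \<longrightarrow> j < ?l \<longrightarrow> add_delta \<nu> ! \<sigma> j \<le> add_delta \<nu> ! \<sigma> i"
    using sorting_permutation[of "add_delta \<nu>", unfolded length_add_delta] by blast
  have "sorted_wrt (\<ge>) (straight_act \<nu> \<sigma>)"
    unfolding sorted_wrt_iff_nth_less
  proof (intro allI impI)
    fix i j assume ij: "i < j" "j < length (straight_act \<nu> \<sigma>)"
    have "straight_act \<nu> \<sigma> ! (i + d) \<le> straight_act \<nu> \<sigma> ! i" if "i + d < ?l" for i d
      using that
    proof (induction d)
      case (Suc d)
      have l: "\<sigma> (i + d) < ?l" "\<sigma> (i + Suc d) < ?l"
        using permutes_in_image[OF \<sigma>(1)] Suc.prems by auto
      have "\<sigma> (i + d) \<noteq> \<sigma> (i + Suc d)"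
        using permutes_inj[OF \<sigma>(1)] by (metis add_Suc_right inj_eq n_not_Suc_n)
      then have "add_delta \<nu> ! \<sigma> (i + d) \<noteq> add_delta \<nu> ! \<sigma> (i + Suc d)"
        using assms l by (simp add: nth_eq_iff_index_eq)
      moreover have "add_delta \<nu> ! \<sigma> (i + Suc d) \<le> add_delta \<nu> ! \<sigma> (i + d)"
        using \<sigma>(2)[rule_format, of "i + d" "i + Suc d"] Suc.prems by simp
      ultimately show ?case using Suc by (simp add: straight_act_def)
    qed simp
    from this[of i "j - i"] ij show "straight_act \<nu> \<sigma> ! i \<ge> straight_act \<nu> \<sigma> ! j"
      by simp
  qed
  with \<sigma>(1) that show ?thesis by blast
qed

text \<open>Outside the straightening case the determinant vanishes too: a repeated entry of \<nu> +
  \<delta> gives equal rows, and if the sorted tuple is not a partition, its last entry is negative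
  and the last row is zero.\<close>

lemma schur_tuple_eq_jt: "schur_tuple \<nu> = (jt \<nu> :: 'k::field_char_0 sym)"
proof -
  let ?l = "length \<nu>"
  have act: "jt (straight_act \<nu> \<sigma>) = of_int (sign \<sigma>) * (jt \<nu> :: 'k sym)" if "\<sigma> permutes {..<?l}" for \<sigma>
    by (rule jt_permute[OF that]) (simp_all add: nth_straight_act[OF that])
  show ?thesis
  proof (cases "\<exists>\<sigma>. straightens \<nu> \<sigma>")
    case True
    then obtain \<sigma> where \<sigma>: "straightens \<nu> \<sigma>" by blast
    then have "(THE \<sigma>. straightens \<nu> \<sigma>) = \<sigma>"
      using straightens_unique by blast
    moreover have "schur (straight_act \<nu> \<sigma>) = (jt (straight_act \<nu> \<sigma>) :: 'k sym)"
      using \<sigma> by (simp add: straightens_def schur_eq_jt)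
    moreover have "of_int (sign \<sigma>) * (of_int (sign \<sigma>) * jt \<nu>) = (jt \<nu> :: 'k sym)"
      by (cases rule: sign_cases[of \<sigma>]) auto
    moreover have "\<sigma> permutes {..<?l}" using \<sigma> by (simp add: straightens_def)
    ultimately show ?thesis
      using True act[of \<sigma>] by (simp add: schur_tuple_def Let_def)
  next
    case False
    have "jt \<nu> = (0 :: 'k sym)"
    proof (cases "distinct (add_delta \<nu>)")
      case True
      then obtain \<sigma> where \<sigma>: "\<sigma> permutes {..<?l}" and sorted: "sorted_wrt (\<ge>) (straight_act \<nu> \<sigma>)"
        by (rule sorting_straight_act)
      have "\<not> is_partition (straight_act \<nu> \<sigma>)"
        using False \<sigma> True by (auto simp: straightens_def)
      then obtain i where i: "i < ?l" "straight_act \<nu> \<sigma> ! i < 0"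
        using sorted by (auto simp: is_partition_def in_set_conv_nth)
      have "straight_act \<nu> \<sigma> ! (?l - 1) < 0"
      proof (cases "i = ?l - 1")
        case False
        then have "straight_act \<nu> \<sigma> ! (?l - 1) \<le> straight_act \<nu> \<sigma> ! i"
          using sorted i(1) by (auto simp: sorted_wrt_iff_nth_less)
        then show ?thesis using i by simp
      qed (use i in simp)
      then have "jt (straight_act \<nu> \<sigma>) = (0 :: 'k sym)"
        by (intro jt_eq_0_neg[of "?l - 1"]) (use i in \<open>auto simp: of_nat_diff\<close>)
      with act[OF \<sigma>] show ?thesis
        by (cases rule: sign_cases[of \<sigma>]) auto
    next
      case False
      then obtain i j where ij: "i < ?l" "j < ?l" "i \<noteq> j" "add_delta \<nu> ! i = add_delta \<nu> ! j"
        by (auto simp: distinct_conv_nth add_delta_def)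
      then show ?thesis by (intro jt_eq_0_repeat[of i _ j]) (auto simp: add_delta_def)
    qed
    with False show ?thesis by (simp add: schur_tuple_def)
  qed
qed

subsection \<open>Products of vertex operators\<close>

text \<open>For \<open>\<epsilon> = 1\<close>, \<open>hh \<epsilon> t n\<close> is the coefficient of \<open>z\<^sup>n\<close> in \<open>H(tz) H(z)\<close>, where \<open>H(z) = \<Sum>\<^sub>n h\<^sub>n z\<^sup>n\<close>.\<close>

definition hh :: "'k::field_char_0 \<Rightarrow> 'k \<Rightarrow> int \<Rightarrow> 'k sym" where
  "hh \<epsilon> t n = (if n < 0 then 0
     else \<Sum>i\<le>nat n. sym_const (t ^ i) * hgen \<epsilon> i * hgen \<epsilon> (nat n - i))"

lemma hh_eq:
  assumes "n < int N"
  shows "hh \<epsilon> t n = (\<Sum>i<N. sym_const (t ^ i) * hgen \<epsilon> i * hint \<epsilon> (n - int i))"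
proof (cases "n < 0")
  case False
  have "hh \<epsilon> t n = (\<Sum>i\<in>{..nat n}. sym_const (t ^ i) * hgen \<epsilon> i * hint \<epsilon> (n - int i))"
    using False by (auto simp: hh_def hint_def nat_diff_distrib intro!: sum.cong)
  also have "\<dots> = (\<Sum>i<N. sym_const (t ^ i) * hgen \<epsilon> i * hint \<epsilon> (n - int i))"
    by (rule sum.mono_neutral_left) (use assms False in auto)
  finally show ?thesis .
qed (simp add: hh_def)

text \<open>The factor \<open>H(tz)\<close> can be taken out of the pairing, which leaves
  Bernstein's operator. The bound on \<open>N\<close> covers every index \<open>n + j\<close> that
  the pairing meets, since the translate of \<open>jt \<nu>\<close> has degree at most
  \<open>length \<nu>\<close>; so nothing is truncated.\<close>

lemma vertex_hh_jt:
  assumes "int (length \<nu>) + n < int N"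
  shows "vertex 1 (hh 1 t) n (jt \<nu>) =
    (\<Sum>k<N. sym_const (t ^ k) * hgen 1 k * jt ((n - int k) # \<nu>))"
proof -
  let ?c = "coeff (translate 1 (jt \<nu> :: 'a sym))"
  have "vertex 1 (hh 1 t) n (jt \<nu>) = (\<Sum>j<Suc (length \<nu>). hh 1 t (n + int j) * ?c j)"
    unfolding vertex_def by (rule pair_superset) (simp add: coeff_translate_jt)
  also have "\<dots> = (\<Sum>j<Suc (length \<nu>).
      (\<Sum>k<N. sym_const (t ^ k) * hgen 1 k * hint 1 (n + int j - int k)) * ?c j)"
  proof (rule sum.cong)
    fix j assume "j \<in> {..<Suc (length \<nu>)}"
    then show "hh 1 t (n + int j) * ?c j =
        (\<Sum>k<N. sym_const (t ^ k) * hgen 1 k * hint 1 (n + int j - int k)) * ?c j"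
      using assms by (subst hh_eq[of _ N]) auto
  qed simp
  also have "\<dots> = (\<Sum>k<N. \<Sum>j<Suc (length \<nu>).
      sym_const (t ^ k) * hgen 1 k * (hint 1 (n - int k + int j) * ?c j))"
    unfolding sum_distrib_right
    by (subst sum.swap) (simp add: algebra_simps del: sum.lessThan_Suc)
  also have "\<dots> = (\<Sum>k<N. sym_const (t ^ k) * hgen 1 k * jt ((n - int k) # \<nu>))"
  proof (rule sum.cong)
    fix k
    have "jt ((n - int k) # \<nu>) = (\<Sum>j<Suc (length \<nu>). hint 1 (n - int k + int j) * ?c j)"
      unfolding vertex_hint_jt[symmetric] vertex_def
      by (rule pair_superset) (simp add: coeff_translate_jt)
    then show "(\<Sum>j<Suc (length \<nu>). sym_const (t ^ k) * hgen 1 k * (hint 1 (n - int k + int j) * ?c j)) =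
        sym_const (t ^ k) * hgen 1 k * jt ((n - int k) # \<nu>)"
      by (simp only: sum_distrib_left[symmetric])
  qed simp
  finally show ?thesis .
qed

text \<open>
  \<open>hsum N t F a = \<Sum>\<^sub>k t\<^bsup>|k|\<^esup> h\<^bsub>k\<^sub>1\<^esub> \<cdots> h\<^bsub>k\<^sub>r\<^esub> F(- a - k)\<close> over \<open>k \<in> {0, \<dots>, N - 1}\<^sup>r\<close>, and
  \<open>subset_sum t F x a = \<Sum>\<^sub>S (- t)\<^bsup>|S|\<^esup> F(x - |S|, a + 1\<^sub>S)\<close> over the sets \<open>S\<close> of positions in \<open>a\<close>,
  the effect of \<open>\<Prod>\<^sub>j (1 - t z\<^sub>j / z\<^sub>0)\<close> on exponents.
\<close>

fun hsum :: "nat \<Rightarrow> 'k::field_char_0 \<Rightarrow> (int list \<Rightarrow> 'k sym) \<Rightarrow> int list \<Rightarrow> 'k sym" where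
  "hsum N t F [] = F []"
| "hsum N t F (a # as) =
     (\<Sum>k<N. sym_const (t ^ k) * hgen 1 k * hsum N t (\<lambda>l. F ((- a - int k) # l)) as)"

fun subset_sum ::
    "'k::field_char_0 \<Rightarrow> (int \<Rightarrow> int list \<Rightarrow> 'k sym) \<Rightarrow> int \<Rightarrow> int list \<Rightarrow> 'k sym" where
  "subset_sum t F x [] = F x []"
| "subset_sum t F x (a # as) = subset_sum t (\<lambda>y l. F y (a # l)) x as -
     sym_const t * subset_sum t (\<lambda>y l. F y ((a + 1) # l)) (x - 1) as"

lemma hsum_cong:
  "(\<And>l. length l = length as \<Longrightarrow> F l = G l) \<Longrightarrow> hsum N t F as = hsum N t G as"
proof (induction as arbitrary: F G)
  case (Cons a as)
  have "hsum N t (\<lambda>l. F ((- a - int k) # l)) as = hsum N t (\<lambda>l. G ((- a - int k) # l)) as" for k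
    by (rule Cons.IH) (simp add: Cons.prems)
  then show ?case by simp
qed simp

lemma hsum_lincomb:
  "hsum N t (\<lambda>l. \<Sum>i\<in>A. c i * F i l) as = (\<Sum>i\<in>A. c i * hsum N t (F i) as)"
proof (induction as arbitrary: F)
  case (Cons a as)
  show ?case
    unfolding hsum.simps Cons.IH sum_distrib_left by (subst sum.swap) (simp add: mult_ac)
qed simp

lemma hsum_scale: "hsum N t (\<lambda>l. c * F l) as = c * hsum N t F as"
  using hsum_lincomb[of N t "\<lambda>_. c" "\<lambda>_. F" "{()}" as] by simp

lemma hsum_zero: "hsum N t (\<lambda>l. 0) as = 0"
  using hsum_scale[of N t 0 "\<lambda>_. 0" as] by simp

lemma subset_sum_cong:
  "(\<And>y l. x - int (length as) \<le> y \<Longrightarrow> length l = length as \<Longrightarrow> F y l = G y l) \<Longrightarrow>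
     subset_sum t F x as = subset_sum t G x as"
proof (induction as arbitrary: F G x)
  case (Cons a as)
  have "subset_sum t (\<lambda>y l. F y (a # l)) x as = subset_sum t (\<lambda>y l. G y (a # l)) x as"
    by (rule Cons.IH) (simp add: Cons.prems)
  moreover have "subset_sum t (\<lambda>y l. F y ((a + 1) # l)) (x - 1) as =
      subset_sum t (\<lambda>y l. G y ((a + 1) # l)) (x - 1) as"
    by (rule Cons.IH) (simp add: Cons.prems)
  ultimately show ?case by simp
qed simp

lemma subset_sum_lincomb:
  "subset_sum t (\<lambda>y l. \<Sum>i\<in>A. c i * F i y l) x as = (\<Sum>i\<in>A. c i * subset_sum t (F i) x as)"
proof (induction as arbitrary: F x)
  case (Cons a as)
  show ?case
    unfolding subset_sum.simps Cons.IH
    by (simp add: right_diff_distrib sum_subtractf sum_distrib_left mult.left_commute)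
qed simp

lemma subset_sum_scale: "subset_sum t (\<lambda>y l. c * F y l) x as = c * subset_sum t F x as"
  using subset_sum_lincomb[of t "\<lambda>_. c" "\<lambda>_. F" "{()}" x as] by simp

lemma subset_sum_zero: "subset_sum t (\<lambda>y l. 0) x as = 0"
  using subset_sum_scale[of t 0 "\<lambda>y l. 0" x as] by simp

lemma subset_sum_shift: "subset_sum t (\<lambda>y l. F (y - 1) l) x as = subset_sum t F (x - 1) as"
proof (induction as arbitrary: F x)
  case (Cons a as)
  show ?case
    using Cons.IH[of "\<lambda>y l. F y (a # l)" x] Cons.IH[of "\<lambda>y l. F y ((a + 1) # l)" "x - 1"] by simp
qed simp

text \<open>The operator is moved past one \<open>h_k\<close> after another by
  \<open>vertex_hint\<close>. In the correction term \<open>k\<close> drops by one; after reindexing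
  this is a factor \<open>t\<close> and the entry \<open>a\<close> raised by one, which is the
  recursion of \<open>subset_sum\<close>. The hypotheses make the cutoff at \<open>N\<close>
  harmless.\<close>

lemma vertex_hsum:
  assumes "\<And>l e. length l = length as \<Longrightarrow> e \<in> set l \<Longrightarrow> e \<le> - L \<Longrightarrow> F l = 0"
    and "\<And>a. a \<in> set as \<Longrightarrow> L - int N \<le> a"
  shows "vertex 1 w (- x) (hsum N t F as) =
    subset_sum t (\<lambda>y l. hsum N t (\<lambda>\<nu>. vertex 1 w (- y) (F \<nu>)) l) x as"
  using assms
proof (induction as arbitrary: F x)
  case (Cons a as)
  define Z where "Z = (\<lambda>k x. subset_sum t
     (\<lambda>y l. hsum N t (\<lambda>\<nu>. vertex 1 w (- y) (F ((- a - int k) # \<nu>))) l) x as)"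
  define g where "g = (\<lambda>k. sym_const (t ^ k) * hint 1 (int k - 1) * Z k (x - 1))"
  have IH: "vertex 1 w (- x) (hsum N t (\<lambda>l. F ((- a - int k) # l)) as) = Z k x" for k x
    unfolding Z_def
  proof (rule Cons.IH)
    fix l e assume "length l = length as" "e \<in> set l" "e \<le> - L"
    then show "F ((- a - int k) # l) = 0"
      by (intro Cons.prems(1)[of _ e]) auto
  qed (use Cons.prems in auto)
  \<comment> \<open>The boundary term of the reindexing: at \<open>k = N\<close> the first entry
    \<open>- a - N\<close> is at most \<open>- L\<close>, so \<open>F\<close> vanishes.\<close>
  have "Z N (x - 1) = subset_sum t (\<lambda>y l. 0) (x - 1) as"
    unfolding Z_def
  proof (rule subset_sum_cong)
    fix y :: int and l :: "int list" assume l: "length l = length as"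
    have "hsum N t (\<lambda>\<nu>. vertex 1 w (- y) (F ((- a - int N) # \<nu>))) l = hsum N t (\<lambda>\<nu>. 0) l"
    proof (rule hsum_cong)
      fix \<nu> :: "int list" assume "length \<nu> = length l"
      then have "F ((- a - int N) # \<nu>) = 0"
        using l Cons.prems(2)[of a] by (intro Cons.prems(1)[of _ "- a - int N"]) auto
      then show "vertex 1 w (- y) (F ((- a - int N) # \<nu>)) = 0" by simp
    qed
    then show "hsum N t (\<lambda>\<nu>. vertex 1 w (- y) (F ((- a - int N) # \<nu>))) l = 0"
      by (simp only: hsum_zero)
  qed
  then have gN: "g N = 0" by (simp add: g_def subset_sum_zero)
  have "vertex 1 w (- x) (hsum N t F (a # as)) = (\<Sum>k<N. sym_const (t ^ k) *
      vertex 1 w (- x) (hint 1 (int k) * hsum N t (\<lambda>l. F ((- a - int k) # l)) as))"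
    by (simp add: vertex_sum vertex_const mult.assoc)
  also have "\<dots> = (\<Sum>k<N. sym_const (t ^ k) * hgen 1 k * Z k x - g k)"
  proof (rule sum.cong)
    fix k
    have "vertex 1 w (- x + 1) (hsum N t (\<lambda>l. F ((- a - int k) # l)) as) = Z k (x - 1)"
      using IH[of "x - 1" k] by simp
    then show "sym_const (t ^ k) *
        vertex 1 w (- x) (hint 1 (int k) * hsum N t (\<lambda>l. F ((- a - int k) # l)) as) =
        sym_const (t ^ k) * hgen 1 k * Z k x - g k"
      by (subst vertex_hint) (simp only: IH hint_of_nat g_def right_diff_distrib mult.assoc)
  qed simp
  also have "\<dots> = (\<Sum>k<N. sym_const (t ^ k) * hgen 1 k * Z k x) - (\<Sum>k<N. g k)"
    by (rule sum_subtractf)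
  also have "(\<Sum>k<N. g k) = (\<Sum>k<Suc N. g k)" using gN by simp
  also have "\<dots> = (\<Sum>k<N. g (Suc k))"
    unfolding sum.lessThan_Suc_shift by (simp add: g_def)
  also have "\<dots> = sym_const t * (\<Sum>k<N. sym_const (t ^ k) * hgen 1 k * Z (Suc k) (x - 1))"
    by (simp add: g_def sum_distrib_left mult.assoc flip: sym_const_mult)
  finally have eq: "vertex 1 w (- x) (hsum N t F (a # as)) =
      (\<Sum>k<N. sym_const (t ^ k) * hgen 1 k * Z k x) -
      sym_const t * (\<Sum>k<N. sym_const (t ^ k) * hgen 1 k * Z (Suc k) (x - 1))" .
  \<comment> \<open>The shift in the summation index turns into the shift of
    \<open>a\<close>.\<close>
  have "- a - int (Suc k) = - (a + 1) - int k" for k by simp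
  then show ?case
    unfolding eq by (simp only: subset_sum.simps hsum.simps subset_sum_lincomb Z_def)
qed simp

text \<open>The weights are symmetric in the two summation indices, so exchanging these along with
  the entries transfers the alternation of \<open>F\<close> to \<open>hsum\<close>. Since
  \<open>F\<close> is applied to negated entries, the shifts by one change direction.\<close>

lemma hsum_swap:
  assumes "\<And>u a b v. F (u @ a # b # v) = - F (u @ (b - 1) # (a + 1) # v)"
  shows "hsum N t F (u @ a # b # v) = - hsum N t F (u @ (b + 1) # (a - 1) # v)"
  using assms
proof (induction u arbitrary: F)
  case Nil
  have "hsum N t (\<lambda>l. F ((- a - int k) # (- b - int j) # l)) v =
      - hsum N t (\<lambda>l. F ((- (b + 1) - int j) # (- (a - 1) - int k) # l)) v" for k j
  proof -
    have "hsum N t (\<lambda>l. F ((- a - int k) # (- b - int j) # l)) v =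
        hsum N t (\<lambda>l. - 1 * F ((- (b + 1) - int j) # (- (a - 1) - int k) # l)) v"
    proof (rule hsum_cong)
      fix l
      have "- b - int j - 1 = - (b + 1) - int j" "- a - int k + 1 = - (a - 1) - int k"
        by simp_all
      then show "F ((- a - int k) # (- b - int j) # l) =
          - 1 * F ((- (b + 1) - int j) # (- (a - 1) - int k) # l)"
        using Nil[of "[]" "- a - int k" "- b - int j" l] by (simp only: append_Nil mult_minus1)
    qed
    then show ?thesis by (simp only: hsum_scale) simp
  qed
  then have "hsum N t F ([] @ a # b # v) = (\<Sum>k<N. \<Sum>j<N. sym_const (t ^ k) * hgen 1 k *
      (sym_const (t ^ j) * hgen 1 j *
        - hsum N t (\<lambda>l. F ((- (b + 1) - int j) # (- (a - 1) - int k) # l)) v))"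
    by (simp only: append_Nil hsum.simps sum_distrib_left)
  also have "\<dots> = - (\<Sum>j<N. \<Sum>k<N. sym_const (t ^ j) * hgen 1 j *
      (sym_const (t ^ k) * hgen 1 k *
        hsum N t (\<lambda>l. F ((- (b + 1) - int j) # (- (a - 1) - int k) # l)) v))"
    by (subst sum.swap) (simp add: sum_negf mult_ac)
  finally show ?case
    by (simp only: append_Nil hsum.simps sum_distrib_left)
next
  case (Cons c u)
  have "hsum N t (\<lambda>l. F ((- c - int k) # l)) (u @ a # b # v) =
      - hsum N t (\<lambda>l. F ((- c - int k) # l)) (u @ (b + 1) # (a - 1) # v)" for k
  proof (rule Cons.IH)
    fix u :: "int list" and a b v
    show "F ((- c - int k) # u @ a # b # v) = - F ((- c - int k) # u @ (b - 1) # (a + 1) # v)"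
      using Cons.prems[of "(- c - int k) # u" a b v] by (simp only: append_Cons)
  qed
  then show ?case by (simp add: sum_negf)
qed

section \<open>Cancellation along a staircase of step two\<close>

text \<open>The indices that come after \<open>x\<close>, without \<open>x\<close> itself: for
  \<open>x = c + 2r\<close> and \<open>n = r\<close> they are those of the \<open>r\<close> factors
  already applied.\<close>

fun staircase :: "int \<Rightarrow> nat \<Rightarrow> int list" where
  "staircase x 0 = []"
| "staircase x (Suc n) = (x - 2) # staircase (x - 2) n"

lemma length_staircase [simp]: "length (staircase x n) = n"
  by (induction n arbitrary: x) auto

lemma staircase_ge: "a \<in> set (staircase x n) \<Longrightarrow> x - 2 * int n \<le> a"
  by (induction n arbitrary: x) force+

lemma nth_staircase: "j < n \<Longrightarrow> staircase x n ! j = x - 2 * (int j + 1)"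
  by (induction n arbitrary: x j) (auto simp: nth_Cons' of_nat_diff)

text \<open>
  A nonempty set \<open>S\<close> of positions after \<open>z\<close> contributes \<open>0\<close>: its least element and the position
  before it carry entries \<open>w - 1\<close> and \<open>w\<close>.
\<close>

lemma subset_sum_staircase_avoid:
  assumes "\<And>y u w v. F y (u @ w # (w - 1) # v) = 0"
  shows "subset_sum t (\<lambda>y l. F y (z # l)) x (staircase z n) = F x (z # staircase z n)"
  using assms
proof (induction n arbitrary: F z)
  case (Suc n)
  have "subset_sum t (\<lambda>y l. F y (z # (z - 2) # l)) x (staircase (z - 2) n) =
      F x (z # (z - 2) # staircase (z - 2) n)"
    by (rule Suc.IH[of "\<lambda>y l. F y (z # l)"]) (use Suc.prems[of _ "_ # _"] in simp)
  moreover have "F y (z # (z - 2 + 1) # l) = 0" for y l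
    using Suc.prems[of y "[]" z l] by simp
  ultimately show ?case by (simp add: subset_sum_zero)
qed simp

text \<open>If the first staircase position is not in the subset, only the empty subset survives and
  contributes 1. If it is, alternation turns the pair \<open>y, x - 1\<close> into
  \<open>x, y - 1\<close> with a sign, and the rest is the same sum starting at \<open>x - 2\<close>
  with \<open>x\<close> moved into the prefix. So the scalars satisfy
  \<open>c_(n+1) = 1 + t c_n\<close>.\<close>

lemma subset_sum_staircase:
  assumes "\<And>u a b v. \<Phi> (u @ a # b # v) = - \<Phi> (u @ (b + 1) # (a - 1) # v)"
  shows "subset_sum t (\<lambda>y l. \<Phi> (pre @ y # l)) x (staircase x n) =
    sym_const (\<Sum>i\<le>n. t ^ i) * \<Phi> (pre @ x # staircase x n)"
proof (induction n arbitrary: pre x)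
  case (Suc n)
  \<comment> \<open>The pair \<open>w, w - 1\<close> is its own image under the exchange, so the
    value equals its negative.\<close>
  have vanish: "\<Phi> (u @ w # (w - 1) # v) = 0" for u w v
  proof -
    have "\<Phi> (u @ w # (w - 1) # v) + \<Phi> (u @ w # (w - 1) # v) = 0"
      using assms[of u w "w - 1" v] by (simp add: eq_neg_iff_add_eq_0)
    then show ?thesis by (simp flip: mult_2)
  qed
  have 1: "subset_sum t (\<lambda>y l. \<Phi> (pre @ y # (x - 2) # l)) x (staircase (x - 2) n) =
      \<Phi> (pre @ x # (x - 2) # staircase (x - 2) n)"
    using subset_sum_staircase_avoid[of "\<lambda>y l. \<Phi> (pre @ y # l)" t "x - 2" x n]
      vanish[of "pre @ _ # _"] by simp
  have "subset_sum t (\<lambda>y l. \<Phi> (pre @ y # (x - 1) # l)) (x - 1) (staircase (x - 2) n) =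
      subset_sum t (\<lambda>y l. - 1 * \<Phi> ((pre @ [x]) @ (y - 1) # l)) (x - 1) (staircase (x - 2) n)"
    using assms[of pre _ "x - 1"] by (intro subset_sum_cong) simp
  also have "\<dots> = - subset_sum t (\<lambda>y l. \<Phi> ((pre @ [x]) @ y # l)) (x - 2) (staircase (x - 2) n)"
    using subset_sum_shift[of t "\<lambda>y l. \<Phi> ((pre @ [x]) @ y # l)" "x - 1"]
    by (simp only: subset_sum_scale) simp
  also have "\<dots> = - (sym_const (\<Sum>i\<le>n. t ^ i) * \<Phi> (pre @ x # (x - 2) # staircase (x - 2) n))"
    using Suc.IH[of "pre @ [x]" "x - 2"] by simp
  finally have 2: "subset_sum t (\<lambda>y l. \<Phi> (pre @ y # (x - 2 + 1) # l)) (x - 1) (staircase (x - 2) n) =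
      - (sym_const (\<Sum>i\<le>n. t ^ i) * \<Phi> (pre @ x # (x - 2) # staircase (x - 2) n))"
    by simp
  have "(\<Sum>i\<le>Suc n. t ^ i) = 1 + t * (\<Sum>i\<le>n. t ^ i)"
    by (subst sum.atMost_Suc_shift) (simp add: sum_distrib_left)
  then show ?case
    unfolding staircase.simps subset_sum.simps 1 2
    by (simp add: sym_const_add sym_const_mult[symmetric] distrib_right mult.assoc)
qed simp

primrec vertex_iter ::
    "'k::field_char_0 \<Rightarrow> (int \<Rightarrow> 'k sym) \<Rightarrow> int \<Rightarrow> nat \<Rightarrow> 'k sym \<Rightarrow> 'k sym" where
  "vertex_iter \<epsilon> w c 0 f = f"
| "vertex_iter \<epsilon> w c (Suc r) f = vertex \<epsilon> w (- (c + 2 * int r)) (vertex_iter \<epsilon> w c r f)"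

text \<open>Only \<open>r\<close> runs in the induction while \<open>R\<close> stays fixed, so that
  one cutoff \<open>N\<close> is large enough at all stages.\<close>

lemma vertex_iter_jt:
  assumes "int R + int (length \<mu>) - c < int N" "r \<le> R"
  shows "vertex_iter 1 (hh 1 t) c r (jt \<mu>) = sym_const (\<Prod>k<r. \<Sum>i\<le>k. t ^ i) *
    hsum N t (\<lambda>\<nu>. jt (\<nu> @ \<mu>)) (staircase (c + 2 * int r) r)"
  using assms(2)
proof (induction r)
  case (Suc r)
  define x where "x = c + 2 * int r"
  define \<Phi> where "\<Phi> = hsum N t (\<lambda>\<nu>. jt (\<nu> @ \<mu>))"
  have "vertex 1 (hh 1 t) (- x) (\<Phi> (staircase x r)) = subset_sum t (\<lambda>y l. hsum N t
     (\<lambda>\<nu>. vertex 1 (hh 1 t) (- y) (jt (\<nu> @ \<mu>))) l) x (staircase x r)"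
    unfolding \<Phi>_def
  proof (rule vertex_hsum[where L = "int R + int (length \<mu>)"])
    \<comment> \<open>The determinant has at most \<open>R + length \<mu>\<close> rows, so an entry
      this negative produces a zero row.\<close>
    fix l e assume l: "length l = length (staircase x r)" "e \<in> set l" "e \<le> - (int R + int (length \<mu>))"
    then obtain i where "i < length l" "l ! i = e" by (auto simp: in_set_conv_nth)
    then show "jt (l @ \<mu>) = 0"
      using l Suc.prems by (intro jt_eq_0_neg[of i]) (auto simp: nth_append)
  next
    fix a assume "a \<in> set (staircase x r)"
    then show "int R + int (length \<mu>) - int N \<le> a"
      using staircase_ge[of a x r] assms(1) by (simp add: x_def)
  qed
  also have "\<dots> = subset_sum t (\<lambda>y l. \<Phi> ([] @ y # l)) x (staircase x r)"
  proof (rule subset_sum_cong)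
    fix y :: int and l :: "int list"
    assume y: "x - int (length (staircase x r)) \<le> y" and l: "length l = length (staircase x r)"
    have "hsum N t (\<lambda>\<nu>. vertex 1 (hh 1 t) (- y) (jt (\<nu> @ \<mu>))) l =
        hsum N t (\<lambda>\<nu>. \<Sum>k<N. sym_const (t ^ k) * hgen 1 k * jt ((- y - int k) # \<nu> @ \<mu>)) l"
    proof (rule hsum_cong)
      fix \<nu> :: "int list" assume "length \<nu> = length l"
      then show "vertex 1 (hh 1 t) (- y) (jt (\<nu> @ \<mu>)) =
          (\<Sum>k<N. sym_const (t ^ k) * hgen 1 k * jt ((- y - int k) # \<nu> @ \<mu>))"
        using y l assms(1) Suc.prems by (intro vertex_hh_jt) (simp add: x_def)
    qed
    then show "hsum N t (\<lambda>\<nu>. vertex 1 (hh 1 t) (- y) (jt (\<nu> @ \<mu>))) l = \<Phi> ([] @ y # l)"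
      by (simp add: hsum_lincomb \<Phi>_def)
  qed
  also have "\<dots> = sym_const (\<Sum>i\<le>r. t ^ i) * \<Phi> ([] @ x # staircase x r)"
  proof (rule subset_sum_staircase)
    fix u v :: "int list" and a b
    show "\<Phi> (u @ a # b # v) = - \<Phi> (u @ (b + 1) # (a - 1) # v)"
      unfolding \<Phi>_def
    proof (rule hsum_swap)
      fix u v :: "int list" and a b
      show "jt ((u @ a # b # v) @ \<mu>) = - jt ((u @ (b - 1) # (a + 1) # v) @ \<mu>)"
        using jt_swap[of u a b "v @ \<mu>"] by (simp only: append_assoc append_Cons)
    qed
  qed
  also have "[] @ x # staircase x r = staircase (c + 2 * int (Suc r)) (Suc r)"
    by (simp add: x_def algebra_simps)
  finally show ?case
    using Suc by (simp add: vertex_const x_def \<Phi>_def mult_ac flip: sym_const_mult)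
qed simp

section \<open>From sums over tuples to sums over partitions\<close>

lemma hsum_lists:
  "hsum N t F as = (\<Sum>ks | set ks \<subseteq> {0..<int N} \<and> length ks = length as.
     sym_const (t ^ nat (sum_list ks)) * prod_list (map (hint 1) ks) * F (map2 (\<lambda>a k. - a - k) as ks))"
proof (induction as arbitrary: F)
  case Nil
  have "{ks. set ks \<subseteq> {0..<int N} \<and> length ks = length ([] :: int list)} = {[]}" by auto
  then show ?case by simp
next
  case (Cons a as)
  define B where "B = {ks. set ks \<subseteq> {0..<int N} \<and> length ks = length as}"
  define g where "g = (\<lambda>ks. sym_const (t ^ nat (sum_list ks)) * prod_list (map (hint 1) ks) *
     F (map2 (\<lambda>a k. - a - k) (a # as) ks))"
  have "hsum N t F (a # as) = (\<Sum>k<N. \<Sum>ks\<in>B. g (int k # ks))"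
    unfolding hsum.simps Cons.IH sum_distrib_left B_def[symmetric]
  proof (intro sum.cong refl)
    fix k ks assume "ks \<in> B"
    then have "sum_list ks \<ge> 0" by (auto simp: B_def intro!: sum_list_nonneg)
    then have "t ^ nat (int k + sum_list ks) = t ^ k * t ^ nat (sum_list ks)"
      by (simp add: nat_add_distrib power_add)
    then show "sym_const (t ^ k) * hgen 1 k * (sym_const (t ^ nat (sum_list ks)) *
        prod_list (map (hint 1) ks) * F ((- a - int k) # map2 (\<lambda>a k. - a - k) as ks)) = g (int k # ks)"
      by (simp add: g_def mult_ac flip: sym_const_mult)
  qed
  also have "\<dots> = (\<Sum>k\<in>{0..<int N}. \<Sum>ks\<in>B. g (k # ks))"
    by (rule sum.reindex_bij_witness[of _ nat int]) auto
  also have "\<dots> = (\<Sum>(ks, k)\<in>B \<times> {0..<int N}. g (k # ks))"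
    by (subst sum.swap) (simp add: sum.cartesian_product)
  also have "\<dots> = sum g ((\<lambda>(ks, k). k # ks) ` (B \<times> {0..<int N}))"
    by (subst sum.reindex) (auto simp: inj_on_def case_prod_unfold)
  also have "(\<lambda>(ks, k). k # ks) ` (B \<times> {0..<int N}) =
      {ks. set ks \<subseteq> {0..<int N} \<and> length ks = length (a # as)}"
    unfolding B_def list.size(4) lists_length_Suc_eq[symmetric] by simp
  finally show ?case by (simp add: g_def)
qed

lemma straight_act_compose:
  assumes "\<sigma> permutes {..<length \<nu>}" "\<tau> permutes {..<length \<nu>}"
  shows "straight_act (straight_act \<nu> \<sigma>) \<tau> = straight_act \<nu> (\<sigma> \<circ> \<tau>)"
proof (rule nth_equalityI)
  fix i assume "i < length (straight_act (straight_act \<nu> \<sigma>) \<tau>)"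
  then have i: "i < length \<nu>" by simp
  then have "\<tau> i < length \<nu>" using permutes_in_image[OF assms(2), of i] by simp
  then show "straight_act (straight_act \<nu> \<sigma>) \<tau> ! i = straight_act \<nu> (\<sigma> \<circ> \<tau>) ! i"
    using i assms permutes_compose[OF assms(2,1)] by (simp add: nth_straight_act)
qed simp

lemma straight_act_id: "straight_act \<nu> id = \<nu>"
  by (rule nth_equalityI) (simp_all add: nth_straight_act permutes_id)

lemma add_delta_straight_act:
  assumes "\<sigma> permutes {..<length \<nu>}"
  shows "add_delta (straight_act \<nu> \<sigma>) = map (\<lambda>i. add_delta \<nu> ! \<sigma> i) [0..<length \<nu>]"
  by (rule nth_equalityI) (simp_all add: add_delta_def straight_act_def)

lemma map_nth_permutes:
  assumes "\<sigma> permutes {..<length xs}"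
  shows "set (map (\<lambda>i. xs ! \<sigma> i) [0..<length xs]) = set xs"
    "distinct (map (\<lambda>i. xs ! \<sigma> i) [0..<length xs]) = distinct xs"
    "sum_list (map (\<lambda>i. xs ! \<sigma> i) [0..<length xs]) = sum_list (xs :: int list)"
proof -
  have m: "mset (map (\<lambda>i. xs ! \<sigma> i) [0..<length xs]) = mset xs"
    using mset_permute_list[OF assms] by (simp only: permute_list_def)
  show "set (map (\<lambda>i. xs ! \<sigma> i) [0..<length xs]) = set xs"
    using m by (rule mset_eq_setD)
  show "distinct (map (\<lambda>i. xs ! \<sigma> i) [0..<length xs]) = distinct xs"
    using m by (rule mset_eq_imp_distinct_iff)
  show "sum_list (map (\<lambda>i. xs ! \<sigma> i) [0..<length xs]) = sum_list xs"
    using arg_cong[OF m, of sum_mset] by (simp only: sum_mset_sum_list)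
qed

lemma sum_list_straight_act:
  assumes "\<sigma> permutes {..<length \<nu>}"
  shows "sum_list (straight_act \<nu> \<sigma>) = sum_list \<nu>"
proof -
  have *: "sum_list (add_delta \<nu>') = sum_list \<nu>' + (\<Sum>j<length \<nu>'. int (length \<nu>') - 1 - int j)" for \<nu>'
    by (simp add: sum_list_sum_nth nth_add_delta atLeast0LessThan sum.distrib)
  have "sum_list (add_delta (straight_act \<nu> \<sigma>)) = sum_list (add_delta \<nu>)"
    unfolding add_delta_straight_act[OF assms]
    using map_nth_permutes(3)[of \<sigma> "add_delta \<nu>"] assms by simp
  then show ?thesis by (simp add: *)
qed

lemma nth_shifted_neg: "i < length l \<Longrightarrow>
    shifted_neg l c ! i = - (l ! i) - 2 * (int (length l) - 1 - int i) - c"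
  by (simp add: shifted_neg_def)

lemma length_shifted_neg [simp]: "length (shifted_neg l c) = length l"
  by (simp add: shifted_neg_def)

lemma map2_staircase:
  assumes "length ks = r"
  shows "map2 (\<lambda>a k. - a - k) (staircase (c + 2 * int r) r) ks = shifted_neg ks c"
  by (rule nth_equalityI) (use assms in \<open>simp_all add: nth_staircase nth_shifted_neg\<close>)

text \<open>Entry minus position in \<open>shifted_neg \<nu> c\<close> is a constant minus
  \<open>\<nu> ! i - i\<close>. The term \<open>-2\<delta>\<close> is thus what makes the negated
  tuple alternate under the same action as \<nu>.\<close>

lemma jt_shifted_neg_straight_act:
  assumes "\<sigma> permutes {..<length \<nu>}"
  shows "jt (shifted_neg (straight_act \<nu> \<sigma>) c @ \<mu>) = of_int (sign \<sigma>) * jt (shifted_neg \<nu> c @ \<mu>)"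
proof (rule jt_permute)
  show "\<sigma> permutes {..<length (shifted_neg \<nu> c @ \<mu>)}"
    using permutes_subset[OF assms, of "{..<length \<nu> + length \<mu>}"] by simp
next
  fix i assume i: "i < length (shifted_neg \<nu> c @ \<mu>)"
  show "(shifted_neg (straight_act \<nu> \<sigma>) c @ \<mu>) ! i - int i =
      (shifted_neg \<nu> c @ \<mu>) ! \<sigma> i - int (\<sigma> i)"
  proof (cases "i < length \<nu>")
    case True
    then have "\<sigma> i < length \<nu>" using permutes_in_image[OF assms, of i] by simp
    with True show ?thesis
      by (simp add: nth_append nth_shifted_neg nth_straight_act[OF assms])
  next
    case False
    then have "\<sigma> i = i" using assms by (simp add: permutes_def)
    with False show ?thesis by (simp add: nth_append)
  qed
qed simp

lemma jt_eq_sum_straight_act: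
  "jt \<nu> = (\<Sum>\<sigma> | \<sigma> permutes {..<length \<nu>}.
     of_int (sign \<sigma>) * prod_list (map (hint 1) (straight_act \<nu> \<sigma>)))"
proof -
  let ?l = "length \<nu>"
  let ?A = "mat ?l ?l (\<lambda>(i, j). hint 1 (\<nu> ! i - int i + int j)) :: 'a sym mat"
  have "jt \<nu> = det (transpose_mat ?A)"
    by (simp add: jt_eq det_transpose[of _ ?l])
  also have "\<dots> = (\<Sum>\<sigma> | \<sigma> permutes {0..<?l}. of_int (sign \<sigma>) *
      (\<Prod>i = 0..<?l. transpose_mat ?A $$ (i, \<sigma> i)))"
    by (subst det_def') (auto simp: carrier_matI)
  also have "\<dots> = (\<Sum>\<sigma> | \<sigma> permutes {..<?l}.
     of_int (sign \<sigma>) * prod_list (map (hint 1) (straight_act \<nu> \<sigma>)))"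
    unfolding atLeast0LessThan
  proof (intro sum.cong refl arg_cong2[of _ _ _ _ "(*)"])
    fix \<sigma> assume "\<sigma> \<in> {\<sigma>. \<sigma> permutes {..<?l}}"
    then have \<sigma>: "\<sigma> permutes {..<?l}" by simp
    have "(\<Prod>i<?l. transpose_mat ?A $$ (i, \<sigma> i)) = (\<Prod>i<?l. hint 1 (straight_act \<nu> \<sigma> ! i))"
    proof (rule prod.cong)
      fix i assume "i \<in> {..<?l}"
      moreover from this have "\<sigma> i < ?l" using permutes_in_image[OF \<sigma>, of i] by simp
      ultimately show "transpose_mat ?A $$ (i, \<sigma> i) = hint 1 (straight_act \<nu> \<sigma> ! i)"
        by (simp add: nth_straight_act[OF \<sigma>])
    qed simp
    also have "\<dots> = prod_list (map (hint 1) (straight_act \<nu> \<sigma>))"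
      by (simp add: prod.list_conv_set_nth atLeast0LessThan)
    finally show "(\<Prod>i<?l. transpose_mat ?A $$ (i, \<sigma> i)) =
      prod_list (map (hint 1) (straight_act \<nu> \<sigma>))" .
  qed
  finally show ?thesis .
qed

text \<open>
  Up to terms that vanish, the tuples \<open>k\<close> with \<open>k + \<delta>\<close> injective are the \<open>\<sigma>(\<lambda> + \<delta>) - \<delta>\<close>, and the sum
  over \<open>\<sigma>\<close> is the expansion of a Jacobi-Trudi determinant.
\<close>

lemma hsum_jt_eq_sum_partitions:
  assumes "int r + int (length \<mu>) - c < int N"
  shows "hsum N t (\<lambda>\<nu>. jt (\<nu> @ \<mu>)) (staircase (c + 2 * int r) r) =
    Sum_any (\<lambda>l. sym_const (t ^ nat (sum_list l)) * jt l * jt (shifted_neg l c @ \<mu>)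
      when l \<in> partitions_upto r)"
proof -
  \<comment> \<open>The box is imposed on \<nu> + \<delta>, where permutations act, and not on
    \<nu>. Hence \<open>K\<close> also contains tuples with negative entries, killed by a factor
    \<open>h_k = 0\<close>, and tuples with entries at least \<open>N\<close>, killed by the
    determinant factor.\<close>
  define K where "K = {\<nu>. length \<nu> = r \<and> distinct (add_delta \<nu>) \<and>
    set (add_delta \<nu>) \<subseteq> {0..<int (N + r)}}"
  define Q where "Q = {l \<in> partitions_upto r. set (add_delta l) \<subseteq> {0..<int (N + r)}}"
  define S where "S = {\<sigma>. \<sigma> permutes {..<r}}"
  define B where "B = {ks. set ks \<subseteq> {0..<int N} \<and> length ks = r}"
  define w where "w = (\<lambda>\<nu>. sym_const (t ^ nat (sum_list \<nu>)) * jt (shifted_neg \<nu> c @ \<mu>))"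
  define g where "g = (\<lambda>\<nu>. w \<nu> * prod_list (map (hint 1) \<nu>))"
  have finB: "finite B" unfolding B_def by (rule finite_lists_length_eq) simp
  have large: "jt (shifted_neg l c @ \<mu>) = (0 :: 'a sym)" if "length l = r" "j < r" "l ! j \<ge> int N" for l j
    by (rule jt_eq_0_neg[of j]) (use that assms in \<open>auto simp: nth_append nth_shifted_neg\<close>)
  have range: "set \<nu> \<subseteq> {- int r..<int (N + r)}" if "length \<nu> = r" "set (add_delta \<nu>) \<subseteq> {0..<int (N + r)}" for \<nu>
  proof
    fix x assume "x \<in> set \<nu>"
    then obtain j where j: "j < r" "x = \<nu> ! j"
      unfolding in_set_conv_nth using \<open>length \<nu> = r\<close> by blast
    then have "add_delta \<nu> ! j \<in> {0..<int (N + r)}" using that nth_mem[of j "add_delta \<nu>"] by (simp add: subset_iff)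
    then show "x \<in> {- int r..<int (N + r)}" using j that(1) by (simp add: nth_add_delta)
  qed
  have finK: "finite K"
    by (rule finite_subset[OF _ finite_lists_length_eq[of "{- int r..<int (N + r)}" r]])
       (use range in \<open>auto simp: K_def\<close>)
  have finQ: "finite Q"
    by (rule finite_subset[OF _ finite_lists_length_eq[of "{- int r..<int (N + r)}" r]])
       (use range in \<open>auto simp: Q_def partitions_upto_def\<close>)
  have part_decr: "distinct (add_delta l)" if "is_partition l" for l
  proof -
    have "add_delta l ! i > add_delta l ! j" if "i < j" "j < length l" for i j
    proof -
      have "l ! i \<ge> l ! j"
        using \<open>is_partition l\<close> that by (auto simp: is_partition_def sorted_wrt_iff_nth_less)
      then show ?thesis using that by (simp add: nth_add_delta)
    qed
    then show ?thesis unfolding distinct_conv_nth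
      by (metis length_add_delta less_irrefl linorder_neqE_nat)
  qed
  \<comment> \<open>The inverse map is straightening; injectivity is the uniqueness of the
    straightening permutation.\<close>
  have bij: "bij_betw (\<lambda>(l, \<sigma>). straight_act l \<sigma>) (Q \<times> S) K"
    unfolding bij_betw_def
  proof (intro conjI inj_onI subset_antisym subsetI)
    fix p p' assume pp: "p \<in> Q \<times> S" "p' \<in> Q \<times> S"
      and eq: "(case p of (l, \<sigma>) \<Rightarrow> straight_act l \<sigma>) = (case p' of (l, \<sigma>) \<Rightarrow> straight_act l \<sigma>)"
    obtain l \<sigma> l' \<sigma>' where p: "p = (l, \<sigma>)" "p' = (l', \<sigma>')" by (cases p, cases p') auto
    define \<nu> where "\<nu> = straight_act l \<sigma>"
    have inverse: "straight_act (straight_act l \<sigma>) (Hilbert_Choice.inv \<sigma>) = l \<and> straightens (straight_act l \<sigma>) (Hilbert_Choice.inv \<sigma>)"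
      if "l \<in> Q" "\<sigma> \<in> S" for l \<sigma>
    proof -
      have l: "length l = r" "is_partition l" and \<sigma>: "\<sigma> permutes {..<length l}"
        using that by (auto simp: Q_def S_def partitions_upto_def)
      have 1: "straight_act (straight_act l \<sigma>) (Hilbert_Choice.inv \<sigma>) = l"
        using straight_act_compose[OF \<sigma> permutes_inv[OF \<sigma>]] permutes_inv_o(1)[OF \<sigma>]
        by (simp add: straight_act_id)
      have "distinct (add_delta (straight_act l \<sigma>))"
        unfolding add_delta_straight_act[OF \<sigma>]
        using map_nth_permutes(2)[of \<sigma> "add_delta l"] \<sigma> part_decr[OF l(2)] by simp
      with 1 l \<sigma> show ?thesis by (simp add: straightens_def permutes_inv)
    qed
    have "straightens \<nu> (Hilbert_Choice.inv \<sigma>)" "straightens \<nu> (Hilbert_Choice.inv \<sigma>')"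
      using inverse[of l \<sigma>] inverse[of l' \<sigma>'] pp eq by (auto simp: p \<nu>_def)
    then have "Hilbert_Choice.inv \<sigma> = Hilbert_Choice.inv \<sigma>'" using straightens_unique by blast
    moreover have "\<sigma> permutes {..<r}" "\<sigma>' permutes {..<r}" using pp by (auto simp: p S_def)
    ultimately have "\<sigma> = \<sigma>'" by (metis permutes_inv_inv)
    have "straight_act \<nu> (Hilbert_Choice.inv \<sigma>) = l"
      using inverse[of l \<sigma>] pp by (simp add: p \<nu>_def)
    moreover have "straight_act \<nu> (Hilbert_Choice.inv \<sigma>') = l'"
      using inverse[of l' \<sigma>'] pp eq by (simp add: p \<nu>_def)
    ultimately have "l = l'" unfolding \<open>\<sigma> = \<sigma>'\<close> by simp
    with \<open>\<sigma> = \<sigma>'\<close> show "p = p'" by (simp add: p)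
  next
    fix \<nu> assume "\<nu> \<in> (\<lambda>(l, \<sigma>). straight_act l \<sigma>) ` (Q \<times> S)"
    then obtain l \<sigma> where l: "\<nu> = straight_act l \<sigma>" "l \<in> Q" "\<sigma> permutes {..<length l}"
      by (auto simp: Q_def S_def partitions_upto_def)
    then show "\<nu> \<in> K"
      using map_nth_permutes(1,2)[of \<sigma> "add_delta l"] part_decr[of l]
      by (simp add: K_def Q_def partitions_upto_def add_delta_straight_act)
  next
    fix \<nu> assume \<nu>: "\<nu> \<in> K"
    then obtain \<sigma> where \<sigma>: "\<sigma> permutes {..<length \<nu>}" "sorted_wrt (\<ge>) (straight_act \<nu> \<sigma>)"
      by (auto simp: K_def elim: sorting_straight_act)
    define l where "l = straight_act \<nu> \<sigma>"
    have set_l: "set (add_delta l) = set (add_delta \<nu>)"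
      using map_nth_permutes(1)[of \<sigma> "add_delta \<nu>"] \<sigma>(1) by (simp add: l_def add_delta_straight_act)
    have len: "length l = r" using \<nu> by (simp add: K_def l_def)
    have "0 \<le> l ! j" if "j < r" for j
    proof -
      \<comment> \<open>The last entry of \<delta> is 0, so the smallest entry of \<open>l\<close>
        itself lies in the box.\<close>
      have "l ! (r - 1) \<in> set (add_delta l)"
        using that len nth_mem[of "r - 1" "add_delta l"] by (simp add: nth_add_delta of_nat_diff)
      then have "0 \<le> l ! (r - 1)" using \<nu> set_l by (auto simp: K_def)
      also have "l ! (r - 1) \<le> l ! j"
        using \<sigma>(2) that len by (cases "j = r - 1") (auto simp: sorted_wrt_iff_nth_less l_def[symmetric])
      finally show ?thesis .
    qed
    then have "l \<in> Q"
      using \<sigma>(2) \<nu> len set_l by (auto simp: Q_def K_def partitions_upto_def is_partition_def in_set_conv_nth l_def[symmetric])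
    moreover have "straight_act l (Hilbert_Choice.inv \<sigma>) = \<nu>"
      using straight_act_compose[OF \<sigma>(1) permutes_inv[OF \<sigma>(1)]] permutes_inv_o(1)[OF \<sigma>(1)]
      by (simp add: straight_act_id l_def)
    moreover have "Hilbert_Choice.inv \<sigma> \<in> S" using permutes_inv[OF \<sigma>(1)] \<nu> by (simp add: S_def K_def)
    ultimately show "\<nu> \<in> (\<lambda>(l, \<sigma>). straight_act l \<sigma>) ` (Q \<times> S)" by force
  qed
  have "hsum N t (\<lambda>\<nu>. jt (\<nu> @ \<mu>)) (staircase (c + 2 * int r) r) = sum g B"
    unfolding hsum_lists B_def length_staircase
  proof (intro sum.cong refl)
    fix ks assume "ks \<in> {ks. set ks \<subseteq> {0..<int N} \<and> length ks = r}"
    then have "length ks = r" by simp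
    then show "sym_const (t ^ nat (sum_list ks)) * prod_list (map (hint 1) ks) *
        jt (map2 (\<lambda>a k. - a - k) (staircase (c + 2 * int r) r) ks @ \<mu>) = g ks"
      by (subst map2_staircase) (simp_all only: g_def w_def mult_ac)
  qed
  also have "\<dots> = sum g (B \<inter> K)"
  proof (rule sum.mono_neutral_right[OF finB]; (intro ballI Int_lower1)?)
    fix \<nu> assume "\<nu> \<in> B - B \<inter> K"
    then have \<nu>: "\<nu> \<in> B" "\<nu> \<notin> K" by auto
    have "add_delta \<nu> ! j \<in> {0..<int (N + r)}" if "j < r" for j
    proof -
      have "\<nu> ! j \<in> {0..<int N}" using that \<nu>(1) nth_mem[of j \<nu>] unfolding B_def by blast
      then show ?thesis using that \<nu>(1) by (simp add: nth_add_delta B_def)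
    qed
    then have "set (add_delta \<nu>) \<subseteq> {0..<int (N + r)}"
      using \<nu>(1) by (auto simp: in_set_conv_nth B_def)
    then have "\<not> distinct (add_delta \<nu>)" using \<nu> by (auto simp: K_def B_def)
    then obtain i j where ij: "i < r" "j < r" "i \<noteq> j" "add_delta \<nu> ! i = add_delta \<nu> ! j"
      using \<nu>(1) by (auto simp: distinct_conv_nth B_def)
    then have "jt (shifted_neg \<nu> c @ \<mu>) = (0 :: 'a sym)"
      using \<nu>(1) by (intro jt_eq_0_repeat[of i _ j]) (auto simp: nth_append nth_shifted_neg nth_add_delta B_def)
    then show "g \<nu> = 0" by (simp add: g_def w_def)
  qed
  also have "\<dots> = sum g K"
  proof (rule sum.mono_neutral_left[OF finK]; (intro ballI Int_lower2)?)
    fix \<nu> assume "\<nu> \<in> K - B \<inter> K"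
    then have \<nu>: "\<nu> \<in> K" "\<nu> \<notin> B" by auto
    then have len: "length \<nu> = r" and "\<not> set \<nu> \<subseteq> {0..<int N}" by (auto simp: K_def B_def)
    then obtain x where x: "x \<in> set \<nu>" "x \<notin> {0..<int N}" by blast
    then obtain j where j: "j < r" "\<nu> ! j \<notin> {0..<int N}"
      using len unfolding in_set_conv_nth by blast
    show "g \<nu> = 0"
    proof (cases "\<nu> ! j < 0")
      case True
      then have "hint 1 (\<nu> ! j) = (0 :: 'a sym)" by simp
      then have "(0 :: 'a sym) \<in> set (map (hint 1) \<nu>)"
        using j(1) \<nu>(1) by (force simp: K_def in_set_conv_nth)
      then show ?thesis by (simp add: g_def prod_list_zero_iff del: set_map)
    next
      case False
      then show ?thesis using large[of \<nu> j] j \<nu>(1) by (simp add: g_def w_def K_def)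
    qed
  qed
  also have "\<dots> = (\<Sum>(l, \<sigma>)\<in>Q \<times> S. g (straight_act l \<sigma>))"
    using sum.reindex_bij_betw[OF bij, of g] by (simp add: case_prod_unfold)
  also have "\<dots> = (\<Sum>l\<in>Q. \<Sum>\<sigma>\<in>S. g (straight_act l \<sigma>))"
    by (simp add: sum.cartesian_product)
  also have "\<dots> = (\<Sum>l\<in>Q. w l * jt l)"
  proof (rule sum.cong)
    fix l assume "l \<in> Q"
    then have len: "length l = r" by (simp add: Q_def partitions_upto_def)
    have "(\<Sum>\<sigma>\<in>S. g (straight_act l \<sigma>)) =
        (\<Sum>\<sigma>\<in>S. w l * (of_int (sign \<sigma>) * prod_list (map (hint 1) (straight_act l \<sigma>))))"
      by (rule sum.cong)
         (auto simp: S_def g_def w_def len sum_list_straight_act jt_shifted_neg_straight_act mult_ac)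
    also have "\<dots> = w l * jt l"
      by (simp add: jt_eq_sum_straight_act len S_def sum_distrib_left)
    finally show "(\<Sum>\<sigma>\<in>S. g (straight_act l \<sigma>)) = w l * jt l" .
  qed simp
  also have "\<dots> = (\<Sum>l\<in>Q. sym_const (t ^ nat (sum_list l)) * jt l * jt (shifted_neg l c @ \<mu>)
      when l \<in> partitions_upto r)"
    by (rule sum.cong) (auto simp: w_def Q_def mult_ac)
  also have "\<dots> = Sum_any (\<lambda>l. sym_const (t ^ nat (sum_list l)) * jt l * jt (shifted_neg l c @ \<mu>)
      when l \<in> partitions_upto r)"
  proof (rule Sum_any.expand_superset[symmetric, OF finQ], safe)
    fix l assume nz: "(sym_const (t ^ nat (sum_list l)) * jt l * jt (shifted_neg l c @ \<mu>)
      when l \<in> partitions_upto r) \<noteq> (0 :: 'a sym)"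
    then have l: "l \<in> partitions_upto r" "length l = r" "jt (shifted_neg l c @ \<mu>) \<noteq> (0 :: 'a sym)"
      by (auto simp: partitions_upto_def)
    have "add_delta l ! j \<in> {0..<int (N + r)}" if "j < r" for j
    proof -
      have "l ! j \<ge> 0" using l that by (auto simp: partitions_upto_def is_partition_def)
      moreover have "l ! j < int N" using large[of l j] l that by force
      ultimately show ?thesis using that l by (simp add: nth_add_delta)
    qed
    then show "l \<in> Q" using l by (auto simp: Q_def in_set_conv_nth)
  qed
  finally show ?thesis .
qed

lemma vertex_iter_jt_partitions:
  "vertex_iter 1 (hh 1 t) c r (jt \<mu>) = sym_const (\<Prod>k<r. \<Sum>i\<le>k. t ^ i) *
    Sum_any (\<lambda>l. sym_const (t ^ nat (sum_list l)) * jt l * jt (shifted_neg l c @ \<mu>)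
      when l \<in> partitions_upto r)"
proof -
  define N where "N = nat (int r + int (length \<mu>) - c + 1)"
  have "int r + int (length \<mu>) - c < int N" by (simp add: N_def)
  then show ?thesis
    using vertex_iter_jt[of r \<mu> c N r t] hsum_jt_eq_sum_partitions[of r \<mu> c N t] by simp
qed

subsection \<open>Conjugation\<close>

definition psign :: "int \<Rightarrow> 'a::comm_ring_1" where
  "psign k = (if even k then 1 else - 1)"

lemma psign_add: "psign (a + b) = psign a * psign b"
  by (auto simp: psign_def)

lemma psign_uminus [simp]: "psign (- a) = psign a"
  by (simp add: psign_def)

lemma psign_0 [simp]: "psign 0 = 1"
  by (simp add: psign_def)

lemma psign_of_nat: "psign (int n) = (- 1) ^ n"
  by (auto simp: psign_def)

lemma psign_square [simp]: "psign a * (psign a * x) = x"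
  by (simp add: psign_def)

lemma sym_const_psign: "sym_const (psign k) = psign k"
  by (simp add: psign_def sym_const_uminus)

lemma omega_psign [simp]: "omega (psign k * f) = psign k * omega f"
  by (simp add: psign_def omega.lift.hom_uminus)

lemma vertex_psign: "vertex \<epsilon> w n (psign k * f) = psign k * vertex \<epsilon> w n f"
  using vertex_const[of \<epsilon> w n "psign k" f] by (simp only: sym_const_psign)

text \<open>Since \<omega> multiplies the j-th power sum by \<open>(-1)^(j-1)\<close>, the
  translation by \<open>- u^j\<close> becomes the one by \<open>+ (- u)^j\<close>: \<epsilon>
  changes sign and \<open>z\<close> is replaced by \<open>- z\<close>.\<close>

lemma omega_vertex:
  assumes w: "\<And>k. omega (w k) = psign k * w' k"
  shows "omega (vertex 1 w n f) = psign n * vertex (- 1) w' n (omega f)"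
proof (induction f arbitrary: n rule: sym_const_mult_psum_induct)
  case one
  then show ?case by (simp add: w)
next
  case (psum j f)
  then obtain i where j: "j = Suc i" by (cases j) auto
  have p: "omega (psum j) = psign (int i) * psum j"
    by (simp add: j omega_psum psign_of_nat)
  have s: "psign (n + int j) = - (psign n * psign (int i) :: 'a sym)"
    by (simp add: j psign_def)
  show ?case
    using psum.hyps
    by (simp add: vertex_psum omega.lift.hom_minus omega.lift_mult p psum.IH s
        sym_const_uminus mult.assoc vertex_psign distrib_left mult.left_commute[of _ "psign n"])
next
  case (add f g)
  then show ?case by (simp add: vertex_add omega.lift_add distrib_left)
next
  case (scale c f)
  then show ?case by (simp add: vertex_const omega.lift_mult omega.lift_const mult.left_commute)
qed

lemma omega_hint: "omega (hint \<epsilon> k) = psign k * hint (- \<epsilon>) k"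
proof (cases "k < 0")
  case False
  then obtain n where "k = int n" by (metis nonneg_int_cases not_less)
  then show ?thesis by (simp add: omega_hgen psign_of_nat)
qed (simp add: omega.lift_0)

lemma omega_hh: "omega (hh \<epsilon> t k) = psign k * hh (- \<epsilon>) t k"
proof -
  obtain N where N: "k < int N" by (metis less_le_trans lessI linorder_not_less of_nat_less_iff zle_iff_zadd
        int_ops(2) nat_le_iff reals_Archimedean2 zless_iff_Suc_zadd nat_less_iff zero_le)
  have "omega (hh \<epsilon> t k) = (\<Sum>i<N. psign k * (sym_const (t ^ i) * hgen (- \<epsilon>) i * hint (- \<epsilon>) (k - int i)))"
    unfolding hh_eq[OF N] omega.lift.hom_sum
  proof (rule sum.cong)
    fix i
    have "psign k = (psign (int i) * psign (k - int i) :: 'a sym)"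
      by (simp flip: psign_add)
    then show "omega (sym_const (t ^ i) * hgen \<epsilon> i * hint \<epsilon> (k - int i)) =
        psign k * (sym_const (t ^ i) * hgen (- \<epsilon>) i * hint (- \<epsilon>) (k - int i))"
      by (simp add: omega.lift_mult omega.lift_const omega_hint omega_hgen psign_of_nat mult_ac)
  qed simp
  then show ?thesis by (simp add: hh_eq[OF N] sum_distrib_left)
qed

text \<open>All indices \<open>c + 2k\<close> have the parity of \<open>c\<close>, so each of the
  \<open>r\<close> factors contributes the same sign.\<close>

lemma omega_vertex_iter:
  "vertex_iter (- 1) (hh (- 1) t) c r (omega f) =
     psign (int r * c) * omega (vertex_iter 1 (hh 1 t) c r f)"
proof (induction r)
  case (Suc r)
  let ?v = "vertex_iter 1 (hh 1 t) c r f" and ?n = "- (c + 2 * int r)"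
  have "omega (vertex 1 (hh 1 t) ?n ?v) = psign ?n * vertex (- 1) (hh (- 1) t) ?n (omega ?v)"
    by (rule omega_vertex) (rule omega_hh)
  then have "vertex (- 1) (hh (- 1) t) ?n (omega ?v) = psign ?n * omega (vertex 1 (hh 1 t) ?n ?v)"
    by simp
  moreover have "psign ?n = (psign c :: 'a sym)" by (simp add: psign_def)
  ultimately show ?case
    by (simp add: Suc vertex_psign distrib_left distrib_right psign_add mult_ac)
qed simp

section \<open>Rows, columns and the Clifford relation\<close>

text \<open>For opposite signs the translation multiplies the generating series by the inverse of
  \<open>1 - u z\<close>, so \<open>hint (- \<epsilon>) b\<close> acquires the whole tail of terms
  \<open>u^(b-m) hint (- \<epsilon>) m\<close>.\<close>

lemma vertex_hint_neg:
  assumes "\<epsilon> * \<epsilon> = 1"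
  shows "vertex \<epsilon> w a (hint (- \<epsilon>) b) = (\<Sum>m\<in>{0..b}. w (a + b - m) * hint (- \<epsilon>) m)"
proof (cases "b < 0")
  case False
  have rec: "vertex \<epsilon> w a (hint (- \<epsilon>) b) = w a * hint (- \<epsilon>) b + vertex \<epsilon> w (a + 1) (hint (- \<epsilon>) (b - 1))"
    for a b
    unfolding vertex_def translate_hint_neg[OF assms, of b] pair_add pair_monom_mult by (simp add: add_ac)
  have "vertex \<epsilon> w a (hint (- \<epsilon>) (int n)) = (\<Sum>m\<in>{0..int n}. w (a + int n - m) * hint (- \<epsilon>) m)" for n a
  proof (induction n arbitrary: a)
    case 0
    then show ?case by (simp add: rec[of a 0])
  next
    case (Suc n)
    have "{0..int (Suc n)} = insert (int (Suc n)) {0..int n}" by auto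
    then show ?case using Suc[of "a + 1"] by (subst rec) (simp add: add_ac)
  qed
  from this[of a "nat b"] False show ?thesis by simp
qed simp

lemma hint_convolution:
  assumes "T > 0"
  shows "(\<Sum>m\<in>{0..T}. hint 1 (T - m) * hint (- 1) m) = 0"
proof -
  have "(\<Sum>m\<in>{0..T}. hint 1 (T - m) * hint (- 1) m) = (\<Sum>i=0..nat T. hgen 1 i * hgen (- 1) (nat T - i))"
    by (rule sum.reindex_bij_witness[of _ "\<lambda>i. T - int i" "\<lambda>m. nat (T - m)"])
       (use assms in \<open>auto simp: hint_def nat_diff_distrib\<close>)
  also have "\<dots> = fps_nth (hser 1 * hser (- 1)) (nat T)"
    by (simp add: fps_mult_nth)
  also have "\<dots> = 0" unfolding hser_inverse using assms by simp
  finally show ?thesis .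
qed

text \<open>
  The Clifford relation between the vertex operators that add rows and columns.  The left-hand side
  commutes with power sums up to raising \<open>a\<close> or \<open>b\<close>, so it suffices to apply it to \<open>1\<close>.
\<close>

lemma vertex_row_column:
  assumes "a + b > 0"
  shows "vertex 1 (hint 1) a (vertex (- 1) (hint (- 1)) b f) +
    vertex (- 1) (hint (- 1)) (b + 1) (vertex 1 (hint 1) (a - 1) f) = 0"
  using assms
proof (induction f arbitrary: a b rule: sym_const_mult_psum_induct)
  case one
  \<comment> \<open>With \<open>T = a + b\<close>, the two summands are the parts
    \<open>m \<le> b\<close> and \<open>m > b\<close> of the convolution in
    \<open>hint_convolution\<close>, which is zero for \<open>T > 0\<close>. The bound
    \<open>M\<close> only pads the ranges with zero terms.\<close>
  define M where "M = \<bar>a\<bar> + \<bar>b\<bar> + 1"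
  define g where "g = (\<lambda>m. hint 1 (a + b - m) * hint (- 1) m :: 'a sym)"
  have "vertex 1 (hint 1) a (hint (- 1) b) = sum g {0..b}"
    using vertex_hint_neg[of 1 "hint 1" a b] by (simp add: g_def)
  also have "\<dots> = sum g {- M..b}"
    by (rule sum.mono_neutral_left) (auto simp: g_def M_def)
  moreover have "vertex (- 1) (hint (- 1)) (b + 1) (hint 1 (a - 1)) =
      (\<Sum>m\<in>{0..a - 1}. hint (- 1) (a + b - m) * hint 1 m :: 'a sym)"
    using vertex_hint_neg[of "- 1" "hint (- 1)" "b + 1" "a - 1"] by (simp add: add_ac)
  moreover have "\<dots> = sum g {b + 1..a + b}"
    by (rule sum.reindex_bij_witness[of _ "\<lambda>m. a + b - m" "\<lambda>m. a + b - m"]) (auto simp: g_def mult.commute)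
  moreover have "\<dots> = sum g {b + 1..M}"
    by (rule sum.mono_neutral_left) (auto simp: g_def M_def)
  moreover have "{- M..b} \<union> {b + 1..M} = {- M..M}" by (auto simp: M_def)
  then have "sum g {- M..b} + sum g {b + 1..M} = sum g {- M..M}"
    by (subst sum.union_disjoint[symmetric]) auto
  moreover have "\<dots> = sum g {0..a + b}"
    by (rule sum.mono_neutral_right) (auto simp: g_def M_def)
  moreover have "\<dots> = 0"
    using hint_convolution[of "a + b"] one by (simp add: g_def)
  ultimately show ?case by simp
next
  case (psum j f)
  let ?V = "vertex 1 (hint 1)" and ?U = "vertex (- 1) (hint (- 1))"
  have "?V a (?U b (psum j * f)) + ?U (b + 1) (?V (a - 1) (psum j * f)) =
      psum j * (?V a (?U b f) + ?U (b + 1) (?V (a - 1) f)) -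
      (?V (a + int j) (?U b f) + ?U (b + 1) (?V (a + int j - 1) f)) +
      (?V a (?U (b + int j) f) + ?U (b + int j + 1) (?V (a - 1) f))"
  proof -
    have V: "?V a (psum j * g) = psum j * ?V a g - ?V (a + int j) g" for a g
      using psum.hyps by (simp add: vertex_psum)
    have U: "?U b (psum j * g) = psum j * ?U b g + ?U (b + int j) g" for b g
      using psum.hyps by (simp add: vertex_psum sym_const_uminus)
    have "a - 1 + int j = a + int j - 1" "b + 1 + int j = b + int j + 1" by simp_all
    then show ?thesis
      by (simp only: V U vertex_add vertex_diff) (simp only: algebra_simps)
  qed
  then show ?case
    using psum.IH[of a b] psum.IH[of "a + int j" b] psum.IH[of a "b + int j"] psum.prems by simp
next
  case (add f g)
  then show ?case
    using add.IH(1)[of a b] add.IH(2)[of a b] by (simp add: vertex_add algebra_simps add_eq_0_iff)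
next
  case (scale c f)
  have "sym_const c * (vertex 1 (hint 1) a (vertex (- 1) (hint (- 1)) b f) +
    vertex (- 1) (hint (- 1)) (b + 1) (vertex 1 (hint 1) (a - 1) f)) = 0"
    using scale by simp
  then show ?case by (simp only: vertex_const distrib_left)
qed

text \<open>The column operator is moved through the row operators. Each passage lengthens the row
  by one, lowers the index of the column operator by one and costs a sign; what remains is the
  operator of index 0 at \<open>1\<close>. Nonnegative rows keep the index sum in the Clifford
  relation positive.\<close>

lemma vertex_column:
  assumes "\<And>x. x \<in> set \<nu> \<Longrightarrow> x \<ge> 0"
  shows "vertex (- 1) (hint (- 1)) (int (length \<nu>)) (jt \<nu> :: 'k::field_char_0 sym) =
    psign (int (length \<nu>)) * jt (map (\<lambda>x. x + 1) \<nu>)"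
  using assms
proof (induction \<nu>)
  case (Cons a \<nu>)
  let ?V = "vertex 1 (hint 1)" and ?U = "vertex (- 1) (hint (- 1))"
  have "?V (a + 1) (?U (int (length \<nu>)) (jt \<nu> :: 'k sym)) + ?U (int (length \<nu>) + 1) (?V (a + 1 - 1) (jt \<nu>)) = 0"
    by (rule vertex_row_column) (use Cons.prems[of a] in simp)
  then have "?U (int (length (a # \<nu>))) (?V a (jt \<nu>)) = (-  ?V (a + 1) (?U (int (length \<nu>)) (jt \<nu>)) :: 'k sym)"
    by (simp add: add_eq_0_iff add.commute)
  also have "\<dots> = - (psign (int (length \<nu>)) * ?V (a + 1) (jt (map (\<lambda>x. x + 1) \<nu>)))"
    using Cons by (simp add: vertex_psign)
  finally show ?case by (simp add: vertex_hint_jt psign_add) (simp add: psign_def)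
qed simp

lemma jt_append_zeros: "jt (\<nu> @ replicate n 0) = jt \<nu>"
proof (induction \<nu>)
  case Nil
  show ?case
  proof (induction n)
    case (Suc n)
    have "jt (0 # replicate n 0) = vertex 1 (hint 1) 0 (jt (replicate n 0) :: 'a sym)"
      by (rule vertex_hint_jt[symmetric])
    with Suc show ?case by simp
  qed simp
next
  case (Cons a \<nu>)
  then show ?case by (simp flip: vertex_hint_jt)
qed

lemma is_partition_conj_part: "is_partition (conj_part \<nu>)"
proof -
  have "length (filter (\<lambda>x. k \<le> x) \<nu>) \<le> length (filter (\<lambda>x. j \<le> x) \<nu>)" if "j \<le> k" for j k :: int
    using that by (induction \<nu>) auto
  then show ?thesis
    by (auto simp: is_partition_def conj_part_def sorted_wrt_iff_nth_less)
qed

text \<open>Removal of the first column: \<open>n\<close> counts the zero rows, and \<kappa> may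
  still end in zeros. This is the step for inductions on the number of columns.\<close>

lemma partition_decompose:
  assumes "is_partition \<nu>"
  obtains \<kappa> n where "is_partition \<kappa>" "\<nu> = map (\<lambda>x. x + 1) \<kappa> @ replicate n 0"
proof -
  have "\<exists>\<kappa> n. is_partition \<kappa> \<and> \<nu> = map (\<lambda>x. x + 1) \<kappa> @ replicate n 0"
    using assms
  proof (induction \<nu>)
    case Nil
    show ?case by (intro exI[of _ "[]"] exI[of _ 0]) (simp add: is_partition_def)
  next
    case (Cons a \<nu>)
    then obtain \<kappa> n where k: "is_partition \<kappa>" "\<nu> = map (\<lambda>x. x + 1) \<kappa> @ replicate n 0"
      by (auto simp: is_partition_def)
    have a: "a \<ge> 0" "\<And>x. x \<in> set \<nu> \<Longrightarrow> x \<le> a" using Cons.prems by (auto simp: is_partition_def)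
    show ?case
    proof (cases "a = 0")
      case True
      have "\<kappa> = []"
      proof (rule ccontr)
        assume "\<kappa> \<noteq> []"
        then have "hd \<kappa> \<in> set \<kappa>" by simp
        then have "hd \<kappa> + 1 \<le> a" "hd \<kappa> \<ge> 0" using k a(2) by (auto simp: is_partition_def)
        with True show False by simp
      qed
      with True k show ?thesis
        by (intro exI[of _ "[]"] exI[of _ "Suc n"]) (simp add: is_partition_def)
    next
      case False
      then have "is_partition ((a - 1) # \<kappa>)" using k a by (force simp: is_partition_def)
      with k show ?thesis by (intro exI[of _ "(a - 1) # \<kappa>"] exI[of _ n]) simp
    qed
  qed
  with that show ?thesis by blast
qed

lemma conj_part_step:
  assumes "is_partition \<kappa>" "\<kappa> \<noteq> []"
  shows "conj_part (map (\<lambda>x. x + 1) \<kappa> @ replicate n 0) = int (length \<kappa>) # conj_part \<kappa>"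
proof -
  let ?\<nu> = "map (\<lambda>x. x + 1) \<kappa> @ replicate n (0 :: int)"
  have part: "part ?\<nu> 0 = part \<kappa> 0 + 1" using assms(2) by (simp add: part_def nth_append)
  have pos: "x \<ge> 0" if "x \<in> set \<kappa>" for x using assms(1) that by (simp add: is_partition_def)
  have p0: "part \<kappa> 0 \<ge> 0" using assms(2) pos by (simp add: part_def)
  have up: "[1..part \<kappa> 0 + 1] = 1 # map (\<lambda>j. j + 1) [1..part \<kappa> 0]"
  proof -
    have "[2..part \<kappa> 0 + 1] = map (\<lambda>j. j + 1) [1..part \<kappa> 0]"
      by (rule nth_equalityI) auto
    then show ?thesis using p0 by (simp add: upto_rec1)
  qed
  have filt: "length (filter (\<lambda>x. j + 1 \<le> x) ?\<nu>) = length (filter (\<lambda>x. j \<le> x) \<kappa>)" if "j \<ge> 0" for j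
    using that by (simp add: filter_map o_def)
  have all: "filter (\<lambda>x. 0 \<le> x) \<kappa> = \<kappa>" using pos by (simp add: filter_id_conv)
  show ?thesis
    using filt[of 0] all by (simp add: conj_part_def part up filt o_def)
qed

text \<open>Induction on the number of columns: \<omega> carries the operator that adds a column to
  Bernstein's operator, which adds a row of the same length to the conjugate.\<close>

lemma omega_jt:
  assumes "is_partition \<nu>"
  shows "omega (jt \<nu>) = jt (conj_part \<nu>)"
  using assms
proof (induction "nat (part \<nu> 0)" arbitrary: \<nu>)
  case 0
  obtain \<kappa> n where k: "is_partition \<kappa>" "\<nu> = map (\<lambda>x. x + 1) \<kappa> @ replicate n 0"
    using partition_decompose[OF 0(2)] by blast
  have "\<kappa> = []"
    using 0(1) k by (cases \<kappa>) (auto simp: part_def is_partition_def)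
  moreover have "conj_part \<nu> = []" using 0(1) by (simp add: conj_part_def)
  ultimately show ?case
    using jt_append_zeros[of "[]" n, where 'a = 'a] omega.lift.hom_one by (simp add: k)
next
  case (Suc p)
  obtain \<kappa> n where k: "is_partition \<kappa>" "\<nu> = map (\<lambda>x. x + 1) \<kappa> @ replicate n 0"
    using partition_decompose[OF Suc(3)] by blast
  have ne: "\<kappa> \<noteq> []" using Suc(2) k by (auto simp: part_def split: if_splits)
  have "p = nat (part \<kappa> 0)" using Suc(2) k ne by (simp add: part_def nth_append)
  then have IH: "omega (jt \<kappa>) = (jt (conj_part \<kappa>) :: 'a sym)" using Suc(1) k(1) by blast
  let ?l = "int (length \<kappa>)"
  have "jt \<nu> = psign ?l * vertex (- 1) (hint (- 1)) ?l (jt \<kappa> :: 'a sym)"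
    using k by (subst vertex_column) (auto simp: jt_append_zeros is_partition_def)
  also have "\<dots> = psign ?l * vertex (- 1) (hint (- 1)) ?l (omega (jt (conj_part \<kappa>)))"
    by (simp flip: IH)
  also have "\<dots> = omega (vertex 1 (hint 1) ?l (jt (conj_part \<kappa>)))"
    by (rule omega_vertex[symmetric]) (rule omega_hint)
  also have "\<dots> = omega (jt (conj_part \<nu>))"
    by (simp add: vertex_hint_jt k conj_part_step[OF k(1) ne])
  finally show ?case by simp
qed

lemma omega_schur: "is_partition \<nu> \<Longrightarrow> omega (schur \<nu>) = schur (conj_part \<nu>)"
  by (simp add: schur_eq_jt is_partition_conj_part omega_jt)

text \<open>As lists the two sides may differ by trailing zeros; applying the involution twice
  avoids comparing them.\<close>

lemma schur_conj_conj: "is_partition \<nu> \<Longrightarrow> schur (conj_part (conj_part \<nu>)) = schur \<nu>"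
  by (simp add: omega_schur[symmetric] is_partition_conj_part)

lemma schur_tuple_conj_eq: "schur_tuple_conj \<nu> = omega (schur_tuple \<nu> :: 'k::field_char_0 sym)"
proof (cases "\<exists>\<sigma>. straightens \<nu> \<sigma>")
  case True
  then obtain \<sigma> where \<sigma>: "straightens \<nu> \<sigma>" by blast
  then have "(THE \<sigma>. straightens \<nu> \<sigma>) = \<sigma>"
    using straightens_unique by blast
  moreover have "is_partition (straight_act \<nu> \<sigma>)" using \<sigma> by (simp add: straightens_def)
  ultimately show ?thesis
    using True by (simp add: schur_tuple_conj_def schur_tuple_def Let_def omega.lift_mult
        omega_schur omega.lift.hom_of_int)
qed (simp add: schur_tuple_conj_def schur_tuple_def omega.lift_0)

subsection \<open>The Fock space\<close>

lemma fscale_single: "fscale c (Poly_Mapping.single m f) = Poly_Mapping.single m (sym_const c * f)"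
  by (simp add: fscale_def mult_single)

lemma fscale_add: "fscale c (v + w) = fscale c v + fscale c w"
  by (simp add: fscale_def distrib_left)

lemma fscale_0 [simp]: "fscale c 0 = 0"
  by (simp add: fscale_def)

lemma fscale_0_left [simp]: "fscale 0 v = 0"
  by (simp add: fscale_def)

lemma fscale_fscale: "fscale a (fscale b v) = fscale (a * b) v"
  by (simp add: fscale_def mult_single sym_const_mult flip: mult.assoc)

lemma fscale_add_left: "fscale (a + b) v = fscale a v + fscale b v"
  by (simp add: fscale_def sym_const_add single_add distrib_right)

lemma fscale_sum: "fscale c (sum g A) = (\<Sum>a\<in>A. fscale c (g a))"
  by (simp add: fscale_def sum_distrib_left)

lemma single_sum_right: "Poly_Mapping.single m (sum g A) = (\<Sum>a\<in>A. Poly_Mapping.single m (g a))"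
  by (induction A rule: infinite_finite_induct) (simp_all add: single_add)

lemma fock_induct [case_names single add]:
  assumes "\<And>m f. P (Poly_Mapping.single m f)" and "\<And>v w. P v \<Longrightarrow> P w \<Longrightarrow> P (v + w)"
  shows "P (v :: 'k::field_char_0 fock)"
proof -
  have "P (\<Sum>m\<in>A. Poly_Mapping.single m (Poly_Mapping.lookup v m))" if "finite A" for A
    using that by (induction A) (use assms assms(1)[of 0 0] in auto)
  from this[OF finite_keys[of v]] show ?thesis by (simp add: sum_monomials)
qed

definition fock_linear :: "('k::field_char_0 fock \<Rightarrow> 'k fock) \<Rightarrow> bool" where
  "fock_linear T \<longleftrightarrow> (\<forall>v w. T (v + w) = T v + T w) \<and> (\<forall>c v. T (fscale c v) = fscale c (T v))"

lemma fock_linearD: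
  assumes "fock_linear T"
  shows "T (v + w) = T v + T w" "T (fscale c v) = fscale c (T v)" "T 0 = 0"
    "T (sum g A) = (\<Sum>a\<in>A. T (g a))"
proof -
  show add: "T (v + w) = T v + T w" for v w using assms by (simp add: fock_linear_def)
  show "T (fscale c v) = fscale c (T v)" using assms by (simp add: fock_linear_def)
  show zero: "T 0 = 0" using add[of 0 0] by simp
  show "T (sum g A) = (\<Sum>a\<in>A. T (g a))"
    by (induction A rule: infinite_finite_induct) (simp_all add: add zero)
qed

lemma fock_linear_mult: "fock_linear (\<lambda>v. u * v)"
  by (simp add: fock_linear_def distrib_left fscale_def mult.left_commute)

lemma fock_linear_compose: "fock_linear S \<Longrightarrow> fock_linear T \<Longrightarrow> fock_linear (\<lambda>v. S (T v))"
  by (simp add: fock_linear_def)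

lemma fock_linear_zero: "fock_linear (\<lambda>v. 0)"
  by (simp add: fock_linear_def)

lemma fock_linear_id: "fock_linear (\<lambda>v. v)"
  by (simp add: fock_linear_def)

lemma fock_linear_sum: "(\<And>a. a \<in> A \<Longrightarrow> fock_linear (T a)) \<Longrightarrow> fock_linear (\<lambda>v. \<Sum>a\<in>A. T a v)"
  by (induction A rule: infinite_finite_induct)
     (simp_all add: fock_linear_def fscale_add algebra_simps)

lemma fock_linear_fscale: "fock_linear (fscale c)"
  unfolding fock_linear_def fscale_add fscale_fscale by (simp add: mult.commute)

lemma fock_linear_funpow: "fock_linear T \<Longrightarrow> fock_linear (T ^^ r)"
  by (induction r) (simp_all add: fock_linear_id[folded id_def] o_def fock_linear_compose)

lemma fock_linear_when: "fock_linear T \<Longrightarrow> fock_linear (\<lambda>v. T v when b)"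
  by (cases b) (simp_all add: fock_linear_zero)

text \<open>Since \<open>Sum_any\<close> is 0 on an infinite support, a product of distributions is
  shown to be linear under this condition on the right factor.\<close>

definition locally_finite :: "'k::field_char_0 distr \<Rightarrow> bool" where
  "locally_finite A \<longleftrightarrow> (\<forall>v. finite {k. A k v \<noteq> 0})"

lemma dmul_eq_sum:
  assumes "finite S" "\<And>j. j \<notin> S \<Longrightarrow> A (k - j) (B j v) = 0"
  shows "(A \<star> B) k v = (\<Sum>j\<in>S. A (k - j) (B j v))"
  unfolding dmul_def by (rule Sum_any.expand_superset) (use assms in auto)

lemma dmul_single:
  assumes "\<And>j. j \<noteq> s \<Longrightarrow> A (k - j) (B j v) = 0"
  shows "(A \<star> B) k v = A (k - s) (B s v)"
  using dmul_eq_sum[of "{s}" A k B v] assms by simp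

lemma fock_linear_dmul:
  assumes A: "\<And>k. fock_linear (A k)" and B: "\<And>k. fock_linear (B k)" and fin: "locally_finite B"
  shows "fock_linear ((A \<star> B) k)"
proof -
  note LA = fock_linearD[OF A] and LB = fock_linearD[OF B]
  have eq: "(A \<star> B) k v = (\<Sum>j\<in>S. A (k - j) (B j v))" if "finite S" "{j. B j v \<noteq> 0} \<subseteq> S" for S v
  proof (rule dmul_eq_sum[OF that(1)])
    fix j assume "j \<notin> S"
    then have "B j v = 0" using that(2) by auto
    then show "A (k - j) (B j v) = 0" by (simp add: LA(3))
  qed
  have "(A \<star> B) k (v + w) = (A \<star> B) k v + (A \<star> B) k w" for v w
  proof -
    define S where "S = {j. B j v \<noteq> 0} \<union> {j. B j w \<noteq> 0}"
    have "finite S" using fin by (simp add: S_def locally_finite_def)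
    moreover have "{j. B j (v + w) \<noteq> 0} \<subseteq> S" by (auto simp: S_def LB(1))
    ultimately show ?thesis
      by (simp add: eq[of S] S_def LA(1) LB(1) sum.distrib del: finite_Un)
  qed
  moreover have "(A \<star> B) k (fscale c v) = fscale c ((A \<star> B) k v)" for c v
  proof -
    have "finite {j. B j v \<noteq> 0}" using fin by (simp add: locally_finite_def)
    moreover have "{j. B j (fscale c v) \<noteq> 0} \<subseteq> {j. B j v \<noteq> 0}" by (auto simp: LB(2))
    ultimately show ?thesis
      by (simp add: eq[of "{j. B j v \<noteq> 0}"] LA(2) LB(2) fscale_sum)
  qed
  ultimately show ?thesis by (simp add: fock_linear_def)
qed

subsection \<open>The creation factor\<close>

lemma creation_series_eq:
  "creation_series q c k v = (Poly_Mapping.single 0 (sym_const (c k) * psum (nat k)) * v when k \<ge> 1)"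
proof (cases "k \<ge> 1")
  case True
  then have "heis q (- k) = (*) (psum (nat k))" by (auto simp: heis_def)
  then have "heis_fock q (- k) v = Poly_Mapping.single 0 (psum (nat k)) * v"
    by (simp add: heis_fock_def mult_map_scale_conv_mult)
  then show ?thesis
    by (simp add: creation_series_def fscale_def mult_single flip: mult.assoc)
qed (simp add: creation_series_def)

text \<open>A coefficient of \<open>exp P\<close>. For \<open>P\<close> without constant term the
  powers above \<open>n\<close> do not reach degree \<open>n\<close>, so the finite sum is
  exact.\<close>

definition exp_coeff :: "'k::field_char_0 sym fps \<Rightarrow> nat \<Rightarrow> 'k sym" where
  "exp_coeff P n = (\<Sum>j\<le>n. sym_const (1 / fact j) * fps_nth (P ^ j) n)"

text \<open>With \<open>Q = z P'\<close>, the operator \<open>z d/dz\<close> takes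
  \<open>P^(j+1)/(j+1)!\<close> to \<open>Q P^j/j!\<close>; summing over \<open>j\<close> gives the
  equation.\<close>

lemma log_deriv_exp_coeff:
  fixes P :: "'k::field_char_0 sym fps"
  assumes P0: "fps_nth P 0 = 0"
  shows "log_deriv (fps_X * fps_deriv P) (Abs_fps (exp_coeff P))"
  unfolding log_deriv_nth
proof
  fix n
  define Q where "Q = fps_X * fps_deriv P"
  have Q0: "fps_nth Q 0 = 0" by (simp add: Q_def)
  have low: "fps_nth (P ^ j) k = 0" if "k < j" for j k
    using startsby_zero_power_prefix[OF P0, of j] that by blast
  have pow: "of_nat n * fps_nth (P ^ Suc j) n =
      of_nat (Suc j) * (\<Sum>i=0..n. fps_nth Q i * fps_nth (P ^ j) (n - i))" for j
  proof -
    have nth: "fps_nth (fps_X * fps_deriv G) n = of_nat n * fps_nth G n" for G :: "'k sym fps"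
      by (cases n) auto
    have "fps_X * fps_deriv (P ^ Suc j) = fps_const (of_nat (Suc j)) * (Q * P ^ j)"
      by (simp only: fps_deriv_power Q_def diff_Suc_1 mult_ac)
    from arg_cong[OF this, of "\<lambda>G. fps_nth G n"] show ?thesis
      by (simp only: nth fps_mult_left_const_nth fps_mult_nth[of Q])
  qed
  have inner: "(\<Sum>j<n. sym_const (1 / fact j) * fps_nth (P ^ j) (n - i)) = exp_coeff P (n - i)"
    if "i \<ge> 1" "i \<le> n" for i
    unfolding exp_coeff_def
    by (rule sum.mono_neutral_right) (use that in \<open>auto simp: low\<close>)
  have "of_nat n * exp_coeff P n =
      (\<Sum>j<Suc n. sym_const (1 / fact j) * (of_nat n * fps_nth (P ^ j) n))"
    by (simp add: exp_coeff_def sum_distrib_left mult.left_commute lessThan_Suc_atMost del: sum.lessThan_Suc)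
  also have "\<dots> = (\<Sum>j<n. sym_const (1 / fact (Suc j)) * (of_nat n * fps_nth (P ^ Suc j) n))"
  proof -
    have "sym_const (1 / fact 0) * (of_nat n * fps_nth (P ^ 0) n) = 0"
      by (cases n) simp_all
    then show ?thesis by (simp only: sum.lessThan_Suc_shift add_0)
  qed
  also have "\<dots> = (\<Sum>j<n. sym_const (1 / fact j) * (\<Sum>i=0..n. fps_nth Q i * fps_nth (P ^ j) (n - i)))"
  proof (rule sum.cong)
    fix j
    have "sym_const (1 / fact (Suc j)) * of_nat (Suc j) = (sym_const (1 / fact j) :: 'k sym)"
      unfolding sym_const_of_nat[symmetric] sym_const_mult
      by (rule arg_cong[of _ _ sym_const]) (simp add: field_simps del: of_nat_Suc)
    then show "sym_const (1 / fact (Suc j)) * (of_nat n * fps_nth (P ^ Suc j) n) =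
        sym_const (1 / fact j) * (\<Sum>i=0..n. fps_nth Q i * fps_nth (P ^ j) (n - i))"
      unfolding pow by (simp only: mult.assoc[symmetric])
  qed simp
  also have "\<dots> = (\<Sum>i=0..n. fps_nth Q i * (\<Sum>j<n. sym_const (1 / fact j) * fps_nth (P ^ j) (n - i)))"
    unfolding sum_distrib_left by (subst sum.swap) (simp add: mult_ac)
  also have "\<dots> = (\<Sum>i=0..n. fps_nth Q i * exp_coeff P (n - i))"
  proof (rule sum.cong)
    fix i assume "i \<in> {0..n}"
    then show "fps_nth Q i * (\<Sum>j<n. sym_const (1 / fact j) * fps_nth (P ^ j) (n - i)) =
        fps_nth Q i * exp_coeff P (n - i)"
      using Q0 inner[of i] by (cases "i = 0") auto
  qed simp
  finally show "of_nat n * fps_nth (Abs_fps (exp_coeff P)) n =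
      (\<Sum>i=0..n. fps_nth (fps_X * fps_deriv P) i * fps_nth (Abs_fps (exp_coeff P)) (n - i))"
    by (simp add: Q_def)
qed

text \<open>All coefficients are multiplication operators, so composing distributions amounts to
  multiplying power series.\<close>

lemma dexp_creation:
  fixes c :: "int \<Rightarrow> 'k::field_char_0"
  defines "P \<equiv> Abs_fps (\<lambda>n. if n = 0 then 0 else sym_const (c (int n)) * psum n)"
  shows "dexp (creation_series q c) k v =
    Poly_Mapping.single 0 (if k < 0 then 0 else exp_coeff P (nat k)) * v"
proof -
  have pow: "dpow (creation_series q c) j k v =
      Poly_Mapping.single 0 (if k < 0 then 0 else fps_nth (P ^ j) (nat k)) * v" for j k v
  proof (induction j arbitrary: k)
    case 0
    then show ?case by (auto simp: dconst_def when_def)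
  next
    case (Suc j)
    have "dpow (creation_series q c) (Suc j) k v =
        (\<Sum>l\<in>{0..k}. creation_series q c (k - l) (dpow (creation_series q c) j l v))"
      unfolding dpow.simps
      by (rule dmul_eq_sum) (auto simp: creation_series_eq Suc)
    also have "\<dots> = (\<Sum>l\<in>{0..k}. Poly_Mapping.single 0
        (fps_nth P (nat (k - l)) * fps_nth (P ^ j) (nat l)) * v)"
    proof (rule sum.cong)
      fix l assume l: "l \<in> {0..k}"
      then show "creation_series q c (k - l) (dpow (creation_series q c) j l v) =
          Poly_Mapping.single 0 (fps_nth P (nat (k - l)) * fps_nth (P ^ j) (nat l)) * v"
        by (auto simp: creation_series_eq Suc P_def mult_single simp flip: mult.assoc)
    qed simp
    also have "\<dots> = Poly_Mapping.single 0 (\<Sum>l\<in>{0..k}. fps_nth P (nat (k - l)) * fps_nth (P ^ j) (nat l)) * v"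
      by (simp add: sum_distrib_right single_sum_right)
    also have "(\<Sum>l\<in>{0..k}. fps_nth P (nat (k - l)) * fps_nth (P ^ j) (nat l)) =
        (if k < 0 then 0 else fps_nth (P ^ Suc j) (nat k))"
    proof (cases "k < 0")
      case False
      have "(\<Sum>l\<in>{0..k}. fps_nth P (nat (k - l)) * fps_nth (P ^ j) (nat l)) =
          (\<Sum>i=0..nat k. fps_nth P i * fps_nth (P ^ j) (nat k - i))"
        by (rule sum.reindex_bij_witness[of _ "\<lambda>i. k - int i" "\<lambda>l. nat (k - l)"])
           (use False in \<open>auto simp: nat_diff_distrib\<close>)
      then show ?thesis using False by (simp add: fps_mult_nth)
    qed simp
    finally show ?case .
  qed
  have P0: "fps_nth P 0 = 0" by (simp add: P_def)
  have "dexp (creation_series q c) k v =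
      (\<Sum>j\<le>nat k. fscale (1 / fact j) (dpow (creation_series q c) j k v))"
    unfolding dexp_def
  proof (rule Sum_any.expand_superset)
    show "{j. fscale (1 / fact j) (dpow (creation_series q c) j k v) \<noteq> 0} \<subseteq> {..nat k}"
    proof
      fix j assume "j \<in> {j. fscale (1 / fact j) (dpow (creation_series q c) j k v) \<noteq> 0}"
      then have "(if k < 0 then 0 else fps_nth (P ^ j) (nat k)) \<noteq> 0" by (auto simp: pow)
      then have "\<not> nat k < j"
        using startsby_zero_power_prefix[OF P0, of j] by (auto split: if_splits)
      then show "j \<in> {..nat k}" by simp
    qed
  qed simp
  also have "\<dots> = Poly_Mapping.single 0 (if k < 0 then 0 else exp_coeff P (nat k)) * v"
  proof (cases "k < 0")
    case False
    have "fscale a (Poly_Mapping.single 0 f * v) = Poly_Mapping.single 0 (sym_const a * f) * v" for a f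
      by (simp only: fscale_def mult.assoc[symmetric] mult_single add_0)
    with False show ?thesis
      by (simp add: pow exp_coeff_def single_sum_right sum_distrib_right del: dpow.simps)
  qed (simp add: pow del: dpow.simps)
  finally show ?thesis .
qed

text \<open>Both sides have the logarithmic derivative with coefficients
  \<open>\<epsilon> (1 + t^n) \<gamma>^n p_n\<close>: the summands \<open>1\<close> and
  \<open>t^n\<close> produce the two factors \<open>H\<close>, and \<gamma> rescales
  \<open>z\<close>.\<close>

lemma exp_coeff_eq_hh:
  fixes c :: "int \<Rightarrow> 'k::field_char_0"
  assumes c: "\<And>n. n \<ge> 1 \<Longrightarrow> of_nat n * c (int n) = \<epsilon> * (1 + t ^ n) * \<gamma> ^ n"
  shows "exp_coeff (Abs_fps (\<lambda>n. if n = 0 then 0 else sym_const (c (int n)) * psum n)) n =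
    sym_const (\<gamma> ^ n) * hh \<epsilon> t (int n)"
proof -
  define P where "P = Abs_fps (\<lambda>n. if n = 0 then 0 else sym_const (c (int n)) * psum n)"
  define L :: "'k sym fps" where "L = fps_const (sym_const \<epsilon>) * psum_ser"
  define G where "G = fps_dilate (sym_const \<gamma>) (fps_dilate (sym_const t) (hser \<epsilon>) * hser \<epsilon>)"
  have G: "log_deriv (fps_dilate (sym_const \<gamma>) (fps_dilate (sym_const t) L + L)) G"
    unfolding G_def L_def by (intro log_deriv_dilate log_deriv_mult log_deriv_hser)
  have "fps_X * fps_deriv P = fps_dilate (sym_const \<gamma>) (fps_dilate (sym_const t) L + L)"
  proof (rule fps_ext)
    fix n
    show "fps_nth (fps_X * fps_deriv P) n =
        fps_nth (fps_dilate (sym_const \<gamma>) (fps_dilate (sym_const t) L + L)) n"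
    proof (cases "n = 0")
      case False
      have "fps_nth (fps_X * fps_deriv P) n = sym_const (of_nat n * c (int n)) * psum n"
        using False by (cases n) (simp_all add: P_def sym_const_mult[symmetric] sym_const_of_nat
          del: of_nat_Suc)
      also have "\<dots> = fps_nth (fps_dilate (sym_const \<gamma>) (fps_dilate (sym_const t) L + L)) n"
        using False by (simp add: c L_def psum_ser_def algebra_simps sym_const_add
          sym_const_power sym_const_mult[symmetric])
      finally show ?thesis .
    qed (simp add: L_def psum_ser_def)
  qed
  moreover have "log_deriv (fps_X * fps_deriv P) (Abs_fps (exp_coeff P))"
    by (rule log_deriv_exp_coeff) (simp add: P_def)
  ultimately have "Abs_fps (exp_coeff P) = G"
    by (intro log_deriv_unique[OF _ _ G]) (simp_all add: L_def psum_ser_def G_def exp_coeff_def)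
  then have "exp_coeff P n = fps_nth G n" by (metis Abs_fps_inverse UNIV_I fps_nth_Abs_fps)
  also have "\<dots> = sym_const (\<gamma> ^ n) * hh \<epsilon> t (int n)"
    by (simp add: G_def hh_def fps_mult_nth sym_const_power atLeast0AtMost)
  finally show ?thesis by (simp add: P_def)
qed

subsection \<open>The annihilation factor\<close>

lemma heis_add: "heis q n (f + g) = heis q n f + heis q n g"
  by (simp add: heis_def distrib_left pd_add)

lemma heis_0 [simp]: "heis q n 0 = 0"
  by (simp add: heis_def)

lemma heis_const: "heis q n (sym_const c * f) = sym_const c * heis q n f"
  by (simp add: heis_def pd_sym_const mult.left_commute)

lemma lookup_heis_fock: "Poly_Mapping.lookup (heis_fock q n v) m = heis q n (Poly_Mapping.lookup v m)"
  by (simp add: heis_fock_def map.rep_eq when_def)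

lemma lookup_fscale: "Poly_Mapping.lookup (fscale c v) m = sym_const c * Poly_Mapping.lookup v m"
proof -
  have "fscale c v = Poly_Mapping.map ((*) (sym_const c)) v"
    by (simp add: fscale_def mult_map_scale_conv_mult)
  then show ?thesis by (simp add: map.rep_eq when_def)
qed

lemma heis_fock_single: "heis_fock q n (Poly_Mapping.single m f) = Poly_Mapping.single m (heis q n f)"
  by (rule poly_mapping_eqI) (simp add: lookup_heis_fock lookup_single when_def)

lemma fock_linear_heis_fock: "fock_linear (heis_fock q n)"
  unfolding fock_linear_def
  by (intro conjI allI poly_mapping_eqI)
     (simp_all add: lookup_heis_fock lookup_add lookup_fscale heis_add heis_const)

lemma heis_fock_0 [simp]: "heis_fock q n 0 = 0"
  by (rule fock_linearD(3)[OF fock_linear_heis_fock])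

lemma dpow_annihilation_Suc:
  "dpow (annihilation_series q c) (Suc j) k v =
     (\<Sum>l\<in>{k<..0}. annihilation_series q c (k - l) (dpow (annihilation_series q c) j l v))"
  and dpow_annihilation_0: "k > 0 \<Longrightarrow> dpow (annihilation_series q c) j k v = 0"
proof -
  \<comment> \<open>The finite range in the recursion rests on the vanishing for positive
    \<open>k\<close>, so both are carried through one induction.\<close>
  have "(\<forall>k>0. dpow (annihilation_series q c) j k v = 0) \<and>
    (\<forall>k. dpow (annihilation_series q c) (Suc j) k v =
       (\<Sum>l\<in>{k<..0}. annihilation_series q c (k - l) (dpow (annihilation_series q c) j l v)))" for j
  proof (induction j)
    case 0
    have 1: "\<forall>k>0. dpow (annihilation_series q c) 0 k v = 0" by (simp add: dconst_def)
    have "dpow (annihilation_series q c) (Suc 0) k v =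
       (\<Sum>l\<in>{k<..0}. annihilation_series q c (k - l) (dpow (annihilation_series q c) 0 l v))" for k
      unfolding dpow.simps(2)
      by (rule dmul_eq_sum) (use 1 in \<open>auto simp: annihilation_series_def not_le\<close>)
    with 1 show ?case by simp
  next
    case (Suc j)
    then have 1: "\<forall>k>0. dpow (annihilation_series q c) (Suc j) k v = 0" by simp
    have "dpow (annihilation_series q c) (Suc (Suc j)) k v =
       (\<Sum>l\<in>{k<..0}. annihilation_series q c (k - l) (dpow (annihilation_series q c) (Suc j) l v))" for k
      unfolding dpow.simps(2)[of _ "Suc j"]
      by (rule dmul_eq_sum) (use 1 in \<open>auto simp: annihilation_series_def not_le simp del: dpow.simps\<close>)
    with 1 show ?case by simp
  qed
  then show "dpow (annihilation_series q c) (Suc j) k v =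
     (\<Sum>l\<in>{k<..0}. annihilation_series q c (k - l) (dpow (annihilation_series q c) j l v))"
    and "k > 0 \<Longrightarrow> dpow (annihilation_series q c) j k v = 0"
    by blast+
qed

lemma dpow_annihilation_low: "- k < int j \<Longrightarrow> dpow (annihilation_series q c) j k v = 0"
proof (induction j arbitrary: k)
  case (Suc j)
  have "annihilation_series q c (k - l) (dpow (annihilation_series q c) j l v) = 0" if "l \<in> {k<..0}" for l
  proof -
    have "dpow (annihilation_series q c) j l v = 0" using that Suc by simp
    then show ?thesis
      by (simp add: annihilation_series_def)
  qed
  then show ?case by (simp add: dpow_annihilation_Suc del: dpow.simps)
qed (simp add: dconst_def)

lemma dexp_annihilation_sum:
  "dexp (annihilation_series q c) k v =
    (\<Sum>j\<le>nat (- k). fscale (1 / fact j) (dpow (annihilation_series q c) j k v))"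
  unfolding dexp_def
proof (rule Sum_any.expand_superset)
  show "{j. fscale (1 / fact j) (dpow (annihilation_series q c) j k v) \<noteq> 0} \<subseteq> {..nat (- k)}"
  proof
    fix j assume "j \<in> {j. fscale (1 / fact j) (dpow (annihilation_series q c) j k v) \<noteq> 0}"
    then have "\<not> - k < int j" using dpow_annihilation_low[of k j q c v] by auto
    then show "j \<in> {..nat (- k)}" by simp
  qed
qed simp

lemma fock_linear_dexp_annihilation: "fock_linear (dexp (annihilation_series q c) k)"
proof -
  have ann: "fock_linear (annihilation_series q c k)" for k
    unfolding annihilation_series_def
    by (rule fock_linear_when) (rule fock_linear_compose[OF fock_linear_fscale fock_linear_heis_fock])
  have "fock_linear (\<lambda>v. dpow (annihilation_series q c) j k v)" for j k
  proof (induction j arbitrary: k)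
    case 0
    show ?case by (simp add: dconst_def fock_linear_when fock_linear_id)
  next
    case (Suc j)
    show ?case
      unfolding dpow_annihilation_Suc by (rule fock_linear_sum) (rule fock_linear_compose[OF ann Suc])
  qed
  then show ?thesis
    unfolding dexp_annihilation_sum[abs_def]
    by (intro fock_linear_sum) (rule fock_linear_compose[OF fock_linear_fscale])
qed

text \<open>\<open>pd_pow \<eta> j n\<close> is the coefficient of \<open>u\<^sup>n\<close> in \<open>(\<Sum>\<^sub>i \<eta>\<^sub>i u\<^sup>i \<partial>/\<partial>p\<^sub>i)\<^sup>j\<close>.\<close>

fun pd_pow :: "(nat \<Rightarrow> 'k::field_char_0) \<Rightarrow> nat \<Rightarrow> nat \<Rightarrow> 'k sym \<Rightarrow> 'k sym" where
  "pd_pow \<eta> 0 n f = (f when n = 0)"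
| "pd_pow \<eta> (Suc j) n f = (\<Sum>i\<in>{1..n}. sym_const (\<eta> i) * pd (i - 1) (pd_pow \<eta> j (n - i) f))"

lemma pd_pow_add: "pd_pow \<eta> j n (f + g) = pd_pow \<eta> j n f + pd_pow \<eta> j n g"
  by (induction j arbitrary: n) (simp_all add: when_add_distrib pd_add distrib_left sum.distrib)

lemma pd_pow_const: "pd_pow \<eta> j n (sym_const c * f) = sym_const c * pd_pow \<eta> j n f"
  by (induction j arbitrary: n)
     (simp_all add: when_mult mult_when pd_sym_const sum_distrib_left mult.left_commute)

lemma pd_pow_low: "n < j \<Longrightarrow> pd_pow \<eta> j n f = 0"
  by (induction j arbitrary: n) (auto intro!: sum.neutral)

lemma pd_pow_one: "pd_pow \<eta> j n 1 = (1 when j = 0 \<and> n = 0)"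
proof (induction j arbitrary: n)
  case (Suc j)
  have "pd k (1 when b) = (0 :: 'a sym)" for k b
    using pd_single[of k 0 "1 :: 'a"] by (cases b) (simp_all add: single_one[symmetric] del: single_one)
  then show ?case by (simp add: Suc)
qed simp

text \<open>For the derivation \<open>D\<close> with terms
  \<open>\<eta>_i u^i \<partial>/\<partial>p_i\<close>, the commutator with \<open>p_n\<close> is
  the scalar \<open>\<eta>_n u^n\<close>. Hence
  \<open>D^(j+1) p_n = p_n D^(j+1) + (j+1) \<eta>_n u^n D^j\<close>.\<close>

lemma pd_pow_psum:
  assumes "p \<ge> 1"
  shows "pd_pow \<eta> (Suc j) n (psum p * f) = psum p * pd_pow \<eta> (Suc j) n f +
    (of_nat (Suc j) * (sym_const (\<eta> p) * pd_pow \<eta> j (n - p) f) when p \<le> n)"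
proof (induction j arbitrary: n)
  case 0
  have "pd (i - 1) (psum p * f when n - i = 0) = psum p * pd (i - 1) (f when n - i = 0) +
      (f when n - i = 0 \<and> i = p)" if "i \<in> {1..n}" for i
    using that assms by (cases "n = i") (auto simp: pd_psum_mult when_def)
  then have "pd_pow \<eta> (Suc 0) n (psum p * f) = (\<Sum>i\<in>{1..n}. sym_const (\<eta> i) *
      (psum p * pd (i - 1) (f when n - i = 0) + (f when n - i = 0 \<and> i = p)))"
    by simp
  also have "\<dots> = psum p * pd_pow \<eta> (Suc 0) n f +
      (\<Sum>i\<in>{1..n}. if i = p then sym_const (\<eta> p) * (f when n - p = 0) else 0)"
  proof -
    have "(\<Sum>i\<in>{1..n}. sym_const (\<eta> i) * (f when n - i = 0 \<and> i = p)) =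
        (\<Sum>i\<in>{1..n}. if i = p then sym_const (\<eta> p) * (f when n - p = 0) else 0)"
      by (rule sum.cong) auto
    then show ?thesis
      by (simp only: distrib_left sum.distrib sum_distrib_left pd_pow.simps mult.left_commute[of "psum p"])
  qed
  finally show ?case using assms by (auto simp: when_def)
next
  case (Suc j)
  let ?g = "\<lambda>i. pd_pow \<eta> (Suc j) (n - i) f"
  let ?h = "\<lambda>i. of_nat (Suc j) * (sym_const (\<eta> p) * pd_pow \<eta> j (n - i - p) f) when p \<le> n - i"
  have pd_h: "pd k (of_nat c * (sym_const a * g)) = of_nat c * (sym_const a * pd k g)" for k c a g
    by (simp add: pd_sym_const flip: sym_const_of_nat)
  have "pd_pow \<eta> (Suc (Suc j)) n (psum p * f) =
      (\<Sum>i\<in>{1..n}. sym_const (\<eta> i) * pd (i - 1) (psum p * ?g i + ?h i))"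
    unfolding pd_pow.simps(2)[of _ "Suc j"] Suc ..
  also have "\<dots> = (\<Sum>i\<in>{1..n}. psum p * (sym_const (\<eta> i) * pd (i - 1) (?g i))) +
      (\<Sum>i\<in>{1..n}. if i = p then sym_const (\<eta> p) * ?g p else 0) +
      (\<Sum>i\<in>{1..n}. sym_const (\<eta> i) * pd (i - 1) (?h i))"
    unfolding sum.distrib[symmetric]
  proof (rule sum.cong)
    fix i assume "i \<in> {1..n}"
    then have "i - 1 = p - 1 \<longleftrightarrow> i = p" using assms by auto
    then show "sym_const (\<eta> i) * pd (i - 1) (psum p * ?g i + ?h i) =
        psum p * (sym_const (\<eta> i) * pd (i - 1) (?g i)) + (if i = p then sym_const (\<eta> p) * ?g p else 0) +
        sym_const (\<eta> i) * pd (i - 1) (?h i)"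
      using assms by (auto simp: pd_add pd_psum_mult distrib_left mult.left_commute simp del: pd_pow.simps)
  qed simp
  also have "(\<Sum>i\<in>{1..n}. psum p * (sym_const (\<eta> i) * pd (i - 1) (?g i))) = psum p * pd_pow \<eta> (Suc (Suc j)) n f"
    unfolding pd_pow.simps(2)[of _ "Suc j"] sum_distrib_left ..
  also have "(\<Sum>i\<in>{1..n}. if i = p then sym_const (\<eta> p) * ?g p else 0) = (sym_const (\<eta> p) * ?g p when p \<le> n)"
    using assms by (simp add: when_def)
  also have "(\<Sum>i\<in>{1..n}. sym_const (\<eta> i) * pd (i - 1) (?h i)) =
      (of_nat (Suc j) * (sym_const (\<eta> p) * pd_pow \<eta> (Suc j) (n - p) f) when p \<le> n)"
  proof (cases "p \<le> n")
    case True
    have "(\<Sum>i\<in>{1..n}. sym_const (\<eta> i) * pd (i - 1) (?h i)) =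
        (\<Sum>i\<in>{1..n - p}. sym_const (\<eta> i) * pd (i - 1) (?h i))"
      by (rule sum.mono_neutral_right) (use True in auto)
    also have "\<dots> = (\<Sum>i\<in>{1..n - p}. of_nat (Suc j) * (sym_const (\<eta> p) *
        (sym_const (\<eta> i) * pd (i - 1) (pd_pow \<eta> j (n - p - i) f))))"
    proof (rule sum.cong)
      fix i assume i: "i \<in> {1..n - p}"
      then have "n - i - p = n - p - i" "p \<le> n - i" by auto
      then show "sym_const (\<eta> i) * pd (i - 1) (?h i) = of_nat (Suc j) * (sym_const (\<eta> p) *
          (sym_const (\<eta> i) * pd (i - 1) (pd_pow \<eta> j (n - p - i) f)))"
        by (simp only: when_simps pd_h mult.left_commute[of "sym_const (\<eta> i)"])
    qed simp
    finally show ?thesis using True by (simp add: sum_distrib_left del: of_nat_Suc)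
  qed (auto simp: when_def intro!: sum.neutral)
  finally show ?case
    by (cases "p \<le> n") (simp_all add: algebra_simps del: pd_pow.simps)
qed

text \<open>Taylor's formula: the exponential of a constant vector field is a translation. Both
  sides agree at \<open>1\<close> and obey the same rule under multiplication by a power sum; the
  factorials absorb the \<open>j + 1\<close> of \<open>pd_pow_psum\<close>.\<close>

lemma sum_pd_pow_eq_translate:
  fixes f :: "'k::field_char_0 sym"
  assumes \<eta>: "\<And>n. n \<ge> 1 \<Longrightarrow> \<eta> n = - \<epsilon> * g ^ n"
  shows "(\<Sum>j\<le>n. sym_const (1 / fact j) * pd_pow \<eta> j n f) = sym_const (g ^ n) * coeff (translate \<epsilon> f) n"
proof (induction f arbitrary: n rule: sym_const_mult_psum_induct)
  case one
  have "(\<Sum>j\<le>n. sym_const (1 / fact j) * pd_pow \<eta> j n 1) = (\<Sum>j\<le>n. if j = 0 then (1 :: 'k sym) when n = 0 else 0)"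
    by (rule sum.cong) (auto simp: pd_pow_one when_def)
  then show ?case by (simp add: when_def)
next
  case (psum p f)
  define D where "D = (\<lambda>n. \<Sum>j\<le>n. sym_const (1 / fact j) * pd_pow \<eta> j n f)"
  have "(\<Sum>j\<le>n. sym_const (1 / fact j) * pd_pow \<eta> j n (psum p * f)) =
      (\<Sum>j\<le>n. psum p * (sym_const (1 / fact j) * pd_pow \<eta> j n f)) +
      (\<Sum>j<n. sym_const (\<eta> p) * (sym_const (1 / fact j) * pd_pow \<eta> j (n - p) f) when p \<le> n)"
  proof -
    have s: "sym_const (1 / fact (Suc j)) * of_nat (Suc j) = (sym_const (1 / fact j) :: 'k sym)" for j
      unfolding sym_const_of_nat[symmetric] sym_const_mult
      by (rule arg_cong[of _ _ sym_const]) (simp add: field_simps del: of_nat_Suc)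
    have "sym_const (1 / fact (Suc j)) * pd_pow \<eta> (Suc j) n (psum p * f) =
        psum p * (sym_const (1 / fact (Suc j)) * pd_pow \<eta> (Suc j) n f) +
        (sym_const (\<eta> p) * (sym_const (1 / fact j) * pd_pow \<eta> j (n - p) f) when p \<le> n)" for j
      unfolding pd_pow_psum[OF psum.hyps] s[of j, symmetric]
      by (cases "p \<le> n") (simp_all add: algebra_simps del: pd_pow.simps of_nat_Suc fact_Suc)
    then show ?thesis
      unfolding lessThan_Suc_atMost[symmetric] sum.lessThan_Suc_shift
      by (simp add: sum.distrib algebra_simps when_def del: pd_pow.simps(2) fact_Suc)
  qed
  also have "(\<Sum>j\<le>n. psum p * (sym_const (1 / fact j) * pd_pow \<eta> j n f)) = psum p * D n"
    by (simp add: D_def sum_distrib_left)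
  also have "(\<Sum>j<n. sym_const (\<eta> p) * (sym_const (1 / fact j) * pd_pow \<eta> j (n - p) f) when p \<le> n) =
      (sym_const (\<eta> p) * D (n - p) when p \<le> n)"
  proof (cases "p \<le> n")
    case True
    have "(\<Sum>j<n. sym_const (1 / fact j) * pd_pow \<eta> j (n - p) f) = D (n - p)"
      unfolding D_def
      by (rule sum.mono_neutral_right) (use True psum.hyps in \<open>auto simp: pd_pow_low\<close>)
    then show ?thesis using True by (simp add: sum_distrib_left[symmetric])
  qed simp
  also have "psum p * D n + (sym_const (\<eta> p) * D (n - p) when p \<le> n) =
      sym_const (g ^ n) * coeff (translate \<epsilon> (psum p * f)) n"
  proof -
    have D: "D k = sym_const (g ^ k) * coeff (translate \<epsilon> f) k" for k
      using psum.IH by (simp add: D_def)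
    have key: "sym_const (\<eta> p) * (sym_const (g ^ (n - p)) * x) = - (sym_const (g ^ n) * (sym_const \<epsilon> * x))"
      if "p \<le> n" for x
    proof -
      have "g ^ p * g ^ (n - p) = g ^ n" using that by (simp flip: power_add)
      then have *: "\<eta> p * g ^ (n - p) = - (g ^ n * \<epsilon>)"
        using psum.hyps by (simp add: \<eta> mult.commute[of \<epsilon>] mult.assoc)
      have "sym_const (\<eta> p) * (sym_const (g ^ (n - p)) * x) = sym_const (\<eta> p * g ^ (n - p)) * x"
        by (simp only: mult.assoc[symmetric] sym_const_mult)
      also have "\<dots> = - (sym_const (g ^ n) * (sym_const \<epsilon> * x))"
        unfolding * by (simp only: sym_const_uminus sym_const_mult[symmetric] mult_minus_left mult.assoc)
      finally show ?thesis .
    qed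
    have "coeff (translate \<epsilon> (psum p * f)) n = psum p * coeff (translate \<epsilon> f) n -
        sym_const \<epsilon> * (if p \<le> n then coeff (translate \<epsilon> f) (n - p) else 0)"
      using psum.hyps by (simp add: translate_psum_mult coeff_monom_mult)
    then show ?thesis
      by (cases "p \<le> n") (simp_all add: D key right_diff_distrib mult.left_commute[of "psum p"])
  qed
  finally show ?case .
next
  case (add f g)
  then show ?case by (simp add: pd_pow_add translate.lift_add distrib_left sum.distrib)
next
  case (scale c f)
  have "(\<Sum>j\<le>n. sym_const (1 / fact j) * pd_pow \<eta> j n (sym_const c * f)) =
      sym_const c * (\<Sum>j\<le>n. sym_const (1 / fact j) * pd_pow \<eta> j n f)"
    by (simp add: pd_pow_const sum_distrib_left mult.left_commute)
  then show ?case
    by (simp add: scale translate.lift_mult translate.lift_const mult.left_commute)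
qed

text \<open>The hypothesis combines \<open>b\<close> with the constant
  \<open>n / (1 + q^(2n))\<close> by which the Heisenberg operator differs from a partial
  derivative.\<close>

lemma dexp_annihilation_single:
  assumes b: "\<And>n. n \<ge> 1 \<Longrightarrow> b (int n) * (of_nat n / (1 + q powi (2 * int n))) = - \<epsilon> * g ^ n"
  shows "dexp (annihilation_series q b) k (Poly_Mapping.single m f) =
    (Poly_Mapping.single m (sym_const (g ^ nat (- k)) * coeff (translate \<epsilon> f) (nat (- k))) when k \<le> 0)"
proof -
  define \<eta> where "\<eta> = (\<lambda>n. b (int n) * (of_nat n / (1 + q powi (2 * int n))))"
  have ann: "annihilation_series q b (- int n) (Poly_Mapping.single m f) =
      Poly_Mapping.single m (sym_const (\<eta> n) * pd (n - 1) f)" if "n \<ge> 1" for n f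
    using that by (simp add: annihilation_series_def heis_fock_single fscale_single heis_def
        \<eta>_def sym_const_mult flip: mult.assoc)
  have pow: "dpow (annihilation_series q b) j (- int n) (Poly_Mapping.single m f) =
      Poly_Mapping.single m (pd_pow \<eta> j n f)" for j n
  proof (induction j arbitrary: n)
    case 0
    then show ?case by (simp add: dconst_def when_def)
  next
    case (Suc j)
    have "dpow (annihilation_series q b) (Suc j) (- int n) (Poly_Mapping.single m f) =
       (\<Sum>i\<in>{1..n}. annihilation_series q b (- int i)
          (dpow (annihilation_series q b) j (- int (n - i)) (Poly_Mapping.single m f)))"
      unfolding dpow_annihilation_Suc
      by (rule sum.reindex_bij_witness[of _ "\<lambda>i. - int (n - i)" "\<lambda>l. n - nat (- l)"])
         (auto simp: of_nat_diff nat_le_iff)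
    also have "\<dots> = (\<Sum>i\<in>{1..n}. Poly_Mapping.single m
        (sym_const (\<eta> i) * pd (i - 1) (pd_pow \<eta> j (n - i) f)))"
      by (rule sum.cong) (simp_all only: Suc ann atLeastAtMost_iff)
    finally show ?case by (simp add: single_sum_right del: dpow.simps)
  qed
  show ?thesis
  proof (cases "k \<le> 0")
    case True
    then obtain n where k: "k = - int n" by (metis nonpos_int_cases)
    have "dexp (annihilation_series q b) k (Poly_Mapping.single m f) =
        Poly_Mapping.single m (\<Sum>j\<le>n. sym_const (1 / fact j) * pd_pow \<eta> j n f)"
      unfolding dexp_annihilation_sum k by (simp add: pow fscale_single single_sum_right)
    also have "(\<Sum>j\<le>n. sym_const (1 / fact j) * pd_pow \<eta> j n f) =
        sym_const (g ^ n) * coeff (translate \<epsilon> f) n"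
      by (rule sum_pd_pow_eq_translate) (use b in \<open>simp add: \<eta>_def\<close>)
    finally show ?thesis by (simp add: k)
  next
    case False
    then show ?thesis by (simp add: dexp_annihilation_sum dpow_annihilation_0 del: dpow.simps)
  qed
qed

subsection \<open>The currents on the Fock space\<close>

lemma lookup_z_del:
  "Poly_Mapping.lookup (z_del i s k v) m = (Poly_Mapping.lookup v m when s * (2 * m + i) = k)"
proof -
  have "Poly_Mapping.lookup (z_del i s k v) m =
      (\<Sum>x\<in>Poly_Mapping.keys v. if x = m then (Poly_Mapping.lookup v m when s * (2 * m + i) = k) else 0)"
    unfolding z_del_def lookup_sum by (rule sum.cong) (auto simp: when_def lookup_single)
  then show ?thesis by (auto simp: when_def in_keys_iff)
qed

lemma z_del_single:
  "z_del i s k (Poly_Mapping.single m f) = (Poly_Mapping.single m f when s * (2 * m + i) = k)"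
  by (rule poly_mapping_eqI) (auto simp: lookup_z_del lookup_single when_def)

lemma fock_linear_z_del: "fock_linear (z_del i s k)"
  unfolding fock_linear_def
  by (intro conjI allI poly_mapping_eqI)
     (simp_all add: lookup_z_del lookup_add lookup_fscale when_add_distrib mult_when)

lemma locally_finite_z_del: "locally_finite (z_del i s)"
  unfolding locally_finite_def
proof
  fix v :: "'a fock"
  have "{k. z_del i s k v \<noteq> 0} \<subseteq> (\<lambda>m. s * (2 * m + i)) ` Poly_Mapping.keys v"
  proof
    fix k assume "k \<in> {k. z_del i s k v \<noteq> 0}"
    then obtain m where "Poly_Mapping.lookup (z_del i s k v) m \<noteq> 0"
      using poly_mapping_eqI[of "z_del i s k v" 0] by auto
    then show "k \<in> (\<lambda>m. s * (2 * m + i)) ` Poly_Mapping.keys v"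
      by (auto simp: lookup_z_del in_keys_iff when_def split: if_splits)
  qed
  then show "finite {k. z_del i s k v \<noteq> 0}" by (rule finite_subset) simp
qed

lemma exp_alpha_single: "exp_alpha s (Poly_Mapping.single m f) = Poly_Mapping.single (m + s) f"
  by (simp add: exp_alpha_def mult_single add.commute)

lemma fock_linear_exp_alpha: "fock_linear (exp_alpha s)"
  unfolding exp_alpha_def[abs_def] by (rule fock_linear_mult)

lemma dconst_dmul:
  assumes "T 0 = 0"
  shows "(dconst T \<star> B) k v = T (B k v)"
  using dmul_single[of k "dconst T" k B v] assms by (simp add: dconst_def)

definition lower_part :: "'k::field_char_0 \<Rightarrow> int \<Rightarrow> int \<Rightarrow> (int \<Rightarrow> 'k) \<Rightarrow> 'k distr" where
  "lower_part q i s b = dexp (annihilation_series q b) \<star> dconst (exp_alpha s) \<star> z_del i s"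

lemma shift_part: "(dconst (exp_alpha s) \<star> z_del i s) k v = exp_alpha s (z_del i s k v)"
  by (rule dconst_dmul) (rule fock_linearD(3)[OF fock_linear_exp_alpha])

lemma fock_linear_shift_part: "fock_linear ((dconst (exp_alpha s) \<star> z_del i s) k)"
  unfolding shift_part[abs_def]
  by (rule fock_linear_compose[OF fock_linear_exp_alpha fock_linear_z_del])

lemma fock_linear_lower_part: "fock_linear (lower_part q i s b k)"
  unfolding lower_part_def
proof (rule fock_linear_dmul)
  have "{k. (dconst (exp_alpha s) \<star> z_del i s) k v \<noteq> 0} \<subseteq> {k. z_del i s k v \<noteq> 0}" for v :: "'a fock"
    using fock_linearD(3)[OF fock_linear_exp_alpha[of s, where 'a = 'a]] by (auto simp: shift_part)
  then show "locally_finite (dconst (exp_alpha s) \<star> z_del i s :: 'a distr)"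
    using locally_finite_z_del finite_subset unfolding locally_finite_def by blast
qed (rule fock_linear_dexp_annihilation fock_linear_shift_part)+

lemma lower_part_single:
  assumes b: "\<And>n. n \<ge> 1 \<Longrightarrow> b (int n) * (of_nat n / (1 + q powi (2 * int n))) = - \<epsilon> * g ^ n"
  shows "lower_part q i s b k (Poly_Mapping.single m f) =
    (Poly_Mapping.single (m + s) (sym_const (g ^ nat (s * (2 * m + i) - k)) *
       coeff (translate \<epsilon> f) (nat (s * (2 * m + i) - k))) when k \<le> s * (2 * m + i))"
proof -
  let ?p = "s * (2 * m + i)"
  have shift: "(dconst (exp_alpha s) \<star> z_del i s) j (Poly_Mapping.single m f) =
      (Poly_Mapping.single (m + s) f when ?p = j)" for j
    using fock_linearD(3)[OF fock_linear_exp_alpha[of s, where 'a = 'a]]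
    by (simp add: shift_part z_del_single exp_alpha_single when_def)
  have "lower_part q i s b k (Poly_Mapping.single m f) =
      dexp (annihilation_series q b) (k - ?p) (Poly_Mapping.single (m + s) f)"
    unfolding lower_part_def
    by (subst dmul_single[of ?p]) (auto simp: shift fock_linearD(3)[OF fock_linear_dexp_annihilation])
  then show ?thesis
    by (simp add: dexp_annihilation_single[OF b] when_def)
qed

text \<open>The common shape of both currents, with \<open>s\<close> the sign in the exponents of
  \<open>e^\<alpha>\<close> and \<open>z^\<partial>\<close>.\<close>

definition vertex_series ::
    "'k::field_char_0 \<Rightarrow> int \<Rightarrow> int \<Rightarrow> (int \<Rightarrow> 'k) \<Rightarrow> (int \<Rightarrow> 'k) \<Rightarrow> 'k distr" where
  "vertex_series q i s c b = dexp (creation_series q c) \<star> lower_part q i s b"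

lemma locally_finite_lower_part:
  assumes b: "\<And>n. n \<ge> 1 \<Longrightarrow> b (int n) * (of_nat n / (1 + q powi (2 * int n))) = - \<epsilon> * g ^ n"
  shows "locally_finite (lower_part q i s b)"
  unfolding locally_finite_def
proof
  fix v
  show "finite {k. lower_part q i s b k v \<noteq> 0}"
  proof (induction v rule: fock_induct)
    case (single m f)
    let ?p = "s * (2 * m + i)"
    have "{k. lower_part q i s b k (Poly_Mapping.single m f) \<noteq> 0} \<subseteq> {?p - int (degree (translate \<epsilon> f))..?p}"
    proof
      fix k assume "k \<in> {k. lower_part q i s b k (Poly_Mapping.single m f) \<noteq> 0}"
      then have "k \<le> ?p" "coeff (translate \<epsilon> f) (nat (?p - k)) \<noteq> 0"
        by (auto simp: lower_part_single[OF b])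
      moreover from this have "nat (?p - k) \<le> degree (translate \<epsilon> f)" by (intro le_degree)
      ultimately show "k \<in> {?p - int (degree (translate \<epsilon> f))..?p}" by auto
    qed
    then show ?case by (rule finite_subset) simp
  next
    case (add v w)
    have "{k. lower_part q i s b k (v + w) \<noteq> 0} \<subseteq>
        {k. lower_part q i s b k v \<noteq> 0} \<union> {k. lower_part q i s b k w \<noteq> 0}"
      by (auto simp: fock_linearD(1)[OF fock_linear_lower_part])
    then show ?case using add by (auto intro: finite_subset)
  qed
qed

lemma fock_linear_vertex_series:
  assumes b: "\<And>n. n \<ge> 1 \<Longrightarrow> b (int n) * (of_nat n / (1 + q powi (2 * int n))) = - \<epsilon> * g ^ n"
  shows "fock_linear (vertex_series q i s c b k)"
  unfolding vertex_series_def
proof (rule fock_linear_dmul)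
  show "fock_linear (dexp (creation_series q c) k)" for k
    unfolding dexp_creation[abs_def] by (rule fock_linear_mult)
qed (rule fock_linear_lower_part locally_finite_lower_part[OF b])+

text \<open>A term that lowers the degree by \<open>l\<close> gets \<open>\<gamma>^l\<close> more
  from the creation part and \<open>\<gamma>^(-l)\<close> from the annihilation part. What remains
  depends only on the total degree: \<open>z\<close> is rescaled to
  \<open>\<gamma> z\<close>.\<close>

lemma vertex_series_single:
  fixes q :: "'k::field_char_0"
  assumes c: "\<And>n. n \<ge> 1 \<Longrightarrow> of_nat n * c (int n) = \<epsilon> * (1 + t ^ n) * \<gamma> ^ n"
    and b: "\<And>n. n \<ge> 1 \<Longrightarrow> b (int n) * (of_nat n / (1 + q powi (2 * int n))) = - \<epsilon> * inverse \<gamma> ^ n"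
    and \<gamma>: "\<gamma> \<noteq> 0"
  shows "vertex_series q i s c b k (Poly_Mapping.single m f) =
    Poly_Mapping.single (m + s) (sym_const (\<gamma> powi (k - s * (2 * m + i))) *
      vertex \<epsilon> (hh \<epsilon> t) (k - s * (2 * m + i)) f)"
proof -
  define p where "p = s * (2 * m + i)"
  define N where "N = Suc (degree (translate \<epsilon> f))"
  define F where "F = coeff (translate \<epsilon> f)"
  have zero: "F l = 0" if "l \<ge> N" for l
    using that by (simp add: F_def N_def coeff_eq_0)
  have creation: "dexp (creation_series q c) j v =
      Poly_Mapping.single 0 (sym_const (\<gamma> powi j) * hh \<epsilon> t j) * v" for j v
  proof (cases "j < 0")
    case False
    then obtain n where "j = int n" by (metis nonneg_int_cases not_less)
    then show ?thesis by (simp add: dexp_creation exp_coeff_eq_hh[OF c])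
  qed (simp add: dexp_creation hh_def)
  have lower: "lower_part q i s b j (Poly_Mapping.single m f) =
      (Poly_Mapping.single (m + s) (sym_const (inverse \<gamma> ^ nat (p - j)) * F (nat (p - j))) when j \<le> p)" for j
    by (simp add: lower_part_single[OF b] p_def F_def)
  have inj: "inj_on (\<lambda>l. p - int l) {..<N}" by (simp add: inj_on_def)
  have "vertex_series q i s c b k (Poly_Mapping.single m f) =
      (\<Sum>j\<in>(\<lambda>l. p - int l) ` {..<N}. dexp (creation_series q c) (k - j)
        (lower_part q i s b j (Poly_Mapping.single m f)))"
    unfolding vertex_series_def
  proof (rule dmul_eq_sum)
    fix j assume j: "j \<notin> (\<lambda>l. p - int l) ` {..<N}"
    have "lower_part q i s b j (Poly_Mapping.single m f) = 0"
    proof (cases "j \<le> p")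
      case True
      then have "j = p - int (nat (p - j))" by simp
      then have "nat (p - j) \<notin> {..<N}" using j by (metis image_eqI)
      then have "nat (p - j) \<ge> N" by simp
      then show ?thesis by (simp add: lower zero)
    qed (simp add: lower)
    then show "dexp (creation_series q c) (k - j) (lower_part q i s b j (Poly_Mapping.single m f)) = 0"
      by (simp add: creation)
  qed simp
  also have "\<dots> = (\<Sum>l<N. Poly_Mapping.single (m + s)
      (sym_const (\<gamma> powi (k - p)) * (hh \<epsilon> t (k - p + int l) * F l)))"
    unfolding sum.reindex[OF inj] o_def
  proof (rule sum.cong)
    fix l
    have "\<gamma> powi (k - p + int l) = \<gamma> powi (k - p) * \<gamma> ^ l"
      using \<gamma> by (subst power_int_add) simp_all
    then have "\<gamma> powi (k - p + int l) * inverse \<gamma> ^ l = \<gamma> powi (k - p)"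
      using \<gamma> by (simp add: mult.assoc power_inverse)
    then have e: "sym_const (\<gamma> powi (k - p + int l)) * sym_const (inverse \<gamma> ^ l) = sym_const (\<gamma> powi (k - p))"
      by (simp only: sym_const_mult)
    have arith: "k - (p - int l) = k - p + int l" by simp
    have low: "lower_part q i s b (p - int l) (Poly_Mapping.single m f) =
        Poly_Mapping.single (m + s) (sym_const (inverse \<gamma> ^ l) * F l)"
      by (simp add: lower)
    have swap: "x * h * (y * z) = x * y * (h * z)" for x h y z :: "'k sym"
      by (simp only: mult_ac)
    show "dexp (creation_series q c) (k - (p - int l))
        (lower_part q i s b (p - int l) (Poly_Mapping.single m f)) =
        Poly_Mapping.single (m + s) (sym_const (\<gamma> powi (k - p)) * (hh \<epsilon> t (k - p + int l) * F l))"
      by (simp only: low creation arith mult_single add_0 swap[of _ _ "sym_const (inverse \<gamma> ^ l)"] e)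
  qed simp
  also have "\<dots> = Poly_Mapping.single (m + s) (sym_const (\<gamma> powi (k - p)) * vertex \<epsilon> (hh \<epsilon> t) (k - p) f)"
    unfolding vertex_def
    by (subst pair_superset[of N])
       (simp_all add: zero[unfolded F_def] single_sum_right sum_distrib_left F_def)
  finally show ?thesis by (simp add: p_def)
qed

text \<open>After \<open>j\<close> steps \<open>m\<close> has become \<open>m + s j\<close>, and as
  \<open>s * s = 1\<close> the index is \<open>-(C + 2j)\<close>. Adding up \<open>C + 2j\<close>
  for \<open>j < r\<close> gives the exponent \<open>r C + r (r - 1)\<close>.\<close>

lemma vertex_series_funpow:
  fixes q :: "'k::field_char_0"
  assumes c: "\<And>n. n \<ge> 1 \<Longrightarrow> of_nat n * c (int n) = \<epsilon> * (1 + t ^ n) * \<gamma> ^ n"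
    and b: "\<And>n. n \<ge> 1 \<Longrightarrow> b (int n) * (of_nat n / (1 + q powi (2 * int n))) = - \<epsilon> * inverse \<gamma> ^ n"
    and \<gamma>: "\<gamma> \<noteq> 0" and s: "s * s = 1" and C: "C = n + 1 + s * (2 * m + i)"
  shows "(vertex_series q i s c b (- n - 1) ^^ r) (Poly_Mapping.single m f) =
    Poly_Mapping.single (m + s * int r) (sym_const (\<gamma> powi (- (int r * C + int r * (int r - 1)))) *
      vertex_iter \<epsilon> (hh \<epsilon> t) C r f)"
proof (induction r)
  case (Suc r)
  have step: "vertex_series q i s c b k (Poly_Mapping.single m f) =
      Poly_Mapping.single (m + s) (sym_const (\<gamma> powi (k - s * (2 * m + i))) *
        vertex \<epsilon> (hh \<epsilon> t) (k - s * (2 * m + i)) f)" for k m f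
    by (rule vertex_series_single[OF c b \<gamma>])
  have "s * (2 * (m + s * int r) + i) = s * (2 * m + i) + (s * s) * (2 * int r)"
    by (simp add: algebra_simps)
  then have e: "- n - 1 - s * (2 * (m + s * int r) + i) = - (C + 2 * int r)"
    by (simp add: C s)
  have "\<gamma> powi (- (C + 2 * int r)) * \<gamma> powi (- (int r * C + int r * (int r - 1))) =
      \<gamma> powi (- (int (Suc r) * C + int (Suc r) * (int (Suc r) - 1)))"
    using \<gamma> by (subst power_int_add[symmetric]) (simp_all add: algebra_simps)
  then have pw: "sym_const (\<gamma> powi (- (C + 2 * int r))) *
      (sym_const (\<gamma> powi (- (int r * C + int r * (int r - 1)))) * x) =
      sym_const (\<gamma> powi (- (int (Suc r) * C + int (Suc r) * (int (Suc r) - 1)))) * x" for x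
    by (simp only: mult.assoc[symmetric] sym_const_mult)
  have shift: "m + s * int r + s = m + s * int (Suc r)" by (simp add: algebra_simps)
  show ?case
    unfolding funpow.simps o_apply Suc step e vertex_const pw shift
      vertex_iter.simps ..
qed simp

section \<open>Transcendental parameters are not roots of unity\<close>

lemma not_algebraic_power:
  fixes x :: "'k::field_char_0"
  assumes "\<not> algebraic x" "n > 0"
  shows "x ^ n \<noteq> 1"
proof
  assume "x ^ n = 1"
  define p where "p = monom (1 :: 'k) n - 1"
  have "coeff p n = 1" using assms(2) by (simp add: p_def)
  then have "p \<noteq> 0" by auto
  moreover have "coeff p k \<in> \<int>" for k by (auto simp: p_def)
  moreover have "poly p x = 0" using \<open>x ^ n = 1\<close> by (simp add: p_def poly_monom)
  ultimately have "algebraic x" unfolding algebraic_def by blast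
  with assms show False by simp
qed

lemma not_algebraic_neq_0:
  fixes x :: "'k::field_char_0"
  assumes "\<not> algebraic x" shows "x \<noteq> 0"
proof
  assume "x = 0"
  then have "poly (monom 1 1) x = 0" by (simp add: poly_monom)
  moreover have "coeff (monom 1 1) k \<in> \<int>" for k by (auto simp: coeff_monom)
  ultimately have "algebraic x" unfolding algebraic_def by (intro exI[of _ "monom 1 1"]) simp
  with assms show False by simp
qed

subsection \<open>Quantum factorials\<close>

lemma qint_inverse: "qint (inverse q) n = qint q n"
proof -
  have "qint (inverse q) n = (- (q powi int n - q powi - int n)) / (- (q - q powi - 1))"
    by (simp add: qint_def power_int_minus power_inverse)
  also have "\<dots> = qint q n" unfolding minus_divide_divide by (simp add: qint_def)
  finally show ?thesis .
qed

lemma geometric_sum_eq_qint: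
  assumes "q \<noteq> 0" "q ^ 2 \<noteq> 1"
  shows "(\<Sum>i\<le>k. (q ^ 2) ^ i) = q ^ k * qint q (Suc k)"
proof -
  have "(q ^ 2 - 1) * (\<Sum>i\<le>k. (q ^ 2) ^ i) = (q ^ 2) ^ Suc k - 1"
    using power_diff_1_eq[of "q ^ 2" "Suc k"] by (simp only: lessThan_Suc_atMost)
  moreover have "(q ^ 2 - 1) * (q ^ k * qint q (Suc k)) = (q ^ 2) ^ Suc k - 1"
  proof -
    have nz: "q - inverse q \<noteq> 0"
    proof
      assume "q - inverse q = 0"
      then have "q * q = 1" using assms(1) by (simp add: field_simps)
      then show False using assms(2) by (simp add: power2_eq_square)
    qed
    have "q ^ 2 - 1 = q * (q - inverse q)"
      using assms(1) by (simp add: power2_eq_square right_diff_distrib)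
    then have "(q ^ 2 - 1) * (q ^ k * qint q (Suc k)) =
        q ^ Suc k * ((q - inverse q) * qint q (Suc k))" by simp
    also have "(q - inverse q) * qint q (Suc k) = q ^ Suc k - inverse (q ^ Suc k)"
      using nz by (simp add: qint_def power_int_minus power_int_of_nat del: power_Suc of_nat_Suc)
    also have "q ^ Suc k * (q ^ Suc k - inverse (q ^ Suc k)) = (q ^ 2) ^ Suc k - 1"
      using assms(1) by (simp add: right_diff_distrib power_mult[symmetric] power_add[symmetric] mult_2
          del: power_Suc)
    finally show ?thesis .
  qed
  ultimately show ?thesis using assms(2) by (metis mult_left_cancel right_minus_eq)
qed

lemma prod_geometric_sum_eq_qfact:
  assumes "q \<noteq> 0" "q ^ 2 \<noteq> 1"
  shows "(\<Prod>k<r. \<Sum>i\<le>k. (q ^ 2) ^ i) = q ^ (r choose 2) * qfact q r"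
proof (induction r)
  case (Suc r)
  have "Suc r choose 2 = (r choose 2) + r" by (simp add: numeral_2_eq_2)
  then show ?case
    using Suc by (simp add: geometric_sum_eq_qint[OF assms] qfact_def power_add mult_ac)
qed (simp add: qfact_def numeral_2_eq_2)

lemma qfact_inverse: "qfact (inverse q) r = qfact q r"
  by (simp add: qfact_def qint_inverse)

lemma qfact_neq_0:
  assumes "q \<noteq> 0" "\<forall>n>0. q ^ n \<noteq> 1"
  shows "qfact q r \<noteq> 0"
proof -
  have "qint q k \<noteq> 0" if pos: "k \<ge> 1" for k
  proof
    assume "qint q k = 0"
    obtain j where k: "k = Suc j" using pos by (cases k) auto
    have "(\<Sum>i\<le>j. (q ^ 2) ^ i) = 0"
      using geometric_sum_eq_qint[OF assms(1), of j] assms(2)[rule_format, of 2] \<open>qint q k = 0\<close> by (simp add: k)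
    then have "(q ^ 2) ^ Suc j = 1"
      using power_diff_1_eq[of "q ^ 2" "Suc j"] by (simp add: lessThan_Suc_atMost del: power_Suc)
    then have "q ^ (2 * Suc j) = 1" by (simp only: power_mult)
    then show False using assms(2)[rule_format, of "2 * Suc j"] by simp
  qed
  then show ?thesis by (simp add: qfact_def)
qed

subsection \<open>Action of the divided powers\<close>

definition partition_sum :: "'k::field_char_0 \<Rightarrow> int \<Rightarrow> nat \<Rightarrow> int list \<Rightarrow> 'k sym" where
  "partition_sum q c r \<mu> = Sum_any (\<lambda>l. sym_const (q powi (2 * sum_list l)) * schur l *
     schur_tuple (shifted_neg l c @ \<mu>) when l \<in> partitions_upto r)"

lemma vertex_iter_schur:
  fixes q :: "'k::field_char_0"
  assumes "q \<noteq> 0" "q ^ 2 \<noteq> 1" "is_partition \<mu>"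
  shows "vertex_iter 1 (hh 1 (q ^ 2)) c r (schur \<mu>) =
    sym_const (q ^ (r choose 2) * qfact q r) * partition_sum q c r \<mu>"
proof -
  have "(sym_const ((q ^ 2) ^ nat (sum_list l)) * jt l * jt (shifted_neg l c @ \<mu>) when l \<in> partitions_upto r) =
      (sym_const (q powi (2 * sum_list l)) * schur l * schur_tuple (shifted_neg l c @ \<mu>)
        when l \<in> partitions_upto r)" for l
  proof (cases "l \<in> partitions_upto r")
    case True
    then have l: "is_partition l" by (simp add: partitions_upto_def)
    then have "sum_list l \<ge> 0" by (auto simp: is_partition_def intro!: sum_list_nonneg)
    then have "(q ^ 2) ^ nat (sum_list l) = q powi (2 * sum_list l)"
      by (simp add: power_int_def nat_mult_distrib power_mult)
    then show ?thesis using True by (simp add: schur_tuple_eq_jt schur_eq_jt[OF l])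
  qed simp
  then show ?thesis
    using assms(3) by (simp add: schur_eq_jt vertex_iter_jt_partitions partition_sum_def
        prod_geometric_sum_eq_qfact[OF assms(1,2)])
qed

text \<open>Injectivity of \<omega> makes the supports equal, so both sums range over the same
  set.\<close>

lemma omega_Sum_any: "omega (Sum_any g) = Sum_any (\<lambda>l. omega (g l))"
proof -
  have "omega (g l) \<noteq> 0 \<longleftrightarrow> g l \<noteq> 0" for l
    using omega_omega[of "g l"] by (metis omega.lift_0)
  then show ?thesis
    by (simp add: Sum_any.expand_set omega.lift.hom_sum)
qed

lemma minus_one_powi: "(- 1) powi k = (psign k :: 'a::field)"
  by (auto simp: power_int_def psign_def minus_one_power_iff even_nat_iff)

lemma divided_power_linear:
  "fock_linear T \<Longrightarrow> fock_linear (divided_power q T r)"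
  unfolding divided_power_def[abs_def]
  by (rule fock_linear_compose[OF fock_linear_fscale fock_linear_funpow])

lemma choose_2_int: "int r * (int r - 1) = 2 * int (r choose 2)"
proof (induction r)
  case (Suc r)
  have "Suc r choose 2 = (r choose 2) + r" by (simp add: numeral_2_eq_2)
  with Suc show ?case by (simp add: algebra_simps)
qed simp

context
  fixes q :: "'k::field_char_0" and i :: int
  assumes q0: "q \<noteq> 0" and q1: "\<forall>n>0. q ^ n \<noteq> 1"
begin

lemma one_plus_neq_0: "n \<ge> 1 \<Longrightarrow> 1 + q powi (2 * int n) \<noteq> 0"
proof
  assume n: "n \<ge> 1" and "1 + q powi (2 * int n) = 0"
  then have "q ^ (2 * n) = - 1"
    by (simp add: eq_neg_iff_add_eq_0 add.commute power_int_def nat_mult_distrib)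
  then have "q ^ (4 * n) = 1"
    using power_mult[of q "2 * n" 2] by (simp add: mult.commute)
  with q1[rule_format, of "4 * n"] n show False by simp
qed

abbreviation plus_coeff :: "int \<Rightarrow> 'k" where
  "plus_coeff \<equiv> \<lambda>n. (1 + q powi (2 * n)) * q powi (- n) / of_int n"

abbreviation minus_coeff :: "int \<Rightarrow> 'k" where
  "minus_coeff \<equiv> \<lambda>n. (1 + q powi (2 * n)) / of_int n"

text \<open>Writing \<open>(1 + q^(2n)) q^(-n)\<close> as \<open>(1 + q^(-2n)) q^n\<close> exhibits
  \<open>t = q^(-2)\<close> and \<open>\<gamma> = q\<close>, matching the factor
  \<open>q^(-n)\<close> of the annihilation part.\<close>

lemma plus_creation_coeff:
  "n \<ge> 1 \<Longrightarrow> of_nat n * plus_coeff (int n) = 1 * (1 + (inverse q ^ 2) ^ n) * q ^ n"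
  using q0 by (simp add: power_int_def nat_mult_distrib power_inverse power_mult field_simps power2_eq_square power_mult_distrib)

lemma plus_annihilation_coeff:
  "n \<ge> 1 \<Longrightarrow> - plus_coeff (int n) * (of_nat n / (1 + q powi (2 * int n))) = - 1 * inverse q ^ n"
  using one_plus_neq_0[of n] by (simp add: power_int_minus power_int_of_nat power_inverse)

lemma minus_creation_coeff:
  "n \<ge> 1 \<Longrightarrow> of_nat n * (- minus_coeff (int n)) = - 1 * (1 + (q ^ 2) ^ n) * 1 ^ n"
  by (simp add: power_int_def nat_mult_distrib power_mult)

lemma minus_annihilation_coeff:
  "n \<ge> 1 \<Longrightarrow> minus_coeff (int n) * (of_nat n / (1 + q powi (2 * int n))) = - (- 1) * inverse 1 ^ n"
  using one_plus_neq_0[of n] by simp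

lemma X_plus_eq: "X_plus q i n = vertex_series q i 1 plus_coeff (\<lambda>n. - plus_coeff n) (- n - 1)"
  unfolding X_plus_def X_plus_series_def vertex_series_def lower_part_def ..

lemma X_minus_eq: "X_minus q i n = vertex_series q i (- 1) (\<lambda>n. - minus_coeff n) minus_coeff (- n - 1)"
  unfolding X_minus_def X_minus_series_def vertex_series_def lower_part_def ..

lemma fock_linear_X_plus: "fock_linear (X_plus q i n)"
  unfolding X_plus_eq by (rule fock_linear_vertex_series) (rule plus_annihilation_coeff)

lemma fock_linear_X_minus: "fock_linear (X_minus q i n)"
  unfolding X_minus_eq by (rule fock_linear_vertex_series) (rule minus_annihilation_coeff)

lemma q2: "q ^ 2 \<noteq> 1"
  using q1 by simp

text \<open>Of the exponent \<open>-3 (r choose 2)\<close>, two parts come from the powers of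
  \<open>\<gamma> = q\<close> and one from the product of geometric sums at \<open>1/q\<close>. The
  quantum factorial is invariant under inversion of \<open>q\<close> and cancels.\<close>

lemma divided_power_X_plus:
  assumes \<mu>: "is_partition \<mu>"
  shows "divided_power q (X_plus q i n) r (Poly_Mapping.single m (schur \<mu>)) =
    fscale (q powi (- 3 * int (r choose 2) - int r * (n + 1 + 2 * m + i)))
      (Poly_Mapping.single (m + int r) (partition_sum (inverse q) (n + 1 + 2 * m + i) r \<mu>))"
proof -
  define C where "C = n + 1 + 2 * m + i"
  let ?S = "partition_sum (inverse q) C r \<mu>"
  have inv: "inverse q ^ 2 \<noteq> 1" using q2 by (simp add: power_inverse)
  have "(X_plus q i n ^^ r) (Poly_Mapping.single m (schur \<mu>)) =
      Poly_Mapping.single (m + 1 * int r) (sym_const (q powi (- (int r * C + int r * (int r - 1)))) *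
        vertex_iter 1 (hh 1 (inverse q ^ 2)) C r (schur \<mu>))"
    unfolding X_plus_eq
    by (rule vertex_series_funpow[OF plus_creation_coeff plus_annihilation_coeff q0])
       (simp_all add: C_def)
  also have "\<dots> = Poly_Mapping.single (m + int r) (sym_const (q powi (- (int r * C + 2 * int (r choose 2))) *
      (inverse q ^ (r choose 2) * qfact q r)) * ?S)"
    using q0 by (simp add: vertex_iter_schur[OF _ inv \<mu>] choose_2_int qfact_inverse sym_const_mult[symmetric] mult.assoc)
  finally have "divided_power q (X_plus q i n) r (Poly_Mapping.single m (schur \<mu>)) =
      fscale (1 / qfact q r * (q powi (- (int r * C + 2 * int (r choose 2))) *
      (inverse q ^ (r choose 2) * qfact q r))) (Poly_Mapping.single (m + int r) ?S)"
    by (simp only: divided_power_def fscale_single sym_const_mult[symmetric] mult.assoc)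
  also have "1 / qfact q r * (q powi (- (int r * C + 2 * int (r choose 2))) *
      (inverse q ^ (r choose 2) * qfact q r)) =
      q powi (- (int r * C + 2 * int (r choose 2))) * q powi (- int (r choose 2))"
    using qfact_neq_0[OF q0 q1, of r]
    by (simp add: power_int_minus[of q "int (r choose 2)"] power_int_of_nat power_inverse)
  also have "\<dots> = q powi (- 3 * int (r choose 2) - int r * C)"
    using q0 by (simp flip: power_int_add)
  finally show ?thesis by (simp only: C_def)
qed

text \<open>Here \<open>\<gamma> = 1\<close>, so the power of \<open>q\<close> comes from the
  geometric sums alone. The sign comes from conjugation by \<omega>, as \<open>C\<close> has the
  parity of \<open>n + 1 + i\<close>.\<close>

lemma divided_power_X_minus:
  assumes \<mu>: "is_partition \<mu>"
  shows "divided_power q (X_minus q i n) r (Poly_Mapping.single m (schur (conj_part \<mu>))) =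
    fscale ((- 1) powi (int r * (n + 1 + i)) * q powi (int (r choose 2)))
      (Poly_Mapping.single (m - int r) (omega (partition_sum q (n + 1 - 2 * m - i) r \<mu>)))"
proof -
  define C where "C = n + 1 - 2 * m - i"
  let ?S = "omega (partition_sum q C r \<mu>)"
  have "(X_minus q i n ^^ r) (Poly_Mapping.single m (schur (conj_part \<mu>))) =
      Poly_Mapping.single (m + - 1 * int r) (sym_const (1 powi (- (int r * C + int r * (int r - 1)))) *
        vertex_iter (- 1) (hh (- 1) (q ^ 2)) C r (omega (schur \<mu>)))"
    unfolding X_minus_eq omega_schur[OF \<mu>]
    by (rule vertex_series_funpow[OF minus_creation_coeff minus_annihilation_coeff])
       (simp_all add: C_def)
  also have "\<dots> = Poly_Mapping.single (m - int r)
      (sym_const (psign (int r * C) * (q ^ (r choose 2) * qfact q r)) * ?S)"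
    by (simp add: omega_vertex_iter vertex_iter_schur[OF q0 q2 \<mu>] omega.lift_mult omega.lift_const
        sym_const_mult[symmetric] sym_const_psign mult.assoc)
  finally have "divided_power q (X_minus q i n) r (Poly_Mapping.single m (schur (conj_part \<mu>))) =
      fscale (1 / qfact q r * (psign (int r * C) * (q ^ (r choose 2) * qfact q r)))
        (Poly_Mapping.single (m - int r) ?S)"
    by (simp only: divided_power_def fscale_single sym_const_mult[symmetric] mult.assoc)
  also have "psign (int r * C) = (psign (int r * (n + 1 + i)) :: 'k)"
    by (simp add: psign_def C_def)
  also have "1 / qfact q r * (psign (int r * (n + 1 + i)) * (q ^ (r choose 2) * qfact q r)) =
      (- 1) powi (int r * (n + 1 + i)) * q powi (int (r choose 2))"
    using qfact_neq_0[OF q0 q1, of r] by (simp add: minus_one_powi power_int_of_nat)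
  finally show ?thesis by (simp only: C_def)
qed

end

subsection \<open>The integral lattice\<close>

text \<open>The integral span of the Schur functions, in inductive form so that closure properties
  follow by rule induction.\<close>

inductive_set schur_span :: "'k::field_char_0 sym set" where
  schur: "is_partition xs \<Longrightarrow> schur xs \<in> schur_span"
| zero: "0 \<in> schur_span"
| add: "f \<in> schur_span \<Longrightarrow> g \<in> schur_span \<Longrightarrow> f + g \<in> schur_span"
| uminus: "f \<in> schur_span \<Longrightarrow> - f \<in> schur_span"

lemma schur_span_sum: "(\<And>a. a \<in> A \<Longrightarrow> g a \<in> schur_span) \<Longrightarrow> sum g A \<in> schur_span"
  by (induction A rule: infinite_finite_induct) (auto intro: schur_span.intros)

lemma sign_schur_span: "f \<in> schur_span \<Longrightarrow> of_int (sign \<sigma>) * f \<in> schur_span"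
  by (cases rule: sign_cases[of \<sigma>]) (auto intro: schur_span.uminus)

lemma schur_tuple_in_span: "schur_tuple \<nu> \<in> schur_span"
proof (cases "\<exists>\<sigma>. straightens \<nu> \<sigma>")
  case True
  then obtain \<sigma> where \<sigma>: "straightens \<nu> \<sigma>" by blast
  then have "(THE \<sigma>. straightens \<nu> \<sigma>) = \<sigma>"
    using straightens_unique by blast
  moreover have "is_partition (straight_act \<nu> \<sigma>)" using \<sigma> by (simp add: straightens_def)
  ultimately show ?thesis
    using True by (simp add: schur_tuple_def Let_def sign_schur_span schur_span.schur)
qed (simp add: schur_tuple_def schur_span.zero)

lemma schur_tuple_conj_in_span: "schur_tuple_conj \<nu> \<in> schur_span"
proof (cases "\<exists>\<sigma>. straightens \<nu> \<sigma>")
  case True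
  then show ?thesis
    by (simp add: schur_tuple_conj_def Let_def sign_schur_span schur_span.schur is_partition_conj_part)
qed (simp add: schur_tuple_conj_def schur_span.zero)

lemma jt_in_span: "jt \<nu> \<in> schur_span"
  using schur_tuple_in_span[of \<nu>] by (simp add: schur_tuple_eq_jt)

lemma vertex_hint_span: "f \<in> schur_span \<Longrightarrow> vertex 1 (hint 1) n f \<in> schur_span"
  by (induction rule: schur_span.induct)
     (auto simp: schur_eq_jt vertex_hint_jt jt_in_span vertex_add vertex_uminus
       intro: schur_span.add schur_span.uminus schur_span.zero)

text \<open>An integral Pieri rule without its combinatorics: \<open>vertex_hint\<close> expresses
  \<open>h_k B_n f\<close> by \<open>B_n (h_k f)\<close>, where the tuple is shorter, and
  \<open>h_(k-1) B_(n+1) f\<close>, where \<open>k\<close> is smaller.\<close>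

lemma hint_mult_jt_span: "hint 1 k * jt \<nu> \<in> schur_span"
proof (induction \<nu> arbitrary: k)
  case Nil
  have "hint 1 k = (jt [k] :: 'a sym)" using vertex_hint_jt[of k "[]", where 'a = 'a] by simp
  then show ?case by (simp add: jt_in_span)
next
  case (Cons n \<nu>)
  have "hint 1 (int j) * vertex 1 (hint 1) n (jt \<nu> :: 'a sym) \<in> schur_span" for j
  proof (induction j arbitrary: n)
    case 0
    then show ?case by (simp add: vertex_hint_jt jt_in_span)
  next
    case (Suc j)
    have "hint 1 (int (Suc j)) * vertex 1 (hint 1) n (jt \<nu> :: 'a sym) =
        vertex 1 (hint 1) n (hint 1 (int (Suc j)) * jt \<nu>) +
        hint 1 (int j) * vertex 1 (hint 1) (n + 1) (jt \<nu>)"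
      unfolding vertex_hint[of "hint 1" n "int (Suc j)"] by simp
    moreover have "vertex 1 (hint 1) n (hint 1 (int (Suc j)) * jt \<nu> :: 'a sym) \<in> schur_span"
      by (rule vertex_hint_span) (rule Cons.IH)
    ultimately show ?case using schur_span.add[OF _ Suc[of "n + 1"]] by simp
  qed
  from this[of "nat k"] show ?case
    by (cases "k < 0") (simp_all add: vertex_hint_jt schur_span.zero)
qed

lemma hint_mult_span: "f \<in> schur_span \<Longrightarrow> hint 1 k * f \<in> schur_span"
  by (induction rule: schur_span.induct)
     (auto simp: schur_eq_jt hint_mult_jt_span distrib_left
       intro: schur_span.add schur_span.uminus schur_span.zero)

text \<open>The Leibniz expansion of the Jacobi-Trudi determinant makes one factor an integer
  polynomial in the \<open>h_k\<close>, which reduces the claim to multiplication by a single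
  \<open>h_k\<close>.\<close>

lemma schur_span_mult:
  assumes "f \<in> schur_span" "g \<in> schur_span"
  shows "f * g \<in> schur_span"
  using assms
proof (induction rule: schur_span.induct)
  case (schur xs)
  have h: "prod_list (map (hint 1) ks) * g \<in> schur_span" for ks
    by (induction ks) (simp_all add: schur mult.assoc hint_mult_span)
  have "schur xs * g = (\<Sum>\<sigma> | \<sigma> permutes {..<length xs}.
      of_int (sign \<sigma>) * (prod_list (map (hint 1) (straight_act xs \<sigma>)) * g))"
    using schur by (simp add: schur_eq_jt jt_eq_sum_straight_act sum_distrib_right mult.assoc)
  then show ?case by (simp add: schur_span_sum sign_schur_span h)
next
  case (add f f')
  then show ?case by (simp add: distrib_right schur_span.add)
qed (auto intro: schur_span.zero schur_span.uminus)

section \<open>Laurent coefficients and closure of the lattice\<close>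

lemma laurent_int_add:
  assumes "a \<in> laurent_int q" "b \<in> laurent_int q" shows "a + b \<in> laurent_int q"
proof -
  obtain c K where a: "a = (\<Sum>k\<in>K. of_int (c k) * q powi k)" "finite K"
    using assms(1) by (auto simp: laurent_int_def)
  obtain d J where b: "b = (\<Sum>k\<in>J. of_int (d k) * q powi k)" "finite J"
    using assms(2) by (auto simp: laurent_int_def)
  have "a = (\<Sum>k\<in>K \<union> J. of_int (c k when k \<in> K) * q powi k)"
    unfolding a(1) by (rule sum.mono_neutral_cong_left) (use a b in auto)
  moreover have "b = (\<Sum>k\<in>K \<union> J. of_int (d k when k \<in> J) * q powi k)"
    unfolding b(1) by (rule sum.mono_neutral_cong_left) (use a b in auto)
  ultimately have "a + b = (\<Sum>k\<in>K \<union> J. of_int ((c k when k \<in> K) + (d k when k \<in> J)) * q powi k)"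
    by (simp add: sum.distrib distrib_right)
  then show ?thesis using a(2) b(2) unfolding laurent_int_def
    by (intro CollectI exI[of _ "\<lambda>k. (c k when k \<in> K) + (d k when k \<in> J)"] exI[of _ "K \<union> J"]) simp
qed

lemma laurent_int_mult_powi:
  assumes "a \<in> laurent_int q" "q \<noteq> 0" shows "q powi e * a \<in> laurent_int q"
proof -
  obtain c K where a: "a = (\<Sum>k\<in>K. of_int (c k) * q powi k)" "finite K"
    using assms(1) by (auto simp: laurent_int_def)
  have "q powi e * a = (\<Sum>k\<in>K. of_int (c k) * q powi (k + e))"
    using assms(2) by (simp add: a(1) sum_distrib_left power_int_add mult_ac)
  also have "\<dots> = (\<Sum>k\<in>(\<lambda>k. k + e) ` K. of_int (c (k - e)) * q powi k)"
    by (subst sum.reindex) (auto simp: inj_on_def)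
  finally show ?thesis using a(2) unfolding laurent_int_def
    by (intro CollectI exI[of _ "\<lambda>k. c (k - e)"] exI[of _ "(\<lambda>k. k + e) ` K"]) simp
qed

lemma laurent_int_uminus: "a \<in> laurent_int q \<Longrightarrow> - a \<in> laurent_int q"
proof -
  assume "a \<in> laurent_int q"
  then obtain c K where a: "a = (\<Sum>k\<in>K. of_int (c k) * q powi k)" "finite K"
    by (auto simp: laurent_int_def)
  then have "- a = (\<Sum>k\<in>K. of_int (- c k) * q powi k)" by (simp add: sum_negf)
  then show ?thesis using a(2) unfolding laurent_int_def
    by (intro CollectI exI[of _ "\<lambda>k. - c k"] exI[of _ K]) simp
qed

lemma laurent_int_psign: "a \<in> laurent_int q \<Longrightarrow> psign k * a \<in> laurent_int q"
  by (simp add: psign_def laurent_int_uminus)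

lemma fock_lattice_0: "0 \<in> fock_lattice q"
  unfolding fock_lattice_def by (auto intro!: exI[of _ "{}"])

lemma fock_lattice_add:
  assumes "v \<in> fock_lattice q" "w \<in> fock_lattice q" shows "v + w \<in> fock_lattice q"
proof -
  let ?e = "\<lambda>(xs, m). Poly_Mapping.single m (schur xs)"
  obtain B c where v: "v = (\<Sum>b\<in>B. fscale (c b) (?e b))" "finite B"
      "B \<subseteq> {xs. is_partition xs} \<times> UNIV" "\<forall>b\<in>B. c b \<in> laurent_int q"
    using assms(1) by (auto simp: fock_lattice_def case_prod_unfold)
  obtain B' c' where w: "w = (\<Sum>b\<in>B'. fscale (c' b) (?e b))" "finite B'"
      "B' \<subseteq> {xs. is_partition xs} \<times> UNIV" "\<forall>b\<in>B'. c' b \<in> laurent_int q"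
    using assms(2) by (auto simp: fock_lattice_def case_prod_unfold)
  define d where "d = (\<lambda>b. (c b when b \<in> B) + (c' b when b \<in> B'))"
  have "v = (\<Sum>b\<in>B \<union> B'. fscale (c b when b \<in> B) (?e b))"
    unfolding v(1) by (rule sum.mono_neutral_cong_left) (use v w in auto)
  moreover have "w = (\<Sum>b\<in>B \<union> B'. fscale (c' b when b \<in> B') (?e b))"
    unfolding w(1) by (rule sum.mono_neutral_cong_left) (use v w in auto)
  ultimately have "v + w = (\<Sum>b\<in>B \<union> B'. fscale (d b) (?e b))"
    by (simp add: d_def fscale_add_left sum.distrib)
  then have "v + w = (\<Sum>(xs, m)\<in>B \<union> B'. fscale (d (xs, m)) (Poly_Mapping.single m (schur xs)))"
    by (simp add: case_prod_unfold)
  moreover have "\<forall>b\<in>B \<union> B'. d b \<in> laurent_int q"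
    using v(4) w(4) by (auto simp: d_def when_def intro: laurent_int_add)
  ultimately show ?thesis
    using v(2,3) w(2,3) unfolding fock_lattice_def by (intro CollectI exI[of _ "B \<union> B'"] exI[of _ d]) simp
qed

lemma fock_lattice_sum: "(\<And>a. a \<in> A \<Longrightarrow> g a \<in> fock_lattice q) \<Longrightarrow> sum g A \<in> fock_lattice q"
  by (induction A rule: infinite_finite_induct) (auto intro: fock_lattice_0 fock_lattice_add)

lemma fock_lattice_single:
  assumes "f \<in> schur_span" "c \<in> laurent_int q"
  shows "fscale c (Poly_Mapping.single m f) \<in> fock_lattice q"
  using assms
proof (induction arbitrary: c rule: schur_span.induct)
  case (schur xs)
  then show ?case
    unfolding fock_lattice_def
    by (intro CollectI exI[of _ "{(xs, m)}"] exI[of _ "\<lambda>_. c"]) simp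
next
  case zero
  then show ?case by (simp add: fock_lattice_0)
next
  case (add f g)
  then show ?case by (simp add: single_add fscale_add fock_lattice_add)
next
  case (uminus f)
  have "fscale c (Poly_Mapping.single m (- f)) = fscale (- c) (Poly_Mapping.single m f)"
    by (simp add: fscale_single sym_const_uminus)
  with uminus show ?case by (simp add: laurent_int_uminus)
qed

lemma fock_lattice_Sum_any:
  assumes "\<And>l. fscale c (Poly_Mapping.single m (g l)) \<in> fock_lattice q"
  shows "fscale c (Poly_Mapping.single m (Sum_any g)) \<in> fock_lattice q"
  unfolding Sum_any.expand_set single_sum_right fscale_sum
  by (rule fock_lattice_sum) (rule assms)

lemma fock_lattice_closed:
  assumes T: "fock_linear T" and v: "v \<in> fock_lattice q"
    and basis: "\<And>xs m c. is_partition xs \<Longrightarrow> c \<in> laurent_int q \<Longrightarrow>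
      fscale c (T (Poly_Mapping.single m (schur xs))) \<in> fock_lattice q"
  shows "T v \<in> fock_lattice q"
proof -
  obtain B c where B: "v = (\<Sum>(xs, m)\<in>B. fscale (c (xs, m)) (Poly_Mapping.single m (schur xs)))"
      "B \<subseteq> {xs. is_partition xs} \<times> UNIV" "\<forall>b\<in>B. c b \<in> laurent_int q"
    using v by (auto simp: fock_lattice_def)
  have "T v = (\<Sum>(xs, m)\<in>B. fscale (c (xs, m)) (T (Poly_Mapping.single m (schur xs))))"
    unfolding B(1) by (simp add: fock_linearD[OF T] case_prod_unfold)
  then show ?thesis
    using B(2,3) by (auto intro!: fock_lattice_sum basis)
qed

lemma fock_lattice_partition_term:
  assumes "q \<noteq> 0" "c \<in> laurent_int q" "b \<Longrightarrow> f \<in> schur_span" "g \<in> schur_span"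
  shows "fscale c (Poly_Mapping.single m (sym_const (q powi e) * f * g when b)) \<in> fock_lattice q"
proof (cases b)
  case True
  have "fscale c (Poly_Mapping.single m (sym_const (q powi e) * f * g)) =
      fscale (q powi e * c) (Poly_Mapping.single m (f * g))"
    by (simp add: fscale_single sym_const_mult[symmetric] mult_ac)
  with True assms show ?thesis
    by (simp add: fock_lattice_single schur_span_mult laurent_int_mult_powi)
qed (simp add: fock_lattice_0)

theorem theorem3p5:
  fixes qh q :: "'k::field_char_0" and i :: int
  assumes "\<not> algebraic qh" and "q = qh ^ 2" and "i \<in> {0, 1}"
  shows
    "(\<forall>n r. \<forall>v\<in>fock_lattice q.
        divided_power q (X_plus q i n) r v \<in> fock_lattice q \<and>
        divided_power q (X_minus q i n) r v \<in> fock_lattice q) \<and>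
     (\<forall>n r m \<mu>. is_partition \<mu> \<longrightarrow>
        divided_power q (X_plus q i n) r (Poly_Mapping.single m (schur \<mu>)) =
          fscale (q powi (- 3 * int (r choose 2) - int r * (n + 1 + 2 * m + i)))
            (Poly_Mapping.single (m + int r)
              (Sum_any (\<lambda>l. sym_const (q powi (- 2 * sum_list l)) *
                   schur l * schur_tuple (shifted_neg l (n + 1 + 2 * m + i) @ \<mu>)
                 when l \<in> partitions_upto r)))) \<and>
     (\<forall>n r m \<mu>. is_partition \<mu> \<longrightarrow>
        divided_power q (X_minus q i n) r (Poly_Mapping.single m (schur (conj_part \<mu>))) =
          fscale ((- 1) powi (int r * (n + 1 + i)) * q powi (int (r choose 2)))
            (Poly_Mapping.single (m - int r)
              (Sum_any (\<lambda>l. sym_const (q powi (2 * sum_list l)) *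
                   schur (conj_part l) *
                   schur_tuple_conj (shifted_neg l (n + 1 - 2 * m - i) @ \<mu>)
                 when l \<in> partitions_upto r))))"
proof -
  have q0: "q \<noteq> 0" using not_algebraic_neq_0[OF assms(1)] assms(2) by simp
  \<comment> \<open>Here \<open>q^n = qh^(2n)\<close>, and a root of unity would be
    algebraic.\<close>
  have q1: "\<forall>n>0. q ^ n \<noteq> 1"
    using not_algebraic_power[OF assms(1), of "2 * _"] assms(2) by (simp add: power_mult)
  have plus_sum: "partition_sum (inverse q) c r \<mu> = Sum_any (\<lambda>l. sym_const (q powi (- 2 * sum_list l)) *
      schur l * schur_tuple (shifted_neg l c @ \<mu>) when l \<in> partitions_upto r)" for c r \<mu>
    by (simp add: partition_sum_def power_int_inverse flip: power_int_minus)
  have minus_sum: "omega (partition_sum q c r \<mu>) = Sum_any (\<lambda>l. sym_const (q powi (2 * sum_list l)) *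
      schur (conj_part l) * schur_tuple_conj (shifted_neg l c @ \<mu>) when l \<in> partitions_upto r)" for c r \<mu>
    unfolding partition_sum_def omega_Sum_any
    by (rule arg_cong[of _ _ Sum_any], rule ext)
       (auto simp: when_def omega.lift_mult omega.lift_const omega_schur schur_tuple_conj_eq
         partitions_upto_def omega.lift_0)
  note plus = divided_power_X_plus[OF q0 q1, where i = i, unfolded plus_sum]
  note minus = divided_power_X_minus[OF q0 q1, where i = i, unfolded minus_sum]
  have "divided_power q (X_plus q i n) r v \<in> fock_lattice q" if "v \<in> fock_lattice q" for n r v
  proof (rule fock_lattice_closed[OF divided_power_linear that])
    show "fock_linear (X_plus q i n)" by (rule fock_linear_X_plus[OF q0 q1])
    fix xs m and c :: 'k assume xs: "is_partition xs" and c: "c \<in> laurent_int q"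
    show "fscale c (divided_power q (X_plus q i n) r (Poly_Mapping.single m (schur xs))) \<in> fock_lattice q"
      unfolding plus[OF xs] fscale_fscale mult.commute[of c]
      by (intro fock_lattice_Sum_any fock_lattice_partition_term q0 c laurent_int_mult_powi
          schur_tuple_in_span schur_span.schur) (simp add: partitions_upto_def)
  qed
  moreover have "divided_power q (X_minus q i n) r v \<in> fock_lattice q" if "v \<in> fock_lattice q" for n r v
  proof (rule fock_lattice_closed[OF divided_power_linear that])
    show "fock_linear (X_minus q i n)" by (rule fock_linear_X_minus[OF q0 q1])
    fix xs m and c :: 'k assume xs: "is_partition xs" and c: "c \<in> laurent_int q"
    have "c * ((- 1) powi e * q powi e') = psign e * (q powi e' * c)" for e e'
      by (simp add: minus_one_powi mult_ac)
    \<comment> \<open>The formula for \<open>X_minus\<close> speaks about conjugates, so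
      \<open>schur xs\<close> is written as the function of the conjugate of
      \<open>conj_part xs\<close>.\<close>
    then show "fscale c (divided_power q (X_minus q i n) r (Poly_Mapping.single m (schur xs))) \<in> fock_lattice q"
      unfolding schur_conj_conj[OF xs, symmetric] minus[OF is_partition_conj_part] fscale_fscale
      by (simp only:)
        (intro fock_lattice_Sum_any fock_lattice_partition_term q0 c laurent_int_mult_powi
          laurent_int_psign schur_tuple_conj_in_span schur_span.schur is_partition_conj_part)
  qed
  ultimately show ?thesis using plus minus by blast
qed

end
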